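(* Let $d\geq 1$ be an integer. Let $\Gamma$ be an amenable discrete group and let $G$ be a discrete group with the $M_d$-AP. Then the wreath product $\Gamma\wr G$ has the $M_d$-AP.
   Context: All groups are discrete, and Hilbert spaces are complex. The wreath product $\Gamma\wr G$ is the semidirect product $G\ltimes\bigoplus_G\Gamma$, where $\bigoplus_G\Gamma$ is the direct sum (finitely supported families) of copies of $\Gamma$ indexed by $G$, on which $G$ acts by shifts. For a group $G$, $\mathbb{C}[G]$ denotes the space of finitely supported functions $G\to\mathbb{C}$. For an integer $d\geq 1$, $M_d(G)$ is the space of all functions $\varphi:G\to\mathbb{C}$ for which there are Hilbert spaces $H_0,\ldots,H_d$ with $H_0=H_d=\mathbb{C}$ and bounded maps $\xi_i:G\to\mathcal{B}(H_i,H_{i-1})$ ($i=1,\ldots,d$) such that $\varphi(t_1\cdots t_d)=\xi_1(t_1)\cdots\xi_d(t_d)$ for all $t_1,\ldots,t_d\in G$. Its norm is $\|\varphi\|_{M_d(G)}=\inf\{\sup_{t\in G}\|\xi_1(t)\|\cdots\sup_{t\in G}\|\xi_d(t)\|\}$, the infimum being over all such decompositions. $X_d(G)$ is the completion of $\mathbb{C}[G]$ for the norm $\|g\|_{X_d(G)}=\sup\{|\sum_{t\in G}\varphi(t)g(t)| : \varphi\in M_d(G),\ \|\varphi\|_{M_d(G)}\leq 1\}$. One has $X_d(G)^*=M_d(G)$ via the duality $\langle\varphi,g\rangle=\sum_{t\in G}\varphi(t)g(t)$ for $g\in\mathbb{C}[G]$. The group $G$ has the $M_d$-AP if the constant function $1$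 is in the $\sigma(M_d(G),X_d(G))$-closure of $\mathbb{C}[G]\subset M_d(G)$. *)

theory Defs
  imports "HOL-Analysis.Analysis" "HOL-Algebra.Product_Groups" "HOL-Algebra.Module"
begin

section \<open>Amenability and wreath products\<close>

text \<open>An invariant mean on the bounded real functions on the carrier of \<open>\<Gamma>\<close>. Positivity only looks at
  values on the carrier, so by linearity \<open>m f\<close> does not depend on \<open>f\<close> outside the carrier.\<close>

definition amenable :: "('g, 'y) monoid_scheme \<Rightarrow> bool" where
  "amenable \<Gamma> \<longleftrightarrow> (\<exists>m :: ('g \<Rightarrow> real) \<Rightarrow> real.
     (\<forall>f g. bounded (f ` carrier \<Gamma>) \<longrightarrow> bounded (g ` carrier \<Gamma>) \<longrightarrow>
        m (\<lambda>x. f x + g x) = m f + m g) \<and>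
     (\<forall>c f. bounded (f ` carrier \<Gamma>) \<longrightarrow> m (\<lambda>x. c * f x) = c * m f) \<and>
     (\<forall>f. bounded (f ` carrier \<Gamma>) \<longrightarrow> (\<forall>x\<in>carrier \<Gamma>. 0 \<le> f x) \<longrightarrow> 0 \<le> m f) \<and>
     m (\<lambda>x. 1) = 1 \<and>
     (\<forall>s\<in>carrier \<Gamma>. \<forall>f. bounded (f ` carrier \<Gamma>) \<longrightarrow> m (\<lambda>x. f (s \<otimes>\<^bsub>\<Gamma>\<^esub> x)) = m f))"

text \<open>\<open>(g, n)\<close> stands for the product \<open>n g\<close>, where \<open>g n g\<^sup>-\<^sup>1 = \<alpha> g n\<close>.\<close>

definition semidirect_product ::
  "('a, 'x) monoid_scheme \<Rightarrow> ('n, 'y) monoid_scheme \<Rightarrow> ('a \<Rightarrow> 'n \<Rightarrow> 'n) \<Rightarrow> ('a \<times> 'n) monoid" where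
  "semidirect_product G N \<alpha> =
     \<lparr>carrier = carrier G \<times> carrier N,
      monoid.mult = (\<lambda>(g, n) (h, m). (g \<otimes>\<^bsub>G\<^esub> h, n \<otimes>\<^bsub>N\<^esub> \<alpha> g m)),
      one = (\<one>\<^bsub>G\<^esub>, \<one>\<^bsub>N\<^esub>)\<rparr>"

definition shift :: "('a, 'x) monoid_scheme \<Rightarrow> 'a \<Rightarrow> ('a \<Rightarrow> 'g) \<Rightarrow> 'a \<Rightarrow> 'g" where
  "shift G g f = (\<lambda>x\<in>carrier G. f (inv\<^bsub>G\<^esub> g \<otimes>\<^bsub>G\<^esub> x))"

definition wreath_product ::
  "('g, 'y) monoid_scheme \<Rightarrow> ('a, 'x) monoid_scheme \<Rightarrow> ('a \<times> ('a \<Rightarrow> 'g)) monoid" where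
  "wreath_product \<Gamma> G = semidirect_product G (sum_group (carrier G) (\<lambda>_. \<Gamma>)) (shift G)"

lemma group_wreath_product:
  assumes \<Gamma>: "group \<Gamma>" and G: "group G"
  shows "group (wreath_product \<Gamma> G)"
proof -
  interpret \<Gamma>: group \<Gamma> by fact
  interpret G: group G by fact
  let ?S = "sum_group (carrier G) (\<lambda>_. \<Gamma>)"
  interpret S: group ?S by (rule sum_group) (rule \<Gamma>)
  have carr: "carrier ?S =
      {x \<in> carrier G \<rightarrow>\<^sub>E carrier \<Gamma>. finite {i \<in> carrier G. x i \<noteq> \<one>\<^bsub>\<Gamma>\<^esub>}}"
    by (rule carrier_sum_group) (rule \<Gamma>)
  have mult: "n \<otimes>\<^bsub>?S\<^esub> m = (\<lambda>x\<in>carrier G. n x \<otimes>\<^bsub>\<Gamma>\<^esub> m x)" for n m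
    by simp
  have shift_closed: "shift G g m \<in> carrier ?S" if g: "g \<in> carrier G" and m: "m \<in> carrier ?S" for g m
  proof -
    have "{i \<in> carrier G. m (inv\<^bsub>G\<^esub> g \<otimes>\<^bsub>G\<^esub> i) \<noteq> \<one>\<^bsub>\<Gamma>\<^esub>} \<subseteq>
        (\<lambda>x. g \<otimes>\<^bsub>G\<^esub> x) ` {i \<in> carrier G. m i \<noteq> \<one>\<^bsub>\<Gamma>\<^esub>}"
    proof
      fix i assume i: "i \<in> {i \<in> carrier G. m (inv\<^bsub>G\<^esub> g \<otimes>\<^bsub>G\<^esub> i) \<noteq> \<one>\<^bsub>\<Gamma>\<^esub>}"
      then have "i = g \<otimes>\<^bsub>G\<^esub> (inv\<^bsub>G\<^esub> g \<otimes>\<^bsub>G\<^esub> i)"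
        using g by (simp add: G.m_assoc[symmetric])
      with i g show "i \<in> (\<lambda>x. g \<otimes>\<^bsub>G\<^esub> x) ` {i \<in> carrier G. m i \<noteq> \<one>\<^bsub>\<Gamma>\<^esub>}"
        by blast
    qed
    then have "finite {i \<in> carrier G. m (inv\<^bsub>G\<^esub> g \<otimes>\<^bsub>G\<^esub> i) \<noteq> \<one>\<^bsub>\<Gamma>\<^esub>}"
      using m unfolding carr by (auto elim: finite_subset)
    then have "finite {i \<in> carrier G. shift G g m i \<noteq> \<one>\<^bsub>\<Gamma>\<^esub>}"
      by (rule rev_finite_subset) (auto simp: shift_def)
    then show ?thesis using m g unfolding carr by (auto simp: shift_def)
  qed
  have shift_mult: "shift G g (n \<otimes>\<^bsub>?S\<^esub> m) = shift G g n \<otimes>\<^bsub>?S\<^esub> shift G g m"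
    if "g \<in> carrier G" for g n m
    unfolding mult using that by (auto simp: shift_def intro!: restrict_ext)
  have shift_shift: "shift G g (shift G h m) = shift G (g \<otimes>\<^bsub>G\<^esub> h) m"
    if "g \<in> carrier G" "h \<in> carrier G" for g h m
    using that by (auto simp: shift_def G.inv_mult_group G.m_assoc intro!: restrict_ext)
  have shift_one: "shift G \<one>\<^bsub>G\<^esub> m = m" if "m \<in> carrier ?S" for m
    using that unfolding carr by (auto simp: shift_def PiE_iff extensional_def fun_eq_iff)
  show ?thesis
    unfolding wreath_product_def semidirect_product_def
  proof (rule groupI, goal_cases)
    case (1 x y)
    then show ?case using shift_closed S.m_closed by (auto simp del: mult_sum_group)
  next
    case 2
    then show ?case using S.one_closed by auto
  next
    case (3 x y z)
    then show ?case
      by (auto simp: G.m_assoc shift_mult shift_shift shift_closed S.m_assoc simp del: mult_sum_group)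
  next
    case (4 x)
    then show ?case using S.l_one by (auto simp: shift_one simp del: mult_sum_group one_sum_group)
  next
    case (5 x)
    then obtain g n where x: "x = (g, n)" "g \<in> carrier G" "n \<in> carrier ?S" by auto
    have 1: "shift G (inv\<^bsub>G\<^esub> g) n \<in> carrier ?S" using x shift_closed by auto
    show ?case
      by (rule bexI[of _ "(inv\<^bsub>G\<^esub> g, inv\<^bsub>?S\<^esub> shift G (inv\<^bsub>G\<^esub> g) n)"])
        (use x 1 S.l_inv S.inv_closed in \<open>auto simp del: mult_sum_group one_sum_group\<close>)
  qed
qed

section \<open>Hilbert spaces and bounded operators\<close>

definition complex_ring :: "complex ring" where
  "complex_ring = \<lparr>carrier = UNIV, monoid.mult = (*), one = 1, zero = 0, add = (+)\<rparr>"

text \<open>A decomposition of a multiplier involves Hilbert spaces that are quantified existentially, so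
  they are records over a carrier set. The ring multiplication and unit inherited from
  \<^term>\<open>module\<close> records are irrelevant. Inner products are linear in the first argument.\<close>

record 'h hilbert = "(complex, 'h) module" +
  hinner :: "'h \<Rightarrow> 'h \<Rightarrow> complex"

definition hnorm :: "('h, 'm) hilbert_scheme \<Rightarrow> 'h \<Rightarrow> real" where
  "hnorm H x = sqrt (Re (hinner H x x))"

locale hilbert_space = module complex_ring H for H :: "('h, 'm) hilbert_scheme" (structure) +
  assumes inner_add: "\<lbrakk>x \<in> carrier H; y \<in> carrier H; z \<in> carrier H\<rbrakk> \<Longrightarrow>
      hinner H (x \<oplus> y) z = hinner H x z + hinner H y z"
    and inner_smult: "\<lbrakk>x \<in> carrier H; z \<in> carrier H\<rbrakk> \<Longrightarrow> hinner H (c \<odot> x) z = c * hinner H x z"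
    and inner_commute: "\<lbrakk>x \<in> carrier H; y \<in> carrier H\<rbrakk> \<Longrightarrow> hinner H y x = cnj (hinner H x y)"
    and inner_nonneg: "x \<in> carrier H \<Longrightarrow> 0 \<le> Re (hinner H x x)"
    and inner_definite: "\<lbrakk>x \<in> carrier H; hinner H x x = 0\<rbrakk> \<Longrightarrow> x = \<zero>"
    and complete: "\<lbrakk>\<And>n. s n \<in> carrier H;
        \<And>e. e > 0 \<Longrightarrow> \<exists>N :: nat. \<forall>m\<ge>N. \<forall>n\<ge>N. hnorm H (s m \<ominus> s n) < e\<rbrakk> \<Longrightarrow>
      \<exists>x\<in>carrier H. (\<lambda>n. hnorm H (s n \<ominus> x)) \<longlonglongrightarrow> 0"

definition bounded_operators ::
  "('h, 'm) hilbert_scheme \<Rightarrow> ('k, 'n) hilbert_scheme \<Rightarrow> ('h \<Rightarrow> 'k) set" where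
  "bounded_operators H K = {T \<in> carrier H \<rightarrow> carrier K.
     (\<forall>x\<in>carrier H. \<forall>y\<in>carrier H. T (x \<oplus>\<^bsub>H\<^esub> y) = T x \<oplus>\<^bsub>K\<^esub> T y) \<and>
     (\<forall>c. \<forall>x\<in>carrier H. T (c \<odot>\<^bsub>H\<^esub> x) = c \<odot>\<^bsub>K\<^esub> T x) \<and>
     (\<exists>C. \<forall>x\<in>carrier H. hnorm K (T x) \<le> C * hnorm H x)}"

definition operator_norm ::
  "('h, 'm) hilbert_scheme \<Rightarrow> ('k, 'n) hilbert_scheme \<Rightarrow> ('h \<Rightarrow> 'k) \<Rightarrow> real" where
  "operator_norm H K T = (SUP x\<in>{x \<in> carrier H. hnorm H x \<le> 1}. hnorm K (T x))"

text \<open>The Hilbert space \<open>\<complex>\<close>, realised on a summand of the carrier type so that it can occur in the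
  same family as other Hilbert spaces.\<close>

definition complex_line :: "(complex + 'v) hilbert" where
  "complex_line = \<lparr>carrier = range Inl,
     monoid.mult = (\<lambda>x y. Inl (projl x * projl y)), one = Inl 1,
     zero = Inl 0, add = (\<lambda>x y. Inl (projl x + projl y)),
     smult = (\<lambda>c x. Inl (c * projl x)),
     hinner = (\<lambda>x y. projl x * cnj (projl y))\<rparr>"

context hilbert_space begin

lemma smult_closed' [simp]: "x \<in> carrier H \<Longrightarrow> c \<odot> x \<in> carrier H"
  using smult_closed by (simp add: complex_ring_def)

lemma minus_eq_smult: assumes "x \<in> carrier H" shows "\<ominus> x = (- 1) \<odot> x"
proof -
  have "(- 1) \<odot> x \<oplus> 1 \<odot> x = (- 1 + 1) \<odot> x"
    using smult_l_distr[of "-1" 1 x] assms by (simp add: complex_ring_def)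
  moreover have "0 \<odot> x = \<zero>" using smult_l_null[of x] assms by (simp add: complex_ring_def)
  moreover have "1 \<odot> x = x" using smult_one[of x] assms by (simp add: complex_ring_def)
  ultimately have "(- 1) \<odot> x \<oplus> x = \<zero>" by simp
  then show ?thesis using assms by (metis M.minus_equality smult_closed')
qed

lemma diff_eq: "x \<in> carrier H \<Longrightarrow> y \<in> carrier H \<Longrightarrow> x \<ominus> y = x \<oplus> (- 1) \<odot> y"
  by (simp add: a_minus_def minus_eq_smult)

lemma inner_diff: "\<lbrakk>x \<in> carrier H; y \<in> carrier H; z \<in> carrier H\<rbrakk> \<Longrightarrow>
    hinner H (x \<ominus> y) z = hinner H x z - hinner H y z"
  by (simp add: diff_eq inner_add inner_smult)

lemma inner_diff_right: "\<lbrakk>x \<in> carrier H; y \<in> carrier H; z \<in> carrier H\<rbrakk> \<Longrightarrow>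
    hinner H z (x \<ominus> y) = hinner H z x - hinner H z y"
  using inner_commute[of "x \<ominus> y" z] inner_commute[of x z] inner_commute[of y z]
  by (simp add: inner_diff M.minus_closed)

lemma inner_smult_right: "\<lbrakk>x \<in> carrier H; z \<in> carrier H\<rbrakk> \<Longrightarrow>
    hinner H z (c \<odot> x) = cnj c * hinner H z x"
  using inner_commute[of "c \<odot> x" z] inner_commute[of x z] by (simp add: inner_smult)

lemma inner_zero: "z \<in> carrier H \<Longrightarrow> hinner H \<zero> z = 0"
  using inner_diff[of z z z] by (simp add: M.r_neg a_minus_def)

lemma inner_zero_right: "z \<in> carrier H \<Longrightarrow> hinner H z \<zero> = 0"
  using inner_commute[of \<zero> z] by (simp add: inner_zero)

lemma inner_self: "x \<in> carrier H \<Longrightarrow> hinner H x x = of_real ((hnorm H x)\<^sup>2)"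
  using inner_commute[of x x] inner_nonneg[of x] by (simp add: hnorm_def complex_eq_iff)

lemma hnorm_nonneg: "x \<in> carrier H \<Longrightarrow> 0 \<le> hnorm H x"
  using inner_nonneg by (simp add: hnorm_def)

lemma hnorm_zero: "hnorm H \<zero> = 0"
  by (simp add: hnorm_def inner_zero)

lemma Cauchy_Schwarz:
  assumes x: "x \<in> carrier H" and y: "y \<in> carrier H"
  shows "cmod (hinner H x y) \<le> hnorm H x * hnorm H y"
proof (cases "hinner H y y = 0")
  case True
  then have "y = \<zero>" using y inner_definite by simp
  then show ?thesis using x by (simp add: inner_zero_right hnorm_zero)
next
  case False
  define n where "n = (hnorm H y)\<^sup>2"
  have n: "hinner H y y = of_real n" unfolding n_def using y by (rule inner_self)
  with False have "n > 0" by (auto simp: n_def)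
  define c where "c = hinner H x y / of_real n"
  define z where "z = x \<ominus> c \<odot> y"
  have z: "z \<in> carrier H" using x y by (simp add: z_def M.minus_closed)
  have "hinner H z y = 0"
    using x y \<open>n > 0\<close> by (simp add: z_def inner_diff inner_smult n c_def)
  then have "hinner H z z = hinner H z x"
    using x y z by (subst (2) z_def) (simp add: inner_diff_right inner_smult_right)
  also have "\<dots> = hinner H x x - c * cnj (hinner H x y)"
    using x y by (simp add: z_def inner_diff inner_smult inner_commute[of x y])
  also have "\<dots> = of_real ((hnorm H x)\<^sup>2 - (cmod (hinner H x y))\<^sup>2 / n)"
    using x complex_norm_square[of "hinner H x y"] by (simp add: inner_self c_def)
  finally have "0 \<le> (hnorm H x)\<^sup>2 - (cmod (hinner H x y))\<^sup>2 / n"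
    using inner_nonneg[OF z] by simp
  then have "(cmod (hinner H x y))\<^sup>2 \<le> (hnorm H x * hnorm H y)\<^sup>2"
    using \<open>n > 0\<close> by (simp add: field_simps n_def power_mult_distrib)
  then show ?thesis
    using hnorm_nonneg x y by (meson mult_nonneg_nonneg power2_le_imp_le)
qed

end

definition closed_subspace :: "('h, 'm) hilbert_scheme \<Rightarrow> 'h set \<Rightarrow> bool" where
  "closed_subspace H S \<longleftrightarrow> S \<subseteq> carrier H \<and> \<zero>\<^bsub>H\<^esub> \<in> S \<and>
     (\<forall>x\<in>S. \<forall>y\<in>S. x \<oplus>\<^bsub>H\<^esub> y \<in> S) \<and> (\<forall>c. \<forall>x\<in>S. c \<odot>\<^bsub>H\<^esub> x \<in> S) \<and>
     (\<forall>s x. (\<forall>n. s n \<in> S) \<longrightarrow> x \<in> carrier H \<longrightarrow>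
        (\<lambda>n. hnorm H (s n \<ominus>\<^bsub>H\<^esub> x)) \<longlonglongrightarrow> 0 \<longrightarrow> x \<in> S)"

definition isometric_onto ::
  "('l, 'k) hilbert_scheme \<Rightarrow> ('h, 'm) hilbert_scheme \<Rightarrow> 'h set \<Rightarrow> ('l \<Rightarrow> 'h) \<Rightarrow> bool" where
  "isometric_onto L H K \<Psi> \<longleftrightarrow> bij_betw \<Psi> (carrier L) K \<and> \<zero>\<^bsub>L\<^esub> \<in> carrier L \<and>
     (\<forall>x\<in>carrier L. \<forall>y\<in>carrier L. x \<oplus>\<^bsub>L\<^esub> y \<in> carrier L) \<and>
     (\<forall>c. \<forall>x\<in>carrier L. c \<odot>\<^bsub>L\<^esub> x \<in> carrier L) \<and>
     \<Psi> \<zero>\<^bsub>L\<^esub> = \<zero>\<^bsub>H\<^esub> \<and>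
     (\<forall>x\<in>carrier L. \<forall>y\<in>carrier L. \<Psi> (x \<oplus>\<^bsub>L\<^esub> y) = \<Psi> x \<oplus>\<^bsub>H\<^esub> \<Psi> y) \<and>
     (\<forall>c. \<forall>x\<in>carrier L. \<Psi> (c \<odot>\<^bsub>L\<^esub> x) = c \<odot>\<^bsub>H\<^esub> \<Psi> x) \<and>
     (\<forall>x\<in>carrier L. \<forall>y\<in>carrier L. hinner L x y = hinner H (\<Psi> x) (\<Psi> y))"

lemma hilbert_space_transfer:
  assumes H: "hilbert_space (H :: ('h, 'm) hilbert_scheme)" and K: "closed_subspace H K"
    and iso: "isometric_onto L H K \<Psi>"
  shows "hilbert_space (L :: ('l, 'k) hilbert_scheme)"
proof -
  have \<Psi>: "bij_betw \<Psi> (carrier L) K" and L0: "\<zero>\<^bsub>L\<^esub> \<in> carrier L"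
    and La: "\<And>x y. x \<in> carrier L \<Longrightarrow> y \<in> carrier L \<Longrightarrow> x \<oplus>\<^bsub>L\<^esub> y \<in> carrier L"
    and Ls: "\<And>c x. x \<in> carrier L \<Longrightarrow> c \<odot>\<^bsub>L\<^esub> x \<in> carrier L"
    and \<Psi>0: "\<Psi> \<zero>\<^bsub>L\<^esub> = \<zero>\<^bsub>H\<^esub>"
    and \<Psi>a: "\<And>x y. x \<in> carrier L \<Longrightarrow> y \<in> carrier L \<Longrightarrow> \<Psi> (x \<oplus>\<^bsub>L\<^esub> y) = \<Psi> x \<oplus>\<^bsub>H\<^esub> \<Psi> y"
    and \<Psi>s: "\<And>c x. x \<in> carrier L \<Longrightarrow> \<Psi> (c \<odot>\<^bsub>L\<^esub> x) = c \<odot>\<^bsub>H\<^esub> \<Psi> x"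
    and \<Psi>i: "\<And>x y. x \<in> carrier L \<Longrightarrow> y \<in> carrier L \<Longrightarrow> hinner L x y = hinner H (\<Psi> x) (\<Psi> y)"
    using iso by (auto simp: isometric_onto_def)
  interpret H: hilbert_space H by fact
  have KH: "K \<subseteq> carrier H" using K by (simp add: closed_subspace_def)
  have mem: "\<Psi> x \<in> K" if "x \<in> carrier L" for x using \<Psi> that by (auto simp: bij_betw_def)
  have memH [simp]: "\<Psi> x \<in> carrier H" if "x \<in> carrier L" for x using mem KH that by auto
  have eqI: "x = y" if "x \<in> carrier L" "y \<in> carrier L" "\<Psi> x = \<Psi> y" for x y
    using \<Psi> that by (auto simp: bij_betw_def inj_on_def)
  have one: "1 \<odot>\<^bsub>H\<^esub> x = x" if "x \<in> carrier H" for x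
    using H.smult_one[OF that] by (simp add: complex_ring_def)
  have neg: "x \<oplus>\<^bsub>H\<^esub> (- 1) \<odot>\<^bsub>H\<^esub> x = \<zero>\<^bsub>H\<^esub>" "(- 1) \<odot>\<^bsub>H\<^esub> x \<oplus>\<^bsub>H\<^esub> x = \<zero>\<^bsub>H\<^esub>" if "x \<in> carrier H" for x
    using that H.M.r_neg H.M.l_neg H.minus_eq_smult by auto
  have LG: "abelian_group L"
  proof (rule abelian_groupI)
    fix x assume x: "x \<in> carrier L"
    show "\<exists>y\<in>carrier L. y \<oplus>\<^bsub>L\<^esub> x = \<zero>\<^bsub>L\<^esub>"
      by (rule bexI[of _ "(- 1) \<odot>\<^bsub>L\<^esub> x"], rule eqI)
        (use x in \<open>auto simp: La Ls L0 \<Psi>a \<Psi>s \<Psi>0 neg\<close>)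
  qed (auto simp: La L0, (auto intro!: eqI simp: La L0 \<Psi>a \<Psi>0 H.M.a_ac))
  have "module complex_ring L"
  proof (rule moduleI)
    show "cring complex_ring" by (rule H.R.cring_axioms) 
    show "abelian_group L" by (rule LG)
    have smult: "(a + b) \<odot>\<^bsub>H\<^esub> x = a \<odot>\<^bsub>H\<^esub> x \<oplus>\<^bsub>H\<^esub> b \<odot>\<^bsub>H\<^esub> x" "(a * b) \<odot>\<^bsub>H\<^esub> x = a \<odot>\<^bsub>H\<^esub> (b \<odot>\<^bsub>H\<^esub> x)"
      "y \<in> carrier H \<Longrightarrow> a \<odot>\<^bsub>H\<^esub> (x \<oplus>\<^bsub>H\<^esub> y) = a \<odot>\<^bsub>H\<^esub> x \<oplus>\<^bsub>H\<^esub> a \<odot>\<^bsub>H\<^esub> y"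
      if "x \<in> carrier H" for a b x y
      using H.smult_l_distr[of a b x] H.smult_assoc1[of a b x] H.smult_r_distr[of a x y] that
      by (auto simp: complex_ring_def)
    fix a b x y assume x: "x \<in> carrier L"
    show "a \<odot>\<^bsub>L\<^esub> x \<in> carrier L" using x by (rule Ls)
    show "(a \<oplus>\<^bsub>complex_ring\<^esub> b) \<odot>\<^bsub>L\<^esub> x = a \<odot>\<^bsub>L\<^esub> x \<oplus>\<^bsub>L\<^esub> b \<odot>\<^bsub>L\<^esub> x"
      by (rule eqI) (use x in \<open>auto simp: complex_ring_def La Ls \<Psi>a \<Psi>s smult\<close>)
    show "(a \<otimes>\<^bsub>complex_ring\<^esub> b) \<odot>\<^bsub>L\<^esub> x = a \<odot>\<^bsub>L\<^esub> (b \<odot>\<^bsub>L\<^esub> x)"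
      by (rule eqI) (use x in \<open>auto simp: complex_ring_def La Ls \<Psi>a \<Psi>s smult\<close>)
    show "\<one>\<^bsub>complex_ring\<^esub> \<odot>\<^bsub>L\<^esub> x = x"
      by (rule eqI) (use x in \<open>auto simp: complex_ring_def La Ls \<Psi>a \<Psi>s one\<close>)
    show "a \<odot>\<^bsub>L\<^esub> (x \<oplus>\<^bsub>L\<^esub> y) = a \<odot>\<^bsub>L\<^esub> x \<oplus>\<^bsub>L\<^esub> a \<odot>\<^bsub>L\<^esub> y" if "y \<in> carrier L"
      by (rule eqI) (use x that in \<open>auto simp: complex_ring_def La Ls \<Psi>a \<Psi>s smult\<close>)
  qed
  then interpret L: module complex_ring L .
  have min: "x \<ominus>\<^bsub>L\<^esub> y \<in> carrier L \<and> \<Psi> (x \<ominus>\<^bsub>L\<^esub> y) = \<Psi> x \<ominus>\<^bsub>H\<^esub> \<Psi> y"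
    if "x \<in> carrier L" "y \<in> carrier L" for x y
  proof -
    have "y \<oplus>\<^bsub>L\<^esub> (- 1) \<odot>\<^bsub>L\<^esub> y = \<zero>\<^bsub>L\<^esub>" using that by (intro eqI) (auto simp: La Ls L0 \<Psi>a \<Psi>s \<Psi>0 neg)
    then have "\<ominus>\<^bsub>L\<^esub> y = (- 1) \<odot>\<^bsub>L\<^esub> y"
      using that Ls by (metis L.M.a_comm L.M.minus_equality)
    then show ?thesis using that by (auto simp: a_minus_def La Ls \<Psi>a \<Psi>s H.minus_eq_smult)
  qed
  have norm: "hnorm L x = hnorm H (\<Psi> x)" if "x \<in> carrier L" for x
    using that by (simp add: hnorm_def \<Psi>i)
  show ?thesis
  proof unfold_locales
    fix s :: "nat \<Rightarrow> 'l"
    assume s: "\<And>n. s n \<in> carrier L"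
      and C: "\<And>e. 0 < e \<Longrightarrow> \<exists>N. \<forall>m\<ge>N. \<forall>n\<ge>N. hnorm L (s m \<ominus>\<^bsub>L\<^esub> s n) < e"
    have "\<exists>N. \<forall>m\<ge>N. \<forall>n\<ge>N. hnorm H (\<Psi> (s m) \<ominus>\<^bsub>H\<^esub> \<Psi> (s n)) < e" if "e > 0" for e
      using C[OF that] s min norm by (metis (no_types, lifting))
    then obtain x where x: "x \<in> carrier H" "(\<lambda>n. hnorm H (\<Psi> (s n) \<ominus>\<^bsub>H\<^esub> x)) \<longlonglongrightarrow> 0"
      using H.complete[of "\<lambda>n. \<Psi> (s n)"] s by auto
    then have "x \<in> K"
      using K mem[OF s] unfolding closed_subspace_def
      by (elim conjE allE[where x = "\<lambda>n. \<Psi> (s n)"] allE[where x = x]) simp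
    then obtain y where y: "y \<in> carrier L" "\<Psi> y = x" using \<Psi> by (auto simp: bij_betw_def)
    show "\<exists>y\<in>carrier L. (\<lambda>n. hnorm L (s n \<ominus>\<^bsub>L\<^esub> y)) \<longlonglongrightarrow> 0"
      by (rule bexI[of _ y]) (use x y s min norm in auto)
  next
    fix x assume "x \<in> carrier L" "hinner L x x = 0"
    then show "x = \<zero>\<^bsub>L\<^esub>" using H.inner_definite[of "\<Psi> x"] by (auto intro!: eqI simp: L0 \<Psi>i \<Psi>0)
  qed (auto simp: La Ls \<Psi>i \<Psi>a \<Psi>s H.inner_add H.inner_smult H.inner_nonneg intro: H.inner_commute)
qed

lemma cring_complex_ring: "cring complex_ring"
proof (rule cringI)
  show "abelian_group complex_ring"
    by (rule abelian_groupI) (auto simp: complex_ring_def intro: exI[of _ "- x" for x] add.left_inverse)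
  show "comm_monoid complex_ring" by (rule comm_monoidI) (auto simp: complex_ring_def)
qed (auto simp: complex_ring_def algebra_simps)

lemma hilbert_space_complex_line: "hilbert_space (complex_line :: (complex + 'v) hilbert)"
proof -
  have G: "abelian_group (complex_line :: (complex + 'v) hilbert)"
  proof (rule abelian_groupI)
    fix x :: "complex + 'v" assume "x \<in> carrier complex_line"
    then show "\<exists>y\<in>carrier complex_line. y \<oplus>\<^bsub>complex_line\<^esub> x = \<zero>\<^bsub>complex_line\<^esub>"
      by (intro bexI[of _ "Inl (- projl x)"]) (auto simp: complex_line_def)
  qed (auto simp: complex_line_def)
  have "module complex_ring (complex_line :: (complex + 'v) hilbert)"
    by (rule moduleI[OF cring_complex_ring G])
      (auto simp: complex_line_def complex_ring_def algebra_simps)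
  then interpret L: module complex_ring "complex_line :: (complex + 'v) hilbert" .
  have neg: "\<ominus>\<^bsub>complex_line\<^esub> (Inl c :: complex + 'v) = Inl (- c)" for c
    by (rule L.M.minus_equality) (auto simp: complex_line_def)
  have diff: "Inl a \<ominus>\<^bsub>complex_line\<^esub> (Inl c :: complex + 'v) = Inl (a - c)" for a c
    unfolding a_minus_def neg by (simp add: complex_line_def)
  have norm: "hnorm complex_line (Inl c :: complex + 'v) = cmod c" for c
    by (simp add: hnorm_def complex_line_def cmod_def power2_eq_square)
  show ?thesis
  proof unfold_locales
    fix s :: "nat \<Rightarrow> complex + 'v"
    assume s: "\<And>n. s n \<in> carrier complex_line"
      and C: "\<And>e. 0 < e \<Longrightarrow> \<exists>N. \<forall>m\<ge>N. \<forall>n\<ge>N. hnorm complex_line (s m \<ominus>\<^bsub>complex_line\<^esub> s n) < e"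
    have s': "s n = Inl (projl (s n))" for n using s[of n] by (auto simp: complex_line_def)
    have 1: "hnorm complex_line (s m \<ominus>\<^bsub>complex_line\<^esub> Inl c) = cmod (projl (s m) - c)" for m c
      by (subst s') (simp only: diff norm)
    have "Cauchy (\<lambda>n. projl (s n))"
      unfolding Cauchy_def dist_norm using C 1 s' by metis
    then obtain c where "(\<lambda>n. projl (s n)) \<longlonglongrightarrow> c" 
      using Cauchy_convergent_iff convergent_def by blast
    then have "(\<lambda>n. cmod (projl (s n) - c)) \<longlonglongrightarrow> 0"
      by (simp add: LIM_zero tendsto_norm_zero)
    then show "\<exists>x\<in>carrier complex_line. (\<lambda>n. hnorm complex_line (s n \<ominus>\<^bsub>complex_line\<^esub> x)) \<longlonglongrightarrow> 0"
      by (intro bexI[of _ "Inl c"]) (simp add: 1, simp add: complex_line_def)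
  qed (auto simp: complex_line_def algebra_simps)
qed


lemma closed_subspace_carrier: assumes "hilbert_space H" shows "closed_subspace H (carrier H)"
proof -
  interpret hilbert_space H by fact
  show ?thesis by (simp add: closed_subspace_def)
qed

lemma closed_subspace_Inter:
  assumes "\<And>S. S \<in> \<S> \<Longrightarrow> closed_subspace H S" "\<S> \<noteq> {}"
  shows "closed_subspace H (\<Inter>\<S>)"
  unfolding closed_subspace_def
proof (intro conjI allI impI ballI)
  show "\<Inter>\<S> \<subseteq> carrier H" using assms by (meson Inter_subset closed_subspace_def)
  fix s x assume "\<forall>n. s n \<in> \<Inter>\<S>" "x \<in> carrier H" "(\<lambda>n. hnorm H (s n \<ominus>\<^bsub>H\<^esub> x)) \<longlonglongrightarrow> 0"
  then show "x \<in> \<Inter>\<S>" using assms unfolding closed_subspace_def by blast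
qed (use assms in \<open>auto simp: closed_subspace_def\<close>)

lemma (in hilbert_space) closed_subspace_orthogonal:
  assumes w: "w \<in> carrier H"
  shows "closed_subspace H {x \<in> carrier H. hinner H x w = 0}"
  unfolding closed_subspace_def
proof (intro conjI allI impI ballI)
  fix s x
  assume s: "\<forall>n. s n \<in> {x \<in> carrier H. hinner H x w = 0}" and x: "x \<in> carrier H"
    and lim: "(\<lambda>n. hnorm H (s n \<ominus> x)) \<longlonglongrightarrow> 0"
  have "cmod (hinner H x w) \<le> hnorm H (s n \<ominus> x) * hnorm H w" for n
  proof -
    have "hinner H (s n \<ominus> x) w = - hinner H x w" using s x w by (simp add: inner_diff)
    then show ?thesis using Cauchy_Schwarz[of "s n \<ominus> x" w] s x w by (simp add: M.minus_closed)
  qed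
  moreover have "(\<lambda>n. hnorm H (s n \<ominus> x) * hnorm H w) \<longlonglongrightarrow> 0"
    using tendsto_mult_left_zero[OF lim] by simp
  ultimately have "cmod (hinner H x w) \<le> 0" by (meson LIMSEQ_le_const)
  then show "x \<in> {x \<in> carrier H. hinner H x w = 0}" using x by simp
qed (use w in \<open>auto simp: inner_zero inner_add inner_smult\<close>)

lemma bounded_operators_closed: "T \<in> bounded_operators H K \<Longrightarrow> x \<in> carrier H \<Longrightarrow> T x \<in> carrier K"
  by (auto simp: bounded_operators_def)

lemma bounded_operators_diff:
  assumes H: "hilbert_space H" and K: "hilbert_space K" and T: "T \<in> bounded_operators H K"
    and x: "x \<in> carrier H" and y: "y \<in> carrier H"
  shows "T (x \<ominus>\<^bsub>H\<^esub> y) = T x \<ominus>\<^bsub>K\<^esub> T y"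
proof -
  interpret H: hilbert_space H by fact
  interpret K: hilbert_space K by fact
  show ?thesis using T x y unfolding bounded_operators_def
    by (auto simp: H.diff_eq K.diff_eq Pi_iff)
qed

lemma bounded_operators_zero:
  assumes H: "hilbert_space H" and K: "hilbert_space K" and T: "T \<in> bounded_operators H K"
  shows "T \<zero>\<^bsub>H\<^esub> = \<zero>\<^bsub>K\<^esub>"
proof -
  interpret H: hilbert_space H by fact
  interpret K: hilbert_space K by fact
  have "T \<zero>\<^bsub>H\<^esub> \<in> carrier K" using T unfolding bounded_operators_def by blast
  then show ?thesis using bounded_operators_diff[OF H K T, of "\<zero>\<^bsub>H\<^esub>" "\<zero>\<^bsub>H\<^esub>"]
    by (simp add: H.M.r_neg K.M.r_neg a_minus_def)
qed

lemma closed_subspace_preimage: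
  assumes H: "hilbert_space H" and K: "hilbert_space K" and T: "T \<in> bounded_operators H K"
    and S: "closed_subspace K S"
  shows "closed_subspace H {x \<in> carrier H. T x \<in> S}"
  unfolding closed_subspace_def
proof (intro conjI allI impI ballI)
  interpret H: hilbert_space H by fact
  interpret K: hilbert_space K by fact
  fix s x
  assume s: "\<forall>n. s n \<in> {x \<in> carrier H. T x \<in> S}" and x: "x \<in> carrier H"
    and lim: "(\<lambda>n. hnorm H (s n \<ominus>\<^bsub>H\<^esub> x)) \<longlonglongrightarrow> 0"
  obtain C where C: "\<And>x. x \<in> carrier H \<Longrightarrow> hnorm K (T x) \<le> C * hnorm H x"
    using T unfolding bounded_operators_def by blast
  have Tx: "T x \<in> carrier K" if "x \<in> carrier H" for x using T that by (auto simp: bounded_operators_def)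
  have "(\<lambda>n. C * hnorm H (s n \<ominus>\<^bsub>H\<^esub> x)) \<longlonglongrightarrow> 0" using tendsto_mult_right_zero[OF lim] by simp
  then have "(\<lambda>n. hnorm K (T (s n) \<ominus>\<^bsub>K\<^esub> T x)) \<longlonglongrightarrow> 0"
  proof (rule Lim_null_comparison[rotated], intro eventuallyI)
    fix n
    have n: "s n \<in> carrier H" using s by simp
    then have "T (s n) \<ominus>\<^bsub>K\<^esub> T x = T (s n \<ominus>\<^bsub>H\<^esub> x)"
      using bounded_operators_diff[OF H K T _ x] by simp
    moreover have "0 \<le> hnorm K (T (s n \<ominus>\<^bsub>H\<^esub> x))"
      using n x by (intro K.hnorm_nonneg Tx) (simp add: H.M.minus_closed)
    ultimately show "norm (hnorm K (T (s n) \<ominus>\<^bsub>K\<^esub> T x)) \<le> C * hnorm H (s n \<ominus>\<^bsub>H\<^esub> x)"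
      using C n x by (simp add: H.M.minus_closed)
  qed
  moreover have "\<forall>n. T (s n) \<in> S" using s by simp
  ultimately have "T x \<in> S"
    using S Tx[OF x] unfolding closed_subspace_def
    by (elim conjE allE[where x = "\<lambda>n. T (s n)"] allE[where x = "T x"]) simp
  then show "x \<in> {x \<in> carrier H. T x \<in> S}" using x by simp
next
  show "\<zero>\<^bsub>H\<^esub> \<in> {x \<in> carrier H. T x \<in> S}"
    using bounded_operators_zero[OF H K T] S closed_subspace_carrier[OF H]
    by (auto simp: closed_subspace_def)
qed (use T S closed_subspace_carrier[OF H] in \<open>auto simp: bounded_operators_def closed_subspace_def\<close>)

lemma isometric_copy_exists:
  assumes "hilbert_space (H :: ('h, 'm) hilbert_scheme)" "closed_subspace H K" "inj_on (\<Phi> :: 'h \<Rightarrow> 'l) K"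
  shows "\<exists>(L :: 'l hilbert) \<Psi>. isometric_onto L H K \<Psi>"
proof -
  define \<Psi> where "\<Psi> = inv_into K \<Phi>"
  define L :: "'l hilbert" where "L = \<lparr>carrier = \<Phi> ` K, monoid.mult = undefined, one = undefined,
    zero = \<Phi> \<zero>\<^bsub>H\<^esub>, add = (\<lambda>x y. \<Phi> (\<Psi> x \<oplus>\<^bsub>H\<^esub> \<Psi> y)), smult = (\<lambda>c x. \<Phi> (c \<odot>\<^bsub>H\<^esub> \<Psi> x)),
    hinner = (\<lambda>x y. hinner H (\<Psi> x) (\<Psi> y))\<rparr>"
  have "\<Psi> (\<Phi> x) = x" if "x \<in> K" for x using assms(3) that by (simp add: \<Psi>_def)
  then have "isometric_onto L H K \<Psi>"
    using assms(2) assms(3) by (auto simp: isometric_onto_def L_def closed_subspace_def \<Psi>_def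
        intro!: bij_betw_inv_into inj_on_imp_bij_betw)
  then show ?thesis by blast
qed

section \<open>The spaces \<open>M\<^sub>d(G)\<close> and \<open>X\<^sub>d(G)\<close>\<close>

text \<open>The maps \<open>\<xi>\<^sub>i\<close> form a decomposition of \<open>\<phi>\<close> through the Hilbert spaces \<open>H\<^sub>i\<close>. An operator from \<open>\<complex>\<close> to
  \<open>\<complex>\<close> is identified with its value at \<open>1\<close>.\<close>

definition Md_decomposition ::
  "nat \<Rightarrow> ('a, 'x) monoid_scheme \<Rightarrow> ('a \<Rightarrow> complex) \<Rightarrow> (nat \<Rightarrow> (complex + 'v) hilbert) \<Rightarrow>
    (nat \<Rightarrow> 'a \<Rightarrow> complex + 'v \<Rightarrow> complex + 'v) \<Rightarrow> bool" where
  "Md_decomposition d G \<phi> H \<xi> \<longleftrightarrow>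
     (\<forall>i\<le>d. hilbert_space (H i)) \<and> H 0 = complex_line \<and> H d = complex_line \<and>
     (\<forall>i\<in>{1..d}.
        (\<forall>t\<in>carrier G. \<xi> i t \<in> bounded_operators (H i) (H (i - 1))) \<and>
        bdd_above ((\<lambda>t. operator_norm (H i) (H (i - 1)) (\<xi> i t)) ` carrier G)) \<and>
     (\<forall>t\<in>{1..d} \<rightarrow> carrier G.
        foldr (\<lambda>i. \<xi> i (t i)) [1..<Suc d] (Inl 1) =
        Inl (\<phi> (foldr (\<lambda>i s. t i \<otimes>\<^bsub>G\<^esub> s) [1..<Suc d] \<one>\<^bsub>G\<^esub>)))"

text \<open>There is no quantification over types, so \<open>M\<^sub>d(G)\<close> only refers to Hilbert spaces whose carrier lies
  in the following type. The lemma \<open>Md_decomposition_universe\<close> shows that this loses nothing: a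
  decomposition through Hilbert spaces in any type gives one in this type, with operator norms that
  are at most as large.\<close>

type_synonym 'a universe = "complex + ('a list \<Rightarrow> complex)"

lemma Md_decomposition_universe:
  fixes G :: "('a, 'x) monoid_scheme" and H :: "nat \<Rightarrow> (complex + 'v) hilbert"
  assumes D: "Md_decomposition d G \<phi> H \<xi>"
  shows "\<exists>(H' :: nat \<Rightarrow> 'a universe hilbert) \<xi>'. Md_decomposition d G \<phi> H' \<xi>' \<and>
    (\<forall>i\<in>{1..d}. \<forall>t\<in>carrier G.
       operator_norm (H' i) (H' (i - 1)) (\<xi>' i t) \<le> operator_norm (H i) (H (i - 1)) (\<xi> i t))"
proof -
  have Hi: "hilbert_space (H i)" if "i \<le> d" for i using D that by (auto simp: Md_decomposition_def)
  have H0d: "H 0 = complex_line" "H d = complex_line" using D by (auto simp: Md_decomposition_def)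
  have \<xi>: "\<xi> i t \<in> bounded_operators (H i) (H (i - 1))" if "1 \<le> i" "i \<le> d" "t \<in> carrier G" for i t
    using D that by (auto simp: Md_decomposition_def)
  have bdd: "bdd_above ((\<lambda>t. operator_norm (H i) (H (i - 1)) (\<xi> i t)) ` carrier G)"
    if "1 \<le> i" "i \<le> d" for i
    using D that by (auto simp: Md_decomposition_def)
  let ?P = "{1..d} \<rightarrow> carrier G"
  define g where "g = (\<lambda>i t. foldr (\<lambda>j. \<xi> j (t j)) [Suc i..<Suc d] (Inl 1))"
  have gd: "g d t = Inl 1" for t by (simp add: g_def)
  have gi: "g i t = \<xi> (Suc i) (t (Suc i)) (g (Suc i) t)" if "i < d" for i t
    unfolding g_def using that by (subst upt_conv_Cons) auto
  have gcong: "g i t = g i t'" if "\<And>j. i < j \<Longrightarrow> j \<le> d \<Longrightarrow> t j = t' j" for i t t'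
    unfolding g_def using that by (intro foldr_cong) auto
  have g_mem: "g i t \<in> carrier (H i)" if t: "t \<in> ?P" and i: "i \<le> d" for i t
    using i
  proof (induction rule: inc_induct)
    case base
    then show ?case by (simp add: gd H0d complex_line_def)
  next
    case (step n)
    have "t (Suc n) \<in> carrier G" using Pi_mem[OF t, of "Suc n"] step.hyps(2) by simp
    then have "\<xi> (Suc n) (t (Suc n)) (g (Suc n) t) \<in> carrier (H (Suc n - 1))"
      using step by (intro bounded_operators_closed[OF \<xi>]) auto
    then show ?case using gi[OF step.hyps(2)] by simp
  qed
  define \<S> where "\<S> = (\<lambda>i. {S. closed_subspace (H i) S \<and> (\<forall>t\<in>?P. g i t \<in> S)})"
  define K where "K = (\<lambda>i. if i = 0 \<or> i = d then carrier (H i) else \<Inter>(\<S> i))"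
  have K: "closed_subspace (H i) (K i)" if "i \<le> d" for i
  proof (cases "i = 0 \<or> i = d")
    case True
    then show ?thesis using closed_subspace_carrier Hi that by (auto simp: K_def)
  next
    case False
    have "carrier (H i) \<in> \<S> i"
      using closed_subspace_carrier[OF Hi] g_mem that by (auto simp: \<S>_def)
    then show ?thesis using False unfolding K_def
      by (auto intro!: closed_subspace_Inter simp: \<S>_def)
  qed
  have \<xi>K: "\<xi> i t v \<in> K (i - 1)" if i: "1 \<le> i" "i \<le> d" and t: "t \<in> carrier G" and v: "v \<in> K i" for i t v
  proof (cases "i = 1")
    case True
    have "v \<in> carrier (H i)" using K[of i] v i by (auto simp: closed_subspace_def)
    then show ?thesis using bounded_operators_closed[OF \<xi>[OF i t]] True by (simp add: K_def)
  next
    case False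
    have "\<xi> i t v \<in> S" if S: "S \<in> \<S> (i - 1)" for S
    proof -
      define Q where "Q = {x \<in> carrier (H i). \<xi> i t x \<in> S}"
      have Q: "closed_subspace (H i) Q"
        unfolding Q_def using closed_subspace_preimage[OF Hi Hi \<xi>[OF i t]] S i by (auto simp: \<S>_def)
      have gQ: "g i t' \<in> Q" if t': "t' \<in> ?P" for t'
      proof -
        have "\<xi> i t (g i t') = \<xi> i ((t'(i := t)) i) (g i (t'(i := t)))"
          by (simp add: gcong[of i t' "t'(i := t)"])
        also have "\<dots> = g (i - 1) (t'(i := t))" using gi[of "i - 1" "t'(i := t)"] i by simp
        also have "\<dots> \<in> S" using S t' t by (auto simp: \<S>_def Pi_iff)
        finally show ?thesis using g_mem[OF t'] i by (simp add: Q_def)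
      qed
      have "v \<in> Q"
      proof (cases "i = d")
        case True
        then obtain c where c: "v = Inl c" using v by (auto simp: K_def H0d complex_line_def)
        have "(Inl 1 :: complex + 'v) \<in> Q" using gQ[of "\<lambda>_. t"] t True by (simp add: gd)
        then have "c \<odot>\<^bsub>H i\<^esub> Inl 1 \<in> Q" using Q by (auto simp: closed_subspace_def)
        then show ?thesis by (simp add: c True H0d complex_line_def)
      next
        case nd: False
        then have "Q \<in> \<S> i" using Q gQ by (auto simp: \<S>_def)
        then show ?thesis using v nd i by (auto simp: K_def)
      qed
      then show ?thesis by (simp add: Q_def)
    qed
    then show ?thesis using False i by (auto simp: K_def)
  qed
  have "\<exists>(L :: 'a universe hilbert) \<Psi>. isometric_onto L (H i) (K i) \<Psi> \<and>
      (i = 0 \<or> i = d \<longrightarrow> L = complex_line \<and> (\<forall>c. \<Psi> (Inl c) = Inl c))" if i: "i \<le> d" for i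
  proof (cases "i = 0 \<or> i = d")
    case True
    then have "H i = complex_line" "K i = carrier complex_line" using H0d by (auto simp: K_def)
    then show ?thesis
      by (intro exI[of _ "complex_line :: 'a universe hilbert"] exI[of _ "\<lambda>x. Inl (projl x)"])
        (auto simp: isometric_onto_def complex_line_def bij_betw_def inj_on_def image_image)
  next
    case False
    interpret Hi: hilbert_space "H i" using Hi i .
    define \<Phi> :: "complex + 'v \<Rightarrow> 'a universe" where "\<Phi> = (\<lambda>v. Inr (\<lambda>ts. hinner (H i) v (g i ((!) ts))))"
    have KH: "K i \<subseteq> carrier (H i)" using K[OF i] by (simp add: closed_subspace_def)
    have "inj_on \<Phi> (K i)"
    proof (rule inj_onI)
      fix u v assume uv: "u \<in> K i" "v \<in> K i" and eq: "\<Phi> u = \<Phi> v"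
      have eq': "hinner (H i) u (g i t) = hinner (H i) v (g i t)" for t
      proof -
        have "g i t = g i ((!) (map t [0..<Suc d]))" by (rule gcong) (simp add: nth_append del: upt_Suc)
        then show ?thesis using eq by (auto simp: \<Phi>_def fun_eq_iff simp del: upt_Suc)
      qed
      define w where "w = u \<ominus>\<^bsub>H i\<^esub> v"
      have w: "w \<in> K i"
        using K[OF i] uv KH by (simp add: w_def closed_subspace_def Hi.diff_eq subset_iff)
      then have wH: "w \<in> carrier (H i)" using KH by auto
      have "hinner (H i) (g i t) w = 0" if "t \<in> ?P" for t
        using Hi.inner_commute[OF wH g_mem[OF that i]] eq'[of t] uv KH g_mem[OF that i]
        by (simp add: w_def Hi.inner_diff subset_iff)
      then have "{x \<in> carrier (H i). hinner (H i) x w = 0} \<in> \<S> i"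
        using Hi.closed_subspace_orthogonal[OF wH] g_mem i by (auto simp: \<S>_def)
      then have "hinner (H i) w w = 0" using w False by (auto simp: K_def)
      then have "w = \<zero>\<^bsub>H i\<^esub>" using Hi.inner_definite wH by simp
      moreover have uvH: "u \<in> carrier (H i)" "v \<in> carrier (H i)" using uv KH by auto
      ultimately have "\<ominus>\<^bsub>H i\<^esub> (\<ominus>\<^bsub>H i\<^esub> v) = u"
        by (intro Hi.M.minus_equality) (auto simp: w_def a_minus_def)
      then show "u = v" using uvH by simp
    qed
    then show ?thesis using isometric_copy_exists[OF Hi[OF i] K[OF i]] False by blast
  qed
  then obtain L :: "nat \<Rightarrow> 'a universe hilbert" and \<Psi> where
    iso: "\<And>i. i \<le> d \<Longrightarrow> isometric_onto (L i) (H i) (K i) (\<Psi> i)"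
    and ends: "\<And>i. i \<le> d \<Longrightarrow> i = 0 \<or> i = d \<longrightarrow> L i = complex_line \<and> (\<forall>c. \<Psi> i (Inl c) = Inl c)"
    by metis
  have Li: "hilbert_space (L i)" if "i \<le> d" for i
    using hilbert_space_transfer[OF Hi K iso] that by blast
  have KH: "K i \<subseteq> carrier (H i)" if "i \<le> d" for i using K[OF that] by (simp add: closed_subspace_def)
  have \<Psi>_mem: "\<Psi> i x \<in> K i" if "i \<le> d" "x \<in> carrier (L i)" for i x
    using iso[OF that(1)] that(2) by (auto simp: isometric_onto_def bij_betw_def)
  have \<Psi>_inj: "x = y" if "i \<le> d" "x \<in> carrier (L i)" "y \<in> carrier (L i)" "\<Psi> i x = \<Psi> i y" for i x y
    using iso[OF that(1)] that by (auto simp: isometric_onto_def bij_betw_def inj_on_def)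
  have \<Psi>_add: "\<Psi> i (x \<oplus>\<^bsub>L i\<^esub> y) = \<Psi> i x \<oplus>\<^bsub>H i\<^esub> \<Psi> i y" "x \<oplus>\<^bsub>L i\<^esub> y \<in> carrier (L i)"
    if "i \<le> d" "x \<in> carrier (L i)" "y \<in> carrier (L i)" for i x y
    using iso[OF that(1)] that by (auto simp: isometric_onto_def)
  have \<Psi>_smult: "\<Psi> i (c \<odot>\<^bsub>L i\<^esub> x) = c \<odot>\<^bsub>H i\<^esub> \<Psi> i x" "c \<odot>\<^bsub>L i\<^esub> x \<in> carrier (L i)"
    if "i \<le> d" "x \<in> carrier (L i)" for i c x
    using iso[OF that(1)] that by (auto simp: isometric_onto_def)
  have \<Psi>_norm: "hnorm (H i) (\<Psi> i x) = hnorm (L i) x" if "i \<le> d" "x \<in> carrier (L i)" for i x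
    using iso[OF that(1)] that by (auto simp: isometric_onto_def hnorm_def)
  define \<xi>' where "\<xi>' = (\<lambda>i t x. inv_into (carrier (L (i - 1))) (\<Psi> (i - 1)) (\<xi> i t (\<Psi> i x)))"
  have \<xi>': "\<xi>' i t x \<in> carrier (L (i - 1)) \<and> \<Psi> (i - 1) (\<xi>' i t x) = \<xi> i t (\<Psi> i x)"
    if "1 \<le> i" "i \<le> d" "t \<in> carrier G" "x \<in> carrier (L i)" for i t x
  proof -
    have "\<xi> i t (\<Psi> i x) \<in> K (i - 1)" using \<xi>K \<Psi>_mem that by simp
    also have "K (i - 1) = \<Psi> (i - 1) ` carrier (L (i - 1))"
      using iso[of "i - 1"] that by (auto simp: isometric_onto_def bij_betw_def)
    finally show ?thesis unfolding \<xi>'_def by (auto intro: inv_into_into f_inv_into_f)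
  qed
  have bop: "\<xi>' i t \<in> bounded_operators (L i) (L (i - 1))"
    if i: "1 \<le> i" "i \<le> d" and t: "t \<in> carrier G" for i t
  proof -
    note T = \<xi>[OF i t] and T' = \<xi>'[OF i t]
    have i': "i - 1 \<le> d" using i by simp
    have \<Psi>H: "\<Psi> i x \<in> carrier (H i)" if "x \<in> carrier (L i)" for x using \<Psi>_mem KH i that by blast
    show ?thesis
      unfolding bounded_operators_def
    proof (intro CollectI conjI ballI allI)
      show "\<xi>' i t \<in> carrier (L i) \<rightarrow> carrier (L (i - 1))" using T' by auto
      show "\<xi>' i t (x \<oplus>\<^bsub>L i\<^esub> y) = \<xi>' i t x \<oplus>\<^bsub>L (i - 1)\<^esub> \<xi>' i t y"
        if "x \<in> carrier (L i)" "y \<in> carrier (L i)" for x y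
        by (rule \<Psi>_inj[OF i']) (use that T T' i \<Psi>_add i' \<Psi>H in \<open>auto simp: bounded_operators_def\<close>)
      show "\<xi>' i t (c \<odot>\<^bsub>L i\<^esub> x) = c \<odot>\<^bsub>L (i - 1)\<^esub> \<xi>' i t x" if "x \<in> carrier (L i)" for c x
        by (rule \<Psi>_inj[OF i']) (use that T T' i \<Psi>_smult i' \<Psi>H in \<open>auto simp: bounded_operators_def\<close>)
      obtain C where C: "\<And>x. x \<in> carrier (H i) \<Longrightarrow> hnorm (H (i - 1)) (\<xi> i t x) \<le> C * hnorm (H i) x"
        using T unfolding bounded_operators_def by blast
      show "\<exists>C. \<forall>x\<in>carrier (L i). hnorm (L (i - 1)) (\<xi>' i t x) \<le> C * hnorm (L i) x"
        using C[OF \<Psi>H] T' \<Psi>_norm i i' by metis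
    qed
  qed
  have opn: "operator_norm (L i) (L (i - 1)) (\<xi>' i t) \<le> operator_norm (H i) (H (i - 1)) (\<xi> i t)"
    if i: "1 \<le> i" "i \<le> d" and t: "t \<in> carrier G" for i t
    unfolding operator_norm_def
  proof (rule cSUP_least)
    interpret Li: hilbert_space "L i" using Li i by simp
    show "{x \<in> carrier (L i). hnorm (L i) x \<le> 1} \<noteq> {}"
      using Li.hnorm_zero by (auto intro!: exI[of _ "\<zero>\<^bsub>L i\<^esub>"])
    fix x assume x: "x \<in> {x \<in> carrier (L i). hnorm (L i) x \<le> 1}"
    obtain C where C: "\<And>x. x \<in> carrier (H i) \<Longrightarrow> hnorm (H (i - 1)) (\<xi> i t x) \<le> C * hnorm (H i) x"
      using \<xi>[OF i t] unfolding bounded_operators_def by blast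
    have b: "bdd_above ((\<lambda>x. hnorm (H (i - 1)) (\<xi> i t x)) ` {x \<in> carrier (H i). hnorm (H i) x \<le> 1})"
    proof (rule bdd_aboveI2)
      fix x assume x: "x \<in> {x \<in> carrier (H i). hnorm (H i) x \<le> 1}"
      then have "hnorm (H (i - 1)) (\<xi> i t x) \<le> C * hnorm (H i) x" using C by simp
      also have "\<dots> \<le> \<bar>C\<bar> * 1"
        using x hilbert_space.hnorm_nonneg[OF Hi[OF i(2)], of x] by (intro mult_mono) auto
      finally show "hnorm (H (i - 1)) (\<xi> i t x) \<le> \<bar>C\<bar>" by simp
    qed
    have "hnorm (L (i - 1)) (\<xi>' i t x) = hnorm (H (i - 1)) (\<xi> i t (\<Psi> i x))"
      using \<xi>'[OF i t, of x] \<Psi>_norm[of "i - 1" "\<xi>' i t x"] x i by simp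
    also have "\<dots> \<le> (SUP x\<in>{x \<in> carrier (H i). hnorm (H i) x \<le> 1}. hnorm (H (i - 1)) (\<xi> i t x))"
      using x \<Psi>_mem[OF i(2)] KH[OF i(2)] \<Psi>_norm[OF i(2)] by (intro cSUP_upper b) auto
    finally show "hnorm (L (i - 1)) (\<xi>' i t x) \<le>
      (SUP x\<in>{x \<in> carrier (H i). hnorm (H i) x \<le> 1}. hnorm (H (i - 1)) (\<xi> i t x))" .
  qed
  have bdd': "bdd_above ((\<lambda>t. operator_norm (L i) (L (i - 1)) (\<xi>' i t)) ` carrier G)"
    if i: "1 \<le> i" "i \<le> d" for i
  proof -
    from bdd[OF i] obtain B where "\<And>t. t \<in> carrier G \<Longrightarrow> operator_norm (H i) (H (i - 1)) (\<xi> i t) \<le> B"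
      by (auto simp: bdd_above_def)
    then show ?thesis using opn[OF i] by (intro bdd_aboveI2[of _ _ B]) (meson order_trans)
  qed
  have chain: "foldr (\<lambda>i. \<xi>' i (t i)) [1..<Suc d] (Inl 1) =
      Inl (\<phi> (foldr (\<lambda>i s. t i \<otimes>\<^bsub>G\<^esub> s) [1..<Suc d] \<one>\<^bsub>G\<^esub>))" if t: "t \<in> ?P" for t
  proof -
    define h where "h = (\<lambda>i. foldr (\<lambda>j. \<xi>' j (t j)) [Suc i..<Suc d] (Inl 1))"
    have hi: "h i = \<xi>' (Suc i) (t (Suc i)) (h (Suc i))" if "i < d" for i
      unfolding h_def using that by (subst upt_conv_Cons) auto
    have h: "h i \<in> carrier (L i) \<and> \<Psi> i (h i) = g i t" if "i \<le> d" for i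
      using that
    proof (induction rule: inc_induct)
      case base
      show ?case using ends[of d] by (simp add: h_def gd complex_line_def)
    next
      case (step n)
      have "t (Suc n) \<in> carrier G" using Pi_mem[OF t, of "Suc n"] step.hyps(2) by simp
      then show ?case
        using \<xi>'[of "Suc n" "t (Suc n)" "h (Suc n)"] step.IH step.hyps(2)
        unfolding hi[OF step.hyps(2)] gi[OF step.hyps(2)] by simp
    qed
    obtain c where c: "h 0 = Inl c" using h[of 0] ends[of 0] by (auto simp: complex_line_def)
    have "g 0 t = Inl c" using h[of 0] ends[of 0] c by simp
    moreover have "g 0 t = Inl (\<phi> (foldr (\<lambda>i s. t i \<otimes>\<^bsub>G\<^esub> s) [1..<Suc d] \<one>\<^bsub>G\<^esub>))"
      using D t by (simp add: g_def Md_decomposition_def del: upt_Suc)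
    ultimately show ?thesis using c by (simp add: h_def del: upt_Suc)
  qed
  have "Md_decomposition d G \<phi> L \<xi>'"
    unfolding Md_decomposition_def using Li ends bop bdd' chain by (auto simp del: upt_Suc)
  then show ?thesis using opn by (intro exI[of _ L] exI[of _ \<xi>']) simp
qed

text \<open>Functions on \<open>G\<close> are represented by functions on the type that vanish outside the carrier.\<close>

definition Md :: "nat \<Rightarrow> ('a, 'x) monoid_scheme \<Rightarrow> ('a \<Rightarrow> complex) set" where
  "Md d G = {\<phi>. (\<forall>t. t \<notin> carrier G \<longrightarrow> \<phi> t = 0) \<and>
     (\<exists>(H :: nat \<Rightarrow> 'a universe hilbert) \<xi>. Md_decomposition d G \<phi> H \<xi>)}"

definition Md_norm :: "nat \<Rightarrow> ('a, 'x) monoid_scheme \<Rightarrow> ('a \<Rightarrow> complex) \<Rightarrow> real" where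
  "Md_norm d G \<phi> =
     Inf {(\<Prod>i=1..d. SUP t\<in>carrier G. operator_norm (H i) (H (i - 1)) (\<xi> i t)) |
       (H :: nat \<Rightarrow> 'a universe hilbert) \<xi>. Md_decomposition d G \<phi> H \<xi>}"

definition finsupp :: "('a, 'x) monoid_scheme \<Rightarrow> ('a \<Rightarrow> complex) set" where
  "finsupp G = {g. finite {t. g t \<noteq> 0} \<and> {t. g t \<noteq> 0} \<subseteq> carrier G}"

definition pairing :: "('a \<Rightarrow> complex) \<Rightarrow> ('a \<Rightarrow> complex) \<Rightarrow> complex" where
  "pairing \<phi> g = (\<Sum>t | g t \<noteq> 0. \<phi> t * g t)"

definition Xd_norm :: "nat \<Rightarrow> ('a, 'x) monoid_scheme \<Rightarrow> ('a \<Rightarrow> complex) \<Rightarrow> real" where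
  "Xd_norm d G g = (SUP \<phi>\<in>{\<phi> \<in> Md d G. Md_norm d G \<phi> \<le> 1}. cmod (pairing \<phi> g))"

text \<open>The completion of \<open>\<complex>[G]\<close>: Cauchy sequences modulo null sequences.\<close>

definition Xd_Cauchy :: "nat \<Rightarrow> ('a, 'x) monoid_scheme \<Rightarrow> (nat \<Rightarrow> 'a \<Rightarrow> complex) set" where
  "Xd_Cauchy d G = {s. (\<forall>n. s n \<in> finsupp G) \<and>
     (\<forall>e>0. \<exists>N. \<forall>m\<ge>N. \<forall>n\<ge>N. Xd_norm d G (\<lambda>t. s m t - s n t) < e)}"

definition Xd_rel ::
  "nat \<Rightarrow> ('a, 'x) monoid_scheme \<Rightarrow> ((nat \<Rightarrow> 'a \<Rightarrow> complex) \<times> (nat \<Rightarrow> 'a \<Rightarrow> complex)) set" where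
  "Xd_rel d G = {(s, s'). s \<in> Xd_Cauchy d G \<and> s' \<in> Xd_Cauchy d G \<and>
     (\<lambda>n. Xd_norm d G (\<lambda>t. s n t - s' n t)) \<longlonglongrightarrow> 0}"

definition Xd :: "nat \<Rightarrow> ('a, 'x) monoid_scheme \<Rightarrow> (nat \<Rightarrow> 'a \<Rightarrow> complex) set set" where
  "Xd d G = Xd_Cauchy d G // Xd_rel d G"

text \<open>The continuous extension of \<^term>\<open>pairing\<close> to the completion.\<close>

definition Xd_pairing :: "('a \<Rightarrow> complex) \<Rightarrow> (nat \<Rightarrow> 'a \<Rightarrow> complex) set \<Rightarrow> complex" where
  "Xd_pairing \<phi> x = the_elem ((\<lambda>s. lim (\<lambda>n. pairing \<phi> (s n))) ` x)"

definition Md_weak_topology :: "nat \<Rightarrow> ('a, 'x) monoid_scheme \<Rightarrow> ('a \<Rightarrow> complex) topology" where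
  "Md_weak_topology d G =
     topology_generated_by {{\<phi> \<in> Md d G. Xd_pairing \<phi> x \<in> U} | x U. x \<in> Xd d G \<and> open U}"

definition Md_AP :: "nat \<Rightarrow> ('a, 'x) monoid_scheme \<Rightarrow> bool" where
  "Md_AP d G \<longleftrightarrow> indicator (carrier G) \<in> Md_weak_topology d G closure_of finsupp G"

end

theory Submission
  imports Defs
begin

text \<open>The wreath product \<open>W = \<Gamma> \<wr> G\<close> is an extension of \<open>G\<close> by the direct sum of copies of \<open>\<Gamma>\<close>. The proof shows
  that the \<open>M\<^sub>d\<close>-AP passes from a quotient \<open>q : W \<rightarrow> G\<close> with amenable kernel \<open>N\<close> to \<open>W\<close>
  (\<open>Md_AP_extension\<close>); amenability is used in the form of almost invariant vectors in \<open>\<ell>\<^sup>2(N)\<close>.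

  Composition with \<open>q\<close> is a contraction from \<open>M\<^sub>d(G)\<close> to \<open>M\<^sub>d(W)\<close> (\<open>Md_pullback\<close>), and it is the adjoint of summation
  along the fibres of \<open>q\<close>. So if \<open>\<phi>\<close> in \<open>\<complex>[G]\<close> is weakly close to \<open>1\<close>, then \<open>\<phi> \<circ> q\<close> is weakly close to \<open>1\<close>. The
  support of \<open>\<phi> \<circ> q\<close> is a finite union of cosets of \<open>N\<close>. To make it finite, one multiplies on each coset by a
  translate of a positive definite function \<open>n \<mapsto> \<langle>\<lambda>(n) f, f\<rangle>\<close> with a finitely supported, almost invariant
  unit vector \<open>f\<close> on \<open>N\<close>. The result is a single coefficient of the regular representation of \<open>W\<close>, at vectors
  of norm \<open>\<parallel>\<phi>\<parallel>\<^sub>2\<close> and \<open>1\<close>. Coefficients \<open>\<langle>\<lambda>(x) a, b\<rangle>\<close> of a representation factor through any number of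
  operators, so their \<open>M\<^sub>d\<close> norm is at most \<open>\<parallel>a\<parallel> \<parallel>b\<parallel>\<close> (\<open>regular_coefficient_Md\<close>). Thus the approximations stay
  bounded in \<open>M\<^sub>d(W)\<close> while they converge pointwise to \<open>\<phi> \<circ> q\<close> (\<open>regular_approximation_of_pullback\<close>); on bounded sets
  this is weak convergence, since \<open>\<complex>[W]\<close> is dense in \<open>X\<^sub>d(W)\<close>.

  Almost invariant vectors for \<open>\<Gamma>\<close> come from an invariant mean by Day's theorem (\<open>l1_almost_invariant\<close>): if no
  finitely supported weight is almost invariant, then a linear programming duality
  (\<open>bounded_solution_of_duality\<close>) yields a bounded function with mean zero that is bounded below by a positive
  constant. The duality is obtained from Blackwell's approachability theorem for finitely many
  inequalities and from Tychonoff's theorem for all of them. Tensor products of almost invariant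
  vectors for \<open>\<Gamma>\<close> are almost invariant vectors for the direct sum (\<open>almost_invariant_vectors_sum_group\<close>).\<close>

section \<open>A duality principle for bounded solutions of linear inequalities\<close>

text \<open>Blackwell's approachability argument. The left side of the inequality is the squared distance of
  the accumulated payoff vector from the nonnegative orthant. The next strategy is a reply to the
  current vector of deficits, with which its payoff has a nonnegative scalar product; hence the
  squared distance grows by at most \<open>card X * L\<^sup>2\<close> per round.\<close>

lemma approachability:
  fixes u :: "'k \<Rightarrow> 'x \<Rightarrow> real"
  assumes X: "finite X" and L: "\<And>k x. k \<in> K \<Longrightarrow> x \<in> X \<Longrightarrow> \<bar>u k x\<bar> \<le> L"
    and resp: "\<And>w. (\<And>x. x \<in> X \<Longrightarrow> 0 \<le> w x) \<Longrightarrow> \<exists>k\<in>K. 0 \<le> (\<Sum>x\<in>X. w x * u k x)"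
  shows "\<exists>k. (\<forall>i<n. k i \<in> K) \<and>
    (\<Sum>x\<in>X. (max 0 (- (\<Sum>i<n. u (k i) x)))\<^sup>2) \<le> real n * (real (card X) * L\<^sup>2)"
proof (induction n)
  case 0
  then show ?case by simp
next
  case (Suc n)
  then obtain k where k: "\<And>i. i < n \<Longrightarrow> k i \<in> K"
    and le: "(\<Sum>x\<in>X. (max 0 (- (\<Sum>i<n. u (k i) x)))\<^sup>2) \<le> real n * (real (card X) * L\<^sup>2)" by auto
  define w where "w x = max 0 (- (\<Sum>i<n. u (k i) x))" for x
  obtain k' where k': "k' \<in> K" "0 \<le> (\<Sum>x\<in>X. w x * u k' x)" using resp[of w] by (auto simp: w_def)
  have step: "(max 0 (- (\<Sum>i<Suc n. u ((k(n := k')) i) x)))\<^sup>2 \<le> (w x)\<^sup>2 - 2 * (w x * u k' x) + L\<^sup>2"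
    if x: "x \<in> X" for x
  proof -
    have eq: "(\<Sum>i<Suc n. u ((k(n := k')) i) x) = (\<Sum>i<n. u (k i) x) + u k' x" by simp
    have "max 0 (- (\<Sum>i<Suc n. u ((k(n := k')) i) x)) \<le> \<bar>w x - u k' x\<bar>"
      unfolding eq w_def by linarith
    then have "(max 0 (- (\<Sum>i<Suc n. u ((k(n := k')) i) x)))\<^sup>2 \<le> \<bar>w x - u k' x\<bar>\<^sup>2"
      by (intro power_mono) simp_all
    then have "(max 0 (- (\<Sum>i<Suc n. u ((k(n := k')) i) x)))\<^sup>2 \<le> (w x - u k' x)\<^sup>2"
      by (simp only: power2_abs)
    also have "\<dots> = (w x)\<^sup>2 - 2 * (w x * u k' x) + (u k' x)\<^sup>2" by (simp add: power2_diff algebra_simps)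
    also have "(u k' x)\<^sup>2 \<le> L\<^sup>2" using L[OF k'(1) x] by (metis abs_ge_zero power2_abs power_mono)
    finally show ?thesis by simp
  qed
  have "(\<Sum>x\<in>X. (max 0 (- (\<Sum>i<Suc n. u ((k(n := k')) i) x)))\<^sup>2) \<le>
      (\<Sum>x\<in>X. (w x)\<^sup>2 - 2 * (w x * u k' x) + L\<^sup>2)" by (rule sum_mono) (rule step)
  also have "\<dots> = (\<Sum>x\<in>X. (w x)\<^sup>2) - 2 * (\<Sum>x\<in>X. w x * u k' x) + real (card X) * L\<^sup>2"
    by (simp add: sum.distrib sum_subtractf sum_distrib_left)
  also have "\<dots> \<le> real (Suc n) * (real (card X) * L\<^sup>2)"
    using le k'(2) by (simp add: w_def algebra_simps)
  finally show ?case using k k' by (intro exI[of _ "k(n := k')"]) (auto simp: less_Suc_eq)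
qed

text \<open>The squared deficit of a sum of \<open>n\<close> payoffs is linear in \<open>n\<close>, so the deficit of their average is of
  order \<open>1 / sqrt n\<close>.\<close>

lemma approachability_average:
  fixes u :: "'k \<Rightarrow> 'x \<Rightarrow> real"
  assumes X: "finite X" and L: "\<And>k x. k \<in> K \<Longrightarrow> x \<in> X \<Longrightarrow> \<bar>u k x\<bar> \<le> L"
    and resp: "\<And>w. (\<And>x. x \<in> X \<Longrightarrow> 0 \<le> w x) \<Longrightarrow> \<exists>k\<in>K. 0 \<le> (\<Sum>x\<in>X. w x * u k x)"
    and \<delta>: "\<delta> > 0"
  shows "\<exists>n k. n > 0 \<and> (\<forall>i<n. k i \<in> K) \<and> (\<forall>x\<in>X. - \<delta> \<le> (\<Sum>i<n. u (k i) x) / real n)"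
proof -
  define C where "C = real (card X) * L\<^sup>2"
  obtain m :: nat where m: "C / \<delta>\<^sup>2 < real m" using reals_Archimedean2 by blast
  define n where "n = Suc m"
  have "C < real m * \<delta>\<^sup>2" using m \<delta> by (simp add: divide_less_eq)
  also have "\<dots> \<le> \<delta>\<^sup>2 * real n" by (simp add: n_def algebra_simps)
  finally have n: "C < \<delta>\<^sup>2 * real n" "n > 0" by (simp_all add: n_def)
  obtain k where k: "\<forall>i<n. k i \<in> K"
    and le: "(\<Sum>x\<in>X. (max 0 (- (\<Sum>i<n. u (k i) x)))\<^sup>2) \<le> real n * C"
    using approachability[of X K u L n, OF X L resp] unfolding C_def by blast
  have "- \<delta> \<le> (\<Sum>i<n. u (k i) x) / real n" if x: "x \<in> X" for x
  proof -
    have "(max 0 (- (\<Sum>i<n. u (k i) x)))\<^sup>2 \<le> real n * C"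
      using member_le_sum[OF x, of "\<lambda>x. (max 0 (- (\<Sum>i<n. u (k i) x)))\<^sup>2"] X le by simp
    also have "\<dots> \<le> real n * (\<delta>\<^sup>2 * real n)" using n by (intro mult_left_mono) auto
    also have "\<dots> = (\<delta> * real n)\<^sup>2" by (simp add: power2_eq_square)
    finally have "max 0 (- (\<Sum>i<n. u (k i) x)) \<le> \<delta> * real n"
      by (rule power2_le_imp_le) (use \<delta> in simp)
    then show ?thesis using n by (simp add: field_simps)
  qed
  then show ?thesis using k n by blast
qed

text \<open>Each inequality involves finitely many coordinates and so defines a closed subset of the cube
  \<open>[-1, 1]\<^sup>I\<close>, which is compact by Tychonoff's theorem.\<close>

lemma bounded_solution_compactness:
  fixes c :: "'x \<Rightarrow> 'i \<Rightarrow> real"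
  assumes fin: "\<And>X. finite X \<Longrightarrow> X \<subseteq> Y \<Longrightarrow>
      \<exists>h. (\<forall>i. \<bar>h i\<bar> \<le> 1) \<and> (\<forall>x\<in>X. r \<le> (\<Sum>i\<in>S x. c x i * h i))"
  shows "\<exists>h. (\<forall>i. \<bar>h i\<bar> \<le> (1::real)) \<and> (\<forall>x\<in>Y. r \<le> (\<Sum>i\<in>S x. c x i * h i))"
proof -
  define B where "B = (PiE UNIV (\<lambda>_. {-1..1}) :: ('i \<Rightarrow> real) set)"
  have "compactin (product_topology (\<lambda>_. euclidean) UNIV) B"
    unfolding B_def compactin_PiE by auto
  then have B: "compact B" by (simp add: euclidean_product_topology)
  have B_iff: "h \<in> B \<longleftrightarrow> (\<forall>i. \<bar>h i\<bar> \<le> 1)" for h by (auto simp: B_def abs_le_iff minus_le_iff)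
  define T where "T x = {h. r \<le> (\<Sum>i\<in>S x. c x i * h i)}" for x
  have T: "closed (T x)" for x
    unfolding T_def by (intro closed_Collect_le continuous_intros continuous_on_product_coordinates)
  have "B \<inter> \<Inter>(T ` Y) \<noteq> {}"
  proof (rule compact_imp_fip_image[OF B])
    show "closed (T x)" for x by (rule T)
    fix X assume "finite X" "X \<subseteq> Y"
    from fin[OF this] show "B \<inter> \<Inter>(T ` X) \<noteq> {}" by (auto simp: B_iff T_def)
  qed
  then obtain h where "h \<in> B" "\<And>x. x \<in> Y \<Longrightarrow> h \<in> T x" by blast
  then show ?thesis by (intro exI[of _ h]) (auto simp: B_iff T_def)
qed

text \<open>The hypothesis says that every nonnegative combination of the inequalities with right side \<open>\<epsilon>\<close> has
  a solution in the cube, which depends on the combination. For a finite set of inequalities,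
  approachability turns such solutions into an average that solves all of them, up to an
  arbitrarily small error; here half of \<open>\<epsilon>\<close> is given away. Compactness then treats all inequalities
  at once. This plays the role of a separation theorem in the space of summable functions.\<close>

lemma bounded_solution_of_duality:
  fixes c :: "'x \<Rightarrow> 'i \<Rightarrow> real"
  assumes S: "\<And>x. finite (S x)" and \<epsilon>: "\<epsilon> > 0"
    and dual: "\<And>X w. finite X \<Longrightarrow> X \<subseteq> Y \<Longrightarrow> (\<And>x. 0 \<le> w x) \<Longrightarrow> (\<And>x. x \<notin> X \<Longrightarrow> w x = 0) \<Longrightarrow>
      \<exists>h. (\<forall>i. \<bar>h i\<bar> \<le> 1) \<and> \<epsilon> * (\<Sum>x\<in>X. w x) \<le> (\<Sum>x\<in>X. w x * (\<Sum>i\<in>S x. c x i * h i))"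
  shows "\<exists>h. (\<forall>i. \<bar>h i\<bar> \<le> (1::real)) \<and> (\<forall>x\<in>Y. \<epsilon> / 2 \<le> (\<Sum>i\<in>S x. c x i * h i))"
proof (rule bounded_solution_compactness)
  fix X assume X: "finite X" "X \<subseteq> Y"
  define K where "K = {h :: 'i \<Rightarrow> real. \<forall>i. \<bar>h i\<bar> \<le> 1}"
  define u where "u h x = (\<Sum>i\<in>S x. c x i * h i) - \<epsilon>" for h x
  define L where "L = (\<Sum>x\<in>X. \<Sum>i\<in>S x. \<bar>c x i\<bar>) + \<epsilon>"
  have L: "\<bar>u h x\<bar> \<le> L" if "h \<in> K" "x \<in> X" for h x
  proof -
    have "\<bar>\<Sum>i\<in>S x. c x i * h i\<bar> \<le> (\<Sum>i\<in>S x. \<bar>c x i * h i\<bar>)" by (rule sum_abs)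
    also have "\<dots> \<le> (\<Sum>i\<in>S x. \<bar>c x i\<bar>)"
      using that(1) by (intro sum_mono) (auto simp: K_def abs_mult intro: mult_left_le)
    also have "\<dots> \<le> (\<Sum>x\<in>X. \<Sum>i\<in>S x. \<bar>c x i\<bar>)"
      by (rule member_le_sum[OF that(2)]) (auto simp: X sum_nonneg)
    finally show ?thesis using \<epsilon> unfolding u_def L_def by linarith
  qed
  have resp: "\<exists>h\<in>K. 0 \<le> (\<Sum>x\<in>X. w x * u h x)" if w: "\<And>x. x \<in> X \<Longrightarrow> 0 \<le> w x" for w
  proof -
    define w' where "w' x = (if x \<in> X then w x else 0)" for x
    obtain h where h: "\<forall>i. \<bar>h i\<bar> \<le> 1"
      and le: "\<epsilon> * (\<Sum>x\<in>X. w' x) \<le> (\<Sum>x\<in>X. w' x * (\<Sum>i\<in>S x. c x i * h i))"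
      using dual[OF X, of w'] w unfolding w'_def by fastforce
    have "(\<Sum>x\<in>X. w x * u h x) = (\<Sum>x\<in>X. w' x * (\<Sum>i\<in>S x. c x i * h i) - \<epsilon> * w' x)"
      by (intro sum.cong) (simp_all add: u_def w'_def right_diff_distrib)
    also have "\<dots> = (\<Sum>x\<in>X. w' x * (\<Sum>i\<in>S x. c x i * h i)) - \<epsilon> * (\<Sum>x\<in>X. w' x)"
      by (simp only: sum_subtractf sum_distrib_left)
    finally have "(\<Sum>x\<in>X. w x * u h x) =
      (\<Sum>x\<in>X. w' x * (\<Sum>i\<in>S x. c x i * h i)) - \<epsilon> * (\<Sum>x\<in>X. w' x)" .
    then show ?thesis using h le by (intro bexI[of _ h]) (auto simp: K_def)
  qed
  obtain n k where n: "n > 0" and k: "\<And>i. i < n \<Longrightarrow> k i \<in> K"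
    and ge: "\<And>x. x \<in> X \<Longrightarrow> - (\<epsilon> / 2) \<le> (\<Sum>i<n. u (k i) x) / real n"
    using approachability_average[OF X(1) L resp, of "\<epsilon> / 2"] \<epsilon> by auto
  define h where "h i = (\<Sum>j<n. k j i) / real n" for i
  have "\<bar>h i\<bar> \<le> 1" for i
  proof -
    have "\<bar>\<Sum>j<n. k j i\<bar> \<le> (\<Sum>j<n. \<bar>k j i\<bar>)" by (rule sum_abs)
    also have "\<dots> \<le> (\<Sum>j<n. 1)" using k by (intro sum_mono) (auto simp: K_def)
    finally show ?thesis using n by (simp add: h_def)
  qed
  moreover have "\<epsilon> / 2 \<le> (\<Sum>i\<in>S x. c x i * h i)" if "x \<in> X" for x
  proof -
    have "(\<Sum>j<n. u (k j) x) = (\<Sum>j<n. \<Sum>i\<in>S x. c x i * k j i) - real n * \<epsilon>"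
      by (simp add: u_def sum_subtractf)
    also have "(\<Sum>j<n. \<Sum>i\<in>S x. c x i * k j i) = real n * (\<Sum>i\<in>S x. c x i * h i)"
    proof -
      have eq: "real n * (c x i * h i) = c x i * (\<Sum>j<n. k j i)" for i using n by (simp add: h_def)
      have "real n * (\<Sum>i\<in>S x. c x i * h i) = (\<Sum>i\<in>S x. c x i * (\<Sum>j<n. k j i))"
        unfolding sum_distrib_left[of "real n"] eq ..
      then show ?thesis by (subst sum.swap) (simp add: sum_distrib_left)
    qed
    finally have eq: "(\<Sum>j<n. u (k j) x) = real n * (\<Sum>i\<in>S x. c x i * h i) - real n * \<epsilon>" .
    have "- (\<epsilon> / 2) * real n \<le> (\<Sum>j<n. u (k j) x)" using ge[OF that] n by (simp add: pos_le_divide_eq)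
    then have "real n * (\<epsilon> / 2) \<le> real n * (\<Sum>i\<in>S x. c x i * h i)"
      unfolding eq by (simp add: mult.commute)
    then show ?thesis using n by simp
  qed
  ultimately show "\<exists>h. (\<forall>i. \<bar>h i\<bar> \<le> 1) \<and> (\<forall>x\<in>X. \<epsilon> / 2 \<le> (\<Sum>i\<in>S x. c x i * h i))" by blast
qed

section \<open>Almost invariant vectors\<close>

text \<open>The sum \<open>\<Sum>x. f x * f (k x)\<close> is the coefficient \<open>\<langle>\<lambda>(k) f, f\<rangle>\<close> of the left regular representation \<open>\<lambda>\<close> at
  the unit vector \<open>f\<close>, so it is close to \<open>1\<close> exactly if \<open>\<lambda>(k) f\<close> is close to \<open>f\<close>.\<close>

definition almost_invariant_vectors :: "('g, 'y) monoid_scheme \<Rightarrow> bool" where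
  "almost_invariant_vectors \<Gamma> \<longleftrightarrow> (\<forall>E \<epsilon>. finite E \<longrightarrow> E \<subseteq> carrier \<Gamma> \<longrightarrow> \<epsilon> > 0 \<longrightarrow>
     (\<exists>S (f :: 'g \<Rightarrow> real). finite S \<and> S \<subseteq> carrier \<Gamma> \<and> (\<forall>x. x \<notin> S \<longrightarrow> f x = 0) \<and>
        (\<Sum>x\<in>S. (f x)\<^sup>2) = 1 \<and> (\<forall>k\<in>E. 1 - \<epsilon> \<le> (\<Sum>x\<in>S. f x * f (k \<otimes>\<^bsub>\<Gamma>\<^esub> x)))))"

text \<open>Both sums are rewritten over the same set \<open>Y\<close>, which carries the translated and the original
  weight, so that their difference becomes a sum of differences of weights.\<close>

lemma sum_translate:
  fixes w :: "'g \<Rightarrow> real"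
  assumes "group \<Gamma>" and s: "s \<in> carrier \<Gamma>" and X: "finite X" "X \<subseteq> carrier \<Gamma>"
    and w: "\<And>x. x \<notin> X \<Longrightarrow> w x = 0"
  defines "Y \<equiv> X \<union> (\<lambda>x. s \<otimes>\<^bsub>\<Gamma>\<^esub> x) ` X"
  shows "(\<Sum>x\<in>X. w x * h (s \<otimes>\<^bsub>\<Gamma>\<^esub> x)) = (\<Sum>y\<in>Y. w (inv\<^bsub>\<Gamma>\<^esub> s \<otimes>\<^bsub>\<Gamma>\<^esub> y) * h y)"
    and "(\<Sum>x\<in>X. w x * h x) = (\<Sum>y\<in>Y. w y * h y)"
proof -
  interpret group \<Gamma> by fact
  have "(\<Sum>x\<in>X. w x * h (s \<otimes>\<^bsub>\<Gamma>\<^esub> x)) = (\<Sum>y\<in>(\<lambda>x. s \<otimes>\<^bsub>\<Gamma>\<^esub> x) ` X. w (inv\<^bsub>\<Gamma>\<^esub> s \<otimes>\<^bsub>\<Gamma>\<^esub> y) * h y)"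
  proof (subst sum.reindex)
    show "inj_on (\<lambda>x. s \<otimes>\<^bsub>\<Gamma>\<^esub> x) X" using inj_on_subset[OF inj_on_cmult[OF s] X(2)] .
    show "(\<Sum>x\<in>X. w x * h (s \<otimes>\<^bsub>\<Gamma>\<^esub> x)) =
        (\<Sum>x\<in>X. ((\<lambda>y. w (inv\<^bsub>\<Gamma>\<^esub> s \<otimes>\<^bsub>\<Gamma>\<^esub> y) * h y) \<circ> (\<lambda>x. s \<otimes>\<^bsub>\<Gamma>\<^esub> x)) x)"
      using s X by (intro sum.cong) (auto simp: m_assoc[symmetric])
  qed
  also have "\<dots> = (\<Sum>y\<in>Y. w (inv\<^bsub>\<Gamma>\<^esub> s \<otimes>\<^bsub>\<Gamma>\<^esub> y) * h y)"
  proof (rule sum.mono_neutral_left)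
    show "\<forall>y\<in>Y - (\<lambda>x. s \<otimes>\<^bsub>\<Gamma>\<^esub> x) ` X. w (inv\<^bsub>\<Gamma>\<^esub> s \<otimes>\<^bsub>\<Gamma>\<^esub> y) * h y = 0"
    proof
      fix y assume y: "y \<in> Y - (\<lambda>x. s \<otimes>\<^bsub>\<Gamma>\<^esub> x) ` X"
      then have "y \<in> carrier \<Gamma>" using s X by (auto simp: Y_def)
      then have "y = s \<otimes>\<^bsub>\<Gamma>\<^esub> (inv\<^bsub>\<Gamma>\<^esub> s \<otimes>\<^bsub>\<Gamma>\<^esub> y)" using s by (simp add: m_assoc[symmetric])
      then have "inv\<^bsub>\<Gamma>\<^esub> s \<otimes>\<^bsub>\<Gamma>\<^esub> y \<notin> X" using y by blast
      then show "w (inv\<^bsub>\<Gamma>\<^esub> s \<otimes>\<^bsub>\<Gamma>\<^esub> y) * h y = 0" using w by simp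
    qed
  qed (auto simp: X Y_def)
  finally show "(\<Sum>x\<in>X. w x * h (s \<otimes>\<^bsub>\<Gamma>\<^esub> x)) = (\<Sum>y\<in>Y. w (inv\<^bsub>\<Gamma>\<^esub> s \<otimes>\<^bsub>\<Gamma>\<^esub> y) * h y)" .
  show "(\<Sum>x\<in>X. w x * h x) = (\<Sum>y\<in>Y. w y * h y)"
    by (rule sum.mono_neutral_left) (auto simp: X Y_def w)
qed

text \<open>Day's theorem for finitely supported weights. If no weight is almost invariant, then the weight
  \<open>w\<close> is detected by the signs of \<open>w (s\<^sup>-\<^sup>1 y) - w y\<close>. By duality there is one bounded family \<open>h\<close> such that
  \<open>\<Sum>s\<in>E. h (s, s x) - h (s, x)\<close> is at least \<open>\<epsilon> / 2\<close> for every \<open>x\<close>. An invariant mean sends this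
  function of \<open>x\<close> to \<open>0\<close> by invariance and to at least \<open>\<epsilon> / 2\<close> by positivity, a contradiction.\<close>

lemma l1_almost_invariant:
  fixes \<Gamma> :: "('g, 'y) monoid_scheme"
  assumes "group \<Gamma>" and am: "amenable \<Gamma>" and E: "finite E" "E \<subseteq> carrier \<Gamma>" and \<epsilon>: "\<epsilon> > 0"
  shows "\<exists>X (w :: 'g \<Rightarrow> real). finite X \<and> X \<subseteq> carrier \<Gamma> \<and> (\<forall>x. 0 \<le> w x) \<and> (\<forall>x. x \<notin> X \<longrightarrow> w x = 0) \<and>
    (\<Sum>s\<in>E. \<Sum>y\<in>X \<union> (\<lambda>x. s \<otimes>\<^bsub>\<Gamma>\<^esub> x) ` X. \<bar>w (inv\<^bsub>\<Gamma>\<^esub> s \<otimes>\<^bsub>\<Gamma>\<^esub> y) - w y\<bar>) < \<epsilon> * (\<Sum>x\<in>X. w x)"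
proof (rule ccontr)
  assume neg: "\<not> ?thesis"
  interpret group \<Gamma> by fact
  obtain m :: "('g \<Rightarrow> real) \<Rightarrow> real" where
    m: "(\<forall>f g. bounded (f ` carrier \<Gamma>) \<longrightarrow> bounded (g ` carrier \<Gamma>) \<longrightarrow>
        m (\<lambda>x. f x + g x) = m f + m g) \<and>
     (\<forall>c f. bounded (f ` carrier \<Gamma>) \<longrightarrow> m (\<lambda>x. c * f x) = c * m f) \<and>
     (\<forall>f. bounded (f ` carrier \<Gamma>) \<longrightarrow> (\<forall>x\<in>carrier \<Gamma>. 0 \<le> f x) \<longrightarrow> 0 \<le> m f) \<and>
     m (\<lambda>x. 1) = 1 \<and>
     (\<forall>s\<in>carrier \<Gamma>. \<forall>f. bounded (f ` carrier \<Gamma>) \<longrightarrow> m (\<lambda>x. f (s \<otimes>\<^bsub>\<Gamma>\<^esub> x)) = m f)"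
    using am unfolding amenable_def by (elim exE)
  note m_add = m[THEN conjunct1, rule_format]
    and m_scale = m[THEN conjunct2, THEN conjunct1, rule_format]
    and m_pos = m[THEN conjunct2, THEN conjunct2, THEN conjunct1, rule_format]
    and m_one = m[THEN conjunct2, THEN conjunct2, THEN conjunct2, THEN conjunct1]
    and m_inv = m[THEN conjunct2, THEN conjunct2, THEN conjunct2, THEN conjunct2, rule_format]
  have bd: "bounded (f ` carrier \<Gamma>)" if "\<And>x. \<bar>f x\<bar> \<le> C" for f :: "'g \<Rightarrow> real" and C
    using that by (auto simp: bounded_iff)
  \<comment> \<open>The functional \<open>h \<mapsto> \<Sum>s\<in>E. h (s, s x) - h (s, x)\<close> in terms of coefficients \<open>c x\<close> on a finite set \<open>S x\<close>; the
    two terms cancel when \<open>s x = x\<close>.\<close>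
  define S where "S x = (\<lambda>s. (s, s \<otimes>\<^bsub>\<Gamma>\<^esub> x)) ` E \<union> (\<lambda>s. (s, x)) ` E" for x
  define c where "c x i = (if snd i = fst i \<otimes>\<^bsub>\<Gamma>\<^esub> x then 1 else 0) - (if snd i = x then 1 else (0::real))"
    for x and i :: "'g \<times> 'g"
  have c: "(\<Sum>i\<in>S x. c x i * h i) = (\<Sum>s\<in>E. h (s, s \<otimes>\<^bsub>\<Gamma>\<^esub> x) - h (s, x))" for x and h :: "'g \<times> 'g \<Rightarrow> real"
  proof -
    have "(\<Sum>i\<in>S x. c x i * h i) = (\<Sum>i\<in>S x. if snd i = fst i \<otimes>\<^bsub>\<Gamma>\<^esub> x then h i else 0)
        - (\<Sum>i\<in>S x. if snd i = x then h i else 0)"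
      unfolding sum_subtractf[symmetric] by (intro sum.cong) (auto simp: c_def)
    also have "(\<Sum>i\<in>S x. if snd i = fst i \<otimes>\<^bsub>\<Gamma>\<^esub> x then h i else 0) = (\<Sum>i\<in>(\<lambda>s. (s, s \<otimes>\<^bsub>\<Gamma>\<^esub> x)) ` E. h i)"
      by (intro sum.mono_neutral_cong_right) (auto simp: S_def E)
    also have "(\<Sum>i\<in>S x. if snd i = x then h i else 0) = (\<Sum>i\<in>(\<lambda>s. (s, x)) ` E. h i)"
      by (intro sum.mono_neutral_cong_right) (auto simp: S_def E)
    also have "(\<Sum>i\<in>(\<lambda>s. (s, s \<otimes>\<^bsub>\<Gamma>\<^esub> x)) ` E. h i) = (\<Sum>s\<in>E. h (s, s \<otimes>\<^bsub>\<Gamma>\<^esub> x))"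
      by (subst sum.reindex) (auto simp: inj_on_def)
    also have "(\<Sum>i\<in>(\<lambda>s. (s, x)) ` E. h i) = (\<Sum>s\<in>E. h (s, x))"
      by (subst sum.reindex) (auto simp: inj_on_def)
    finally show ?thesis by (simp add: sum_subtractf)
  qed
  have "\<exists>h. (\<forall>i. \<bar>h i\<bar> \<le> (1::real)) \<and> (\<forall>x\<in>carrier \<Gamma>. \<epsilon> / 2 \<le> (\<Sum>i\<in>S x. c x i * h i))"
  proof (rule bounded_solution_of_duality)
    show "finite (S x)" for x using E by (simp add: S_def)
    show "\<epsilon> > 0" by fact
    fix X and w :: "'g \<Rightarrow> real"
    assume X: "finite X" "X \<subseteq> carrier \<Gamma>" and w: "\<And>x. 0 \<le> w x" "\<And>x. x \<notin> X \<Longrightarrow> w x = 0"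
    \<comment> \<open>With these signs the weighted sum of the functionals is the \<open>\<ell>\<^sup>1\<close> distance of \<open>w\<close> from its translates.\<close>
    define h where "h i = sgn (w (inv\<^bsub>\<Gamma>\<^esub> (fst i) \<otimes>\<^bsub>\<Gamma>\<^esub> snd i) - w (snd i))" for i
    have "\<epsilon> * (\<Sum>x\<in>X. w x) \<le> (\<Sum>s\<in>E. \<Sum>y\<in>X \<union> (\<lambda>x. s \<otimes>\<^bsub>\<Gamma>\<^esub> x) ` X. \<bar>w (inv\<^bsub>\<Gamma>\<^esub> s \<otimes>\<^bsub>\<Gamma>\<^esub> y) - w y\<bar>)"
      using neg X w by (meson not_less)
    also have "\<dots> = (\<Sum>s\<in>E. \<Sum>x\<in>X. w x * (h (s, s \<otimes>\<^bsub>\<Gamma>\<^esub> x) - h (s, x)))"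
    proof (rule sum.cong[OF refl])
      fix s assume "s \<in> E"
      then have s: "s \<in> carrier \<Gamma>" using E by auto
      have abs: "\<bar>w (inv\<^bsub>\<Gamma>\<^esub> s \<otimes>\<^bsub>\<Gamma>\<^esub> y) - w y\<bar> =
          w (inv\<^bsub>\<Gamma>\<^esub> s \<otimes>\<^bsub>\<Gamma>\<^esub> y) * h (s, y) - w y * h (s, y)" for y
        by (simp add: h_def abs_sgn left_diff_distrib)
      show "(\<Sum>y\<in>X \<union> (\<lambda>x. s \<otimes>\<^bsub>\<Gamma>\<^esub> x) ` X. \<bar>w (inv\<^bsub>\<Gamma>\<^esub> s \<otimes>\<^bsub>\<Gamma>\<^esub> y) - w y\<bar>) =
          (\<Sum>x\<in>X. w x * (h (s, s \<otimes>\<^bsub>\<Gamma>\<^esub> x) - h (s, x)))"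
        unfolding abs right_diff_distrib sum_subtractf
        using sum_translate[OF \<open>group \<Gamma>\<close> s X w(2), where h = "\<lambda>y. h (s, y)"] by simp
    qed
    also have "\<dots> = (\<Sum>x\<in>X. w x * (\<Sum>i\<in>S x. c x i * h i))"
      unfolding c by (subst sum.swap) (simp add: sum_distrib_left)
    finally have "\<epsilon> * (\<Sum>x\<in>X. w x) \<le> (\<Sum>x\<in>X. w x * (\<Sum>i\<in>S x. c x i * h i))" .
    moreover have "\<bar>h i\<bar> \<le> 1" for i by (simp add: h_def abs_sgn_eq)
    ultimately show "\<exists>h. (\<forall>i. \<bar>h i\<bar> \<le> 1) \<and> \<epsilon> * (\<Sum>x\<in>X. w x) \<le> (\<Sum>x\<in>X. w x * (\<Sum>i\<in>S x. c x i * h i))"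
      by blast
  qed
  then obtain h where h: "\<And>i. \<bar>h i\<bar> \<le> (1::real)"
    and ge: "\<And>x. x \<in> carrier \<Gamma> \<Longrightarrow> \<epsilon> / 2 \<le> (\<Sum>s\<in>E. h (s, s \<otimes>\<^bsub>\<Gamma>\<^esub> x) - h (s, x))"
    unfolding c by blast
  have sum0: "m (\<lambda>x. \<Sum>s\<in>F. h (s, s \<otimes>\<^bsub>\<Gamma>\<^esub> x) - h (s, x)) = 0 \<and>
      (\<forall>x. \<bar>\<Sum>s\<in>F. h (s, s \<otimes>\<^bsub>\<Gamma>\<^esub> x) - h (s, x)\<bar> \<le> 2 * real (card F))"
    if "finite F" "F \<subseteq> carrier \<Gamma>" for F
    using that
  proof (induction F rule: finite_induct)
    case empty
    show ?case using m_scale[of "\<lambda>x. 1" 0] bd[of "\<lambda>x. 1" 1] by simp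
  next
    case (insert s F)
    have 1: "bounded ((\<lambda>x. h (s, s \<otimes>\<^bsub>\<Gamma>\<^esub> x)) ` carrier \<Gamma>)" "bounded ((\<lambda>x. h (s, x)) ` carrier \<Gamma>)"
      "bounded ((\<lambda>x. - 1 * h (s, x)) ` carrier \<Gamma>)"
      by (rule bd[of _ 1], use h in simp)+
    have "m (\<lambda>x. h (s, s \<otimes>\<^bsub>\<Gamma>\<^esub> x) + - 1 * h (s, x)) = 0"
      unfolding m_add[OF 1(1,3)] m_scale[OF 1(2)] using m_inv[OF _ 1(2), of s] insert.prems by simp
    moreover have 2: "\<bar>h (s, s \<otimes>\<^bsub>\<Gamma>\<^esub> x) + - 1 * h (s, x)\<bar> \<le> 2" for x
      using h[of "(s, s \<otimes>\<^bsub>\<Gamma>\<^esub> x)"] h[of "(s, x)"] by linarith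
    moreover have IH: "m (\<lambda>x. \<Sum>s\<in>F. h (s, s \<otimes>\<^bsub>\<Gamma>\<^esub> x) - h (s, x)) = 0"
      "\<bar>\<Sum>s\<in>F. h (s, s \<otimes>\<^bsub>\<Gamma>\<^esub> x) - h (s, x)\<bar> \<le> 2 * real (card F)" for x
      using insert.IH insert.prems by auto
    ultimately have "m (\<lambda>x. (h (s, s \<otimes>\<^bsub>\<Gamma>\<^esub> x) + - 1 * h (s, x)) +
        (\<Sum>s\<in>F. h (s, s \<otimes>\<^bsub>\<Gamma>\<^esub> x) - h (s, x))) = 0"
      by (subst m_add[OF bd[OF 2] bd[OF IH(2)]]) simp
    moreover have "\<bar>(h (s, s \<otimes>\<^bsub>\<Gamma>\<^esub> x) - h (s, x)) + (\<Sum>s\<in>F. h (s, s \<otimes>\<^bsub>\<Gamma>\<^esub> x) - h (s, x))\<bar> \<le>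
        2 * (1 + real (card F))" for x
      using 2[of x] IH(2)[of x] by (intro order_trans[OF abs_triangle_ineq]) simp
    ultimately show ?case using insert.hyps by simp
  qed
  have 1: "bounded ((\<lambda>x. - (\<epsilon> / 2)) ` carrier \<Gamma>)" "bounded ((\<lambda>x. 1) ` carrier \<Gamma> :: real set)"
    by (rule bd[of _ "\<epsilon> / 2"], use \<epsilon> in simp, rule bd[of _ 1], simp)
  have 2: "bounded ((\<lambda>x. \<Sum>s\<in>E. h (s, s \<otimes>\<^bsub>\<Gamma>\<^esub> x) - h (s, x)) ` carrier \<Gamma>)"
    using sum0[OF E] by (intro bd) blast
  have "0 \<le> m (\<lambda>x. (\<Sum>s\<in>E. h (s, s \<otimes>\<^bsub>\<Gamma>\<^esub> x) - h (s, x)) + - (\<epsilon> / 2))"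
  proof (rule m_pos)
    show "bounded ((\<lambda>x. (\<Sum>s\<in>E. h (s, s \<otimes>\<^bsub>\<Gamma>\<^esub> x) - h (s, x)) + - (\<epsilon> / 2)) ` carrier \<Gamma>)"
      using bounded_plus_comp[OF 2 1(1)] by simp
  qed (use ge in fastforce)
  also have "\<dots> = - (\<epsilon> / 2)"
    using m_add[OF 2 1(1)] sum0[OF E] m_scale[OF 1(2), of "- (\<epsilon> / 2)"] m_one by simp
  finally show False using \<epsilon> by simp
qed

text \<open>The vector is the square root of a normalised almost invariant weight \<open>w\<close>. The passage from summable
  to square-summable functions rests on \<open>sqrt (u v) \<ge> min u v = (u + v - \<bar>u - v\<bar>) / 2\<close>, and the weight
  must be almost invariant under the inverses of the given elements.\<close>

lemma amenable_almost_invariant_vectors: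
  fixes \<Gamma> :: "('g, 'y) monoid_scheme"
  assumes "group \<Gamma>" and am: "amenable \<Gamma>"
  shows "almost_invariant_vectors \<Gamma>"
  unfolding almost_invariant_vectors_def
proof (intro allI impI)
  interpret group \<Gamma> by fact
  fix E and \<epsilon> :: real assume E: "finite E" "E \<subseteq> carrier \<Gamma>" and \<epsilon>: "\<epsilon> > 0"
  have invE: "finite ((\<lambda>k. inv\<^bsub>\<Gamma>\<^esub> k) ` E)" "(\<lambda>k. inv\<^bsub>\<Gamma>\<^esub> k) ` E \<subseteq> carrier \<Gamma>" using E by auto
  obtain X w where X: "finite X" "X \<subseteq> carrier \<Gamma>" and w: "\<And>x. 0 \<le> w x" "\<And>x. x \<notin> X \<Longrightarrow> w x = 0"
    and le: "(\<Sum>s\<in>(\<lambda>k. inv\<^bsub>\<Gamma>\<^esub> k) ` E. \<Sum>y\<in>X \<union> (\<lambda>x. s \<otimes>\<^bsub>\<Gamma>\<^esub> x) ` X. \<bar>w (inv\<^bsub>\<Gamma>\<^esub> s \<otimes>\<^bsub>\<Gamma>\<^esub> y) - w y\<bar>)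
      < \<epsilon> * (\<Sum>x\<in>X. w x)"
    using l1_almost_invariant[OF assms invE \<epsilon>] by blast
  define W where "W = (\<Sum>x\<in>X. w x)"
  have "0 \<le> (\<Sum>s\<in>(\<lambda>k. inv\<^bsub>\<Gamma>\<^esub> k) ` E. \<Sum>y\<in>X \<union> (\<lambda>x. s \<otimes>\<^bsub>\<Gamma>\<^esub> x) ` X. \<bar>w (inv\<^bsub>\<Gamma>\<^esub> s \<otimes>\<^bsub>\<Gamma>\<^esub> y) - w y\<bar>)"
    by (intro sum_nonneg) auto
  then have "0 < \<epsilon> * W" using le unfolding W_def by (rule le_less_trans)
  then have W: "W > 0" using \<epsilon> by (rule zero_less_mult_pos)
  define f where "f x = sqrt (w x / W)" for x
  have f2: "(f x)\<^sup>2 = w x / W" for x using w W by (simp add: f_def)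
  have "(\<Sum>x\<in>X. (f x)\<^sup>2) = 1" using W unfolding f2 by (simp add: sum_divide_distrib[symmetric] W_def)
  moreover have "1 - \<epsilon> \<le> (\<Sum>x\<in>X. f x * f (k \<otimes>\<^bsub>\<Gamma>\<^esub> x))" if k: "k \<in> E" for k
  proof -
    define s where "s = inv\<^bsub>\<Gamma>\<^esub> k"
    have kc: "k \<in> carrier \<Gamma>" using k E by auto
    then have s: "s \<in> carrier \<Gamma>" "inv\<^bsub>\<Gamma>\<^esub> s = k" by (auto simp: s_def)
    define Y where "Y = X \<union> (\<lambda>x. s \<otimes>\<^bsub>\<Gamma>\<^esub> x) ` X"
    have "(\<Sum>y\<in>Y. \<bar>w (k \<otimes>\<^bsub>\<Gamma>\<^esub> y) - w y\<bar>) \<le>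
      (\<Sum>s\<in>(\<lambda>k. inv\<^bsub>\<Gamma>\<^esub> k) ` E. \<Sum>y\<in>X \<union> (\<lambda>x. s \<otimes>\<^bsub>\<Gamma>\<^esub> x) ` X. \<bar>w (inv\<^bsub>\<Gamma>\<^esub> s \<otimes>\<^bsub>\<Gamma>\<^esub> y) - w y\<bar>)"
      using k invE by (subst s(2)[symmetric], unfold Y_def, intro member_le_sum[of s])
        (auto simp: s_def intro: sum_nonneg)
    then have small: "(\<Sum>y\<in>Y. \<bar>w (k \<otimes>\<^bsub>\<Gamma>\<^esub> y) - w y\<bar>) < \<epsilon> * W" using le by (simp add: W_def)
    have sums: "(\<Sum>y\<in>Y. w (k \<otimes>\<^bsub>\<Gamma>\<^esub> y)) = W" "(\<Sum>y\<in>Y. w y) = W"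
      using sum_translate[OF \<open>group \<Gamma>\<close> s(1) X w(2), where h = "\<lambda>_. 1"] s(2) by (simp_all add: Y_def W_def)
    have "W - \<epsilon> * W \<le> W - (\<Sum>y\<in>Y. \<bar>w (k \<otimes>\<^bsub>\<Gamma>\<^esub> y) - w y\<bar>) / 2"
    proof -
      have "0 \<le> (\<Sum>y\<in>Y. \<bar>w (k \<otimes>\<^bsub>\<Gamma>\<^esub> y) - w y\<bar>)" by (simp add: sum_nonneg)
      then show ?thesis using small by linarith
    qed
    also have "\<dots> = (\<Sum>y\<in>Y. (w (k \<otimes>\<^bsub>\<Gamma>\<^esub> y) + w y - \<bar>w (k \<otimes>\<^bsub>\<Gamma>\<^esub> y) - w y\<bar>) / 2)"
      by (simp add: sum_divide_distrib[symmetric] sum.distrib sum_subtractf sums)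
    also have "\<dots> \<le> (\<Sum>y\<in>Y. W * (f y * f (k \<otimes>\<^bsub>\<Gamma>\<^esub> y)))"
    proof (rule sum_mono)
      fix y
      have "(w (k \<otimes>\<^bsub>\<Gamma>\<^esub> y) + w y - \<bar>w (k \<otimes>\<^bsub>\<Gamma>\<^esub> y) - w y\<bar>) / 2 = min (w y) (w (k \<otimes>\<^bsub>\<Gamma>\<^esub> y))" by (simp add: min_def)
      also have "\<dots> \<le> sqrt (w y * w (k \<otimes>\<^bsub>\<Gamma>\<^esub> y))"
        by (rule real_le_rsqrt) (auto simp: min_def power2_eq_square w intro: mult_mono)
      also have "\<dots> = W * (f y * f (k \<otimes>\<^bsub>\<Gamma>\<^esub> y))"
        using W by (simp add: f_def real_sqrt_mult real_sqrt_divide field_simps)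
      finally show "(w (k \<otimes>\<^bsub>\<Gamma>\<^esub> y) + w y - \<bar>w (k \<otimes>\<^bsub>\<Gamma>\<^esub> y) - w y\<bar>) / 2 \<le> W * (f y * f (k \<otimes>\<^bsub>\<Gamma>\<^esub> y))" .
    qed
    also have "\<dots> = (\<Sum>x\<in>X. W * (f x * f (k \<otimes>\<^bsub>\<Gamma>\<^esub> x)))"
      by (rule sum.mono_neutral_right) (auto simp: Y_def X f_def w(2))
    finally have "W * (1 - \<epsilon>) \<le> W * (\<Sum>x\<in>X. f x * f (k \<otimes>\<^bsub>\<Gamma>\<^esub> x))"
      by (simp add: sum_distrib_left algebra_simps)
    then show ?thesis using W by simp
  qed
  moreover have "f x = 0" if "x \<notin> X" for x using w(2)[OF that] by (simp add: f_def)
  ultimately show "\<exists>S (f :: 'g \<Rightarrow> real). finite S \<and> S \<subseteq> carrier \<Gamma> \<and> (\<forall>x. x \<notin> S \<longrightarrow> f x = 0) \<and>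
        (\<Sum>x\<in>S. (f x)\<^sup>2) = 1 \<and> (\<forall>k\<in>E. 1 - \<epsilon> \<le> (\<Sum>x\<in>S. f x * f (k \<otimes>\<^bsub>\<Gamma>\<^esub> x)))"
    using X by blast
qed

lemma almost_invariant_vectorsE:
  assumes aiv: "almost_invariant_vectors \<Gamma>" and E: "finite E" "E \<subseteq> carrier \<Gamma>" "\<epsilon> > 0"
  obtains S f where "finite S" "S \<subseteq> carrier \<Gamma>" "\<And>x. x \<notin> S \<Longrightarrow> f x = (0 :: real)"
    "(\<Sum>x\<in>S. (f x)\<^sup>2) = 1" "\<And>k. k \<in> E \<Longrightarrow> 1 - \<epsilon> \<le> (\<Sum>x\<in>S. f x * f (k \<otimes>\<^bsub>\<Gamma>\<^esub> x))"
proof -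
  note ex = aiv[unfolded almost_invariant_vectors_def, THEN spec, THEN spec, THEN mp, THEN mp, THEN mp, OF E]
  from ex show ?thesis
  proof (elim exE conjE)
    fix S and f :: "_ \<Rightarrow> real"
    assume "finite S" "S \<subseteq> carrier \<Gamma>" "\<forall>x. x \<notin> S \<longrightarrow> f x = 0"
      "(\<Sum>x\<in>S. (f x)\<^sup>2) = 1" "\<forall>k\<in>E. 1 - \<epsilon> \<le> (\<Sum>x\<in>S. f x * f (k \<otimes>\<^bsub>\<Gamma>\<^esub> x))"
    then show thesis by (intro that[of S f]) simp_all
  qed
qed

text \<open>A finite set \<open>E\<close> of finitely supported families lives on a finite set \<open>T\<close> of coordinates. The tensor
  product of copies of an almost invariant vector for \<open>\<Gamma>\<close>, one for each element of \<open>T\<close>, has coefficients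
  that are products over \<open>T\<close> of coefficients for \<open>\<Gamma>\<close>; by Bernoulli's inequality these stay close to \<open>1\<close>.\<close>

lemma almost_invariant_vectors_sum_group:
  fixes \<Gamma> :: "('g, 'y) monoid_scheme" and I :: "'i set"
  assumes "group \<Gamma>" and aiv: "almost_invariant_vectors \<Gamma>"
  shows "almost_invariant_vectors (sum_group I (\<lambda>_. \<Gamma>))"
  unfolding almost_invariant_vectors_def
proof (intro allI impI)
  interpret group \<Gamma> by fact
  let ?N = "sum_group I (\<lambda>_. \<Gamma>)"
  have carr: "carrier ?N = {x \<in> I \<rightarrow>\<^sub>E carrier \<Gamma>. finite {i \<in> I. x i \<noteq> \<one>\<^bsub>\<Gamma>\<^esub>}}"
    by (rule carrier_sum_group) (rule \<open>group \<Gamma>\<close>)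
  interpret N: group ?N by (rule sum_group) (rule \<open>group \<Gamma>\<close>)
  fix E and \<epsilon> :: real assume E: "finite E" "E \<subseteq> carrier ?N" and \<epsilon>: "\<epsilon> > 0"
  define T where "T = (\<Union>k\<in>E. {i \<in> I. k i \<noteq> \<one>\<^bsub>\<Gamma>\<^esub>})"
  have T: "finite T" "T \<subseteq> I" using E unfolding T_def carr by auto
  \<comment> \<open>Bernoulli's inequality gives \<open>(1 - \<delta>) ^ card T \<ge> 1 - \<epsilon>\<close>; the summand \<open>1\<close> avoids a division by zero.\<close>
  define \<delta> where "\<delta> = min 1 (\<epsilon> / (real (card T) + 1))"
  have \<delta>: "\<delta> > 0" "\<delta> \<le> 1" using \<epsilon> by (auto simp: \<delta>_def)
  have "real (card T) * \<delta> \<le> (real (card T) + 1) * (\<epsilon> / (real (card T) + 1))"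
    by (intro mult_mono) (use \<epsilon> \<delta> in \<open>auto simp: \<delta>_def\<close>)
  then have bern: "1 - \<epsilon> \<le> (1 - \<delta>) ^ card T"
    using Bernoulli_inequality[of "- \<delta>" "card T"] \<delta> by simp
  define E' where "E' = (\<Union>k\<in>E. k ` T)"
  have E': "finite E'" "E' \<subseteq> carrier \<Gamma>" using E T unfolding E'_def carr by auto
  obtain S f where S: "finite S" "S \<subseteq> carrier \<Gamma>" and fS: "\<And>x. x \<notin> S \<Longrightarrow> f x = 0"
    and f1: "(\<Sum>x\<in>S. (f x)\<^sup>2) = 1"
    and fk: "\<And>k. k \<in> E' \<Longrightarrow> 1 - \<delta> \<le> (\<Sum>x\<in>S. f x * f (k \<otimes>\<^bsub>\<Gamma>\<^esub> x))"
    using almost_invariant_vectorsE[OF aiv E' \<delta>(1)] by blast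
  define \<iota> where "\<iota> p = (\<lambda>i\<in>I. if i \<in> T then p i else \<one>\<^bsub>\<Gamma>\<^esub>)" for p :: "'i \<Rightarrow> 'g"
  let ?P = "T \<rightarrow>\<^sub>E S"
  have \<iota>: "\<iota> p \<in> carrier ?N" if "p \<in> ?P" for p
    using that S T unfolding carr by (auto simp: \<iota>_def PiE_iff intro: finite_subset)
  have inj: "inj_on \<iota> ?P"
  proof (rule inj_onI)
    fix p q assume pq: "p \<in> ?P" "q \<in> ?P" "\<iota> p = \<iota> q"
    show "p = q"
    proof (rule PiE_ext[OF pq(1,2)])
      fix i assume "i \<in> T"
      then show "p i = q i" using fun_cong[OF pq(3), of i] T by (auto simp: \<iota>_def)
    qed
  qed
  \<comment> \<open>The tensor product vector, extended by the unit vector at \<open>1\<close> in the coordinates outside \<open>T\<close>.\<close>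
  define F where "F n = (if n \<in> carrier ?N \<and> (\<forall>i\<in>I - T. n i = \<one>\<^bsub>\<Gamma>\<^esub>) then \<Prod>i\<in>T. f (n i) else 0)" for n
  define S' where "S' = \<iota> ` ?P"
  have S': "finite S'" "S' \<subseteq> carrier ?N" unfolding S'_def using S T \<iota> by (auto intro: finite_PiE)
  have F\<iota>: "F (\<iota> p) = (\<Prod>i\<in>T. f (p i))" if "p \<in> ?P" for p
    using \<iota>[OF that] T by (auto simp: F_def \<iota>_def intro!: prod.cong)
  have Fk: "F (k \<otimes>\<^bsub>?N\<^esub> \<iota> p) = (\<Prod>i\<in>T. f (k i \<otimes>\<^bsub>\<Gamma>\<^esub> p i))" if p: "p \<in> ?P" and k: "k \<in> E" for p k
  proof -
    have "k \<otimes>\<^bsub>?N\<^esub> \<iota> p \<in> carrier ?N" using \<iota>[OF p] k E by blast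
    moreover have "\<forall>i\<in>I - T. (k \<otimes>\<^bsub>?N\<^esub> \<iota> p) i = \<one>\<^bsub>\<Gamma>\<^esub>"
      using k by (auto simp: \<iota>_def T_def)
    moreover have "(k \<otimes>\<^bsub>?N\<^esub> \<iota> p) i = k i \<otimes>\<^bsub>\<Gamma>\<^esub> p i" if "i \<in> T" for i
      using that T by (auto simp: \<iota>_def)
    ultimately show ?thesis by (simp add: F_def del: mult_sum_group cong: prod.cong)
  qed
  have sum_S': "(\<Sum>n\<in>S'. h n) = (\<Sum>p\<in>?P. h (\<iota> p))" for h :: "_ \<Rightarrow> real"
    unfolding S'_def by (rule sum.reindex[OF inj, unfolded o_def])
  have "(\<Sum>n\<in>S'. (F n)\<^sup>2) = (\<Sum>p\<in>?P. \<Prod>i\<in>T. (f (p i))\<^sup>2)"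
    unfolding sum_S' by (rule sum.cong) (auto simp: F\<iota> prod_power_distrib)
  also have "\<dots> = (\<Prod>i\<in>T. \<Sum>x\<in>S. (f x)\<^sup>2)" by (rule prod_sum_PiE[symmetric]) (auto simp: T S)
  finally have norm: "(\<Sum>n\<in>S'. (F n)\<^sup>2) = 1" by (simp add: f1)
  have inv: "1 - \<epsilon> \<le> (\<Sum>n\<in>S'. F n * F (k \<otimes>\<^bsub>?N\<^esub> n))" if k: "k \<in> E" for k
  proof -
    have "1 - \<epsilon> \<le> (\<Prod>i\<in>T. 1 - \<delta>)" using bern by simp
    also have "\<dots> \<le> (\<Prod>i\<in>T. \<Sum>x\<in>S. f x * f (k i \<otimes>\<^bsub>\<Gamma>\<^esub> x))"
      using k \<delta> by (intro prod_mono conjI fk) (auto simp: E'_def)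
    also have "\<dots> = (\<Sum>p\<in>?P. \<Prod>i\<in>T. f (p i) * f (k i \<otimes>\<^bsub>\<Gamma>\<^esub> p i))"
      by (rule prod_sum_PiE) (auto simp: T S)
    also have "\<dots> = (\<Sum>n\<in>S'. F n * F (k \<otimes>\<^bsub>?N\<^esub> n))"
      unfolding sum_S' by (rule sum.cong) (auto simp: F\<iota> Fk[OF _ k] prod.distrib simp del: mult_sum_group)
    finally show ?thesis .
  qed
  have supp: "F n = 0" if n: "n \<notin> S'" for n
  proof (rule ccontr)
    assume "F n \<noteq> 0"
    then have nc: "n \<in> carrier ?N" "\<And>i. i \<in> I - T \<Longrightarrow> n i = \<one>\<^bsub>\<Gamma>\<^esub>" and "(\<Prod>i\<in>T. f (n i)) \<noteq> 0"
      by (auto simp: F_def split: if_splits)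
    then have nS: "n i \<in> S" if "i \<in> T" for i using that T fS by (auto simp: prod_zero_iff)
    have "n = \<iota> (restrict n T)"
      using nc T unfolding carr by (auto simp: \<iota>_def fun_eq_iff PiE_iff extensional_def)
    then show False using n nS unfolding S'_def by (metis image_eqI restrict_PiE_iff)
  qed
  show "\<exists>S F. finite S \<and> S \<subseteq> carrier ?N \<and> (\<forall>x. x \<notin> S \<longrightarrow> F x = (0::real)) \<and>
        (\<Sum>x\<in>S. (F x)\<^sup>2) = 1 \<and> (\<forall>k\<in>E. 1 - \<epsilon> \<le> (\<Sum>x\<in>S. F x * F (k \<otimes>\<^bsub>?N\<^esub> x)))"
    using S' norm inv supp by (intro exI[of _ S'] exI[of _ F]) auto
qed

section \<open>The Hilbert space of square-summable functions\<close>

definition sq_summable :: "('v \<Rightarrow> complex) \<Rightarrow> bool" where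
  "sq_summable f \<longleftrightarrow> (\<lambda>x. (cmod (f x))\<^sup>2) summable_on UNIV"

definition l2_norm :: "('v \<Rightarrow> complex) \<Rightarrow> real" where
  "l2_norm f = sqrt (\<Sum>\<^sub>\<infinity>x. (cmod (f x))\<^sup>2)"

text \<open>Functions are tagged with \<^term>\<open>Inr\<close> because the left summand of the type is occupied by
  \<^term>\<open>complex_line\<close>, with which this space shares a decomposition.\<close>

definition ell2 :: "(complex + ('v \<Rightarrow> complex)) hilbert" where
  "ell2 = \<lparr>carrier = Inr ` {f. sq_summable f}, monoid.mult = undefined, one = undefined,
     zero = Inr (\<lambda>_. 0), add = (\<lambda>x y. Inr (\<lambda>t. projr x t + projr y t)),
     smult = (\<lambda>c x. Inr (\<lambda>t. c * projr x t)),
     hinner = (\<lambda>x y. \<Sum>\<^sub>\<infinity>t. projr x t * cnj (projr y t))\<rparr>"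

lemma sq_summable_add:
  assumes "sq_summable f" "sq_summable g"
  shows "sq_summable (\<lambda>x. f x + g x)"
  unfolding sq_summable_def
proof (rule summable_on_comparison_test)
  show "(\<lambda>x. 2 * (cmod (f x))\<^sup>2 + 2 * (cmod (g x))\<^sup>2) summable_on UNIV"
    using assms unfolding sq_summable_def by (intro summable_on_add summable_on_cmult_right)
  fix x
  have "(cmod (f x + g x))\<^sup>2 \<le> (cmod (f x) + cmod (g x))\<^sup>2"
    by (intro power_mono norm_triangle_ineq) simp
  also have "\<dots> \<le> 2 * (cmod (f x))\<^sup>2 + 2 * (cmod (g x))\<^sup>2"
    using sum_squares_bound[of "cmod (f x)" "cmod (g x)"] by (simp add: power2_sum)
  finally show "(cmod (f x + g x))\<^sup>2 \<le> 2 * (cmod (f x))\<^sup>2 + 2 * (cmod (g x))\<^sup>2" .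
qed simp

lemma sq_summable_scale: "sq_summable f \<Longrightarrow> sq_summable (\<lambda>x. c * f x)"
  unfolding sq_summable_def by (simp add: norm_mult power_mult_distrib summable_on_cmult_right)

lemma sq_summable_diff: "sq_summable f \<Longrightarrow> sq_summable g \<Longrightarrow> sq_summable (\<lambda>x. f x - g x)"
  using sq_summable_add[of f "\<lambda>x. - 1 * g x"] sq_summable_scale[of g "- 1"] by simp

lemma sq_summable_zero: "sq_summable (\<lambda>_. 0)"
  by (simp add: sq_summable_def)

lemma sq_summable_finite: "finite {x. f x \<noteq> 0} \<Longrightarrow> sq_summable f"
  unfolding sq_summable_def by (rule finite_nonzero_values_imp_summable_on) simp

lemma l2_norm_finite: "finite S \<Longrightarrow> (\<And>x. x \<notin> S \<Longrightarrow> f x = 0) \<Longrightarrow> l2_norm f = sqrt (\<Sum>x\<in>S. (cmod (f x))\<^sup>2)"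
  unfolding l2_norm_def by (subst infsum_cong_neutral[of S UNIV]) auto

lemma sq_summable_inner:
  assumes "sq_summable f" "sq_summable g"
  shows "(\<lambda>x. f x * cnj (g x)) summable_on UNIV"
proof (rule abs_summable_summable, rule summable_on_comparison_test)
  show "(\<lambda>x. (cmod (f x))\<^sup>2 + (cmod (g x))\<^sup>2) summable_on UNIV"
    using assms unfolding sq_summable_def by (intro summable_on_add)
  show "norm (f x * cnj (g x)) \<le> (cmod (f x))\<^sup>2 + (cmod (g x))\<^sup>2" for x
    using sum_squares_bound[of "cmod (f x)" "cmod (g x)"] zero_le_power2[of "cmod (f x)"]
      zero_le_power2[of "cmod (g x)"] mult_nonneg_nonneg[OF norm_ge_zero[of "f x"] norm_ge_zero[of "g x"]] unfolding norm_mult complex_mod_cnj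
    by linarith
qed simp

lemma ell2_simps [simp]:
  "Inr f \<in> carrier ell2 \<longleftrightarrow> sq_summable f"
  "\<zero>\<^bsub>ell2\<^esub> = Inr (\<lambda>_. 0)"
  "Inr f \<oplus>\<^bsub>ell2\<^esub> Inr g = Inr (\<lambda>t. f t + g t)"
  "c \<odot>\<^bsub>ell2\<^esub> Inr f = Inr (\<lambda>t. c * f t)"
  "hinner ell2 (Inr f) (Inr g) = (\<Sum>\<^sub>\<infinity>t. f t * cnj (g t))"
  by (auto simp: ell2_def)

lemma ell2_carrierE: "x \<in> carrier ell2 \<Longrightarrow> (\<And>f. x = Inr f \<Longrightarrow> sq_summable f \<Longrightarrow> P) \<Longrightarrow> P"
  by (auto simp: ell2_def)

lemma hnorm_ell2 [simp]: assumes "sq_summable f" shows "hnorm ell2 (Inr f) = l2_norm f"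
proof -
  have "(\<Sum>\<^sub>\<infinity>t. f t * cnj (f t)) = (\<Sum>\<^sub>\<infinity>t. complex_of_real ((cmod (f t))\<^sup>2))"
    by (intro infsum_cong) (simp only: complex_norm_square)
  also have "\<dots> = complex_of_real (\<Sum>\<^sub>\<infinity>t. (cmod (f t))\<^sup>2)"
    using assms unfolding sq_summable_def by (intro infsumI has_sum_of_real has_sum_infsum)
  finally show ?thesis by (simp add: hnorm_def l2_norm_def)
qed

lemma l2_norm_nonneg: "0 \<le> l2_norm f"
  by (simp add: l2_norm_def infsum_nonneg)

lemma cmod_le_l2_norm: assumes "sq_summable f" shows "cmod (f x) \<le> l2_norm f"
proof -
  have "(\<Sum>x\<in>{x}. (cmod (f x))\<^sup>2) \<le> (\<Sum>\<^sub>\<infinity>x. (cmod (f x))\<^sup>2)"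
    by (rule finite_sum_le_infsum) (use assms in \<open>auto simp: sq_summable_def\<close>)
  then show ?thesis unfolding l2_norm_def by (intro real_le_rsqrt) simp
qed

text \<open>A Cauchy sequence converges pointwise. The Cauchy bound on sums over a finite set survives the
  pointwise limit, and a bound on all finite sums is a bound on the norm.\<close>

lemma ell2_complete:
  fixes f :: "nat \<Rightarrow> 'v \<Rightarrow> complex"
  assumes f: "\<And>n. sq_summable (f n)"
    and C: "\<And>e. e > 0 \<Longrightarrow> \<exists>N. \<forall>m\<ge>N. \<forall>n\<ge>N. l2_norm (\<lambda>x. f m x - f n x) < e"
  shows "\<exists>g. sq_summable g \<and> (\<lambda>n. l2_norm (\<lambda>x. f n x - g x)) \<longlonglongrightarrow> 0"
proof -
  have "Cauchy (\<lambda>n. f n x)" for x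
  proof (rule CauchyI)
    fix e :: real assume "e > 0"
    then obtain N where N: "\<And>m n. m \<ge> N \<Longrightarrow> n \<ge> N \<Longrightarrow> l2_norm (\<lambda>x. f m x - f n x) < e" using C by blast
    have "norm (f m x - f n x) < e" if "m \<ge> N" "n \<ge> N" for m n
      using cmod_le_l2_norm[OF sq_summable_diff[OF f[of m] f[of n]], of x] N[OF that] by linarith
    then show "\<exists>M. \<forall>m\<ge>M. \<forall>n\<ge>M. norm (f m x - f n x) < e" by blast
  qed
  then have "convergent (\<lambda>n. f n x)" for x by (simp add: Cauchy_convergent_iff)
  then obtain g where g: "\<And>x. (\<lambda>n. f n x) \<longlonglongrightarrow> g x" unfolding convergent_def by metis
  have fin: "(\<Sum>x\<in>F. (cmod (f m x - g x))\<^sup>2) \<le> e\<^sup>2"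
    if N: "\<And>n. n \<ge> N \<Longrightarrow> l2_norm (\<lambda>x. f m x - f n x) < e" and F: "finite F" for F m N and e :: real
  proof (rule LIMSEQ_le_const2)
    show "(\<lambda>n. \<Sum>x\<in>F. (cmod (f m x - f n x))\<^sup>2) \<longlonglongrightarrow> (\<Sum>x\<in>F. (cmod (f m x - g x))\<^sup>2)"
      by (intro tendsto_intros g)
    have "(\<Sum>x\<in>F. (cmod (f m x - f n x))\<^sup>2) \<le> e\<^sup>2" if "n \<ge> N" for n
    proof -
      have "(\<Sum>x\<in>F. (cmod (f m x - f n x))\<^sup>2) \<le> (\<Sum>\<^sub>\<infinity>x. (cmod (f m x - f n x))\<^sup>2)"
        by (rule finite_sum_le_infsum)
          (use sq_summable_diff[OF f[of m] f[of n]] F in \<open>auto simp: sq_summable_def\<close>)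
      also have "\<dots> = (l2_norm (\<lambda>x. f m x - f n x))\<^sup>2" by (simp add: l2_norm_def infsum_nonneg)
      also have "\<dots> \<le> e\<^sup>2" using N[OF that] l2_norm_nonneg by (intro power_mono) (auto intro: less_imp_le)
      finally show ?thesis .
    qed
    then show "\<exists>N. \<forall>n\<ge>N. (\<Sum>x\<in>F. (cmod (f m x - f n x))\<^sup>2) \<le> e\<^sup>2" by blast
  qed
  have key: "\<exists>N. \<forall>m\<ge>N. sq_summable (\<lambda>x. f m x - g x) \<and> l2_norm (\<lambda>x. f m x - g x) \<le> e" if e: "e > 0" for e
  proof -
    obtain N where N: "\<And>m n. m \<ge> N \<Longrightarrow> n \<ge> N \<Longrightarrow> l2_norm (\<lambda>x. f m x - f n x) < e" using C[OF e] by blast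
    have "sq_summable (\<lambda>x. f m x - g x) \<and> l2_norm (\<lambda>x. f m x - g x) \<le> e" if m: "m \<ge> N" for m
    proof
      have le: "(\<Sum>x\<in>F. (cmod (f m x - g x))\<^sup>2) \<le> e\<^sup>2" if "finite F" for F
        by (rule fin[of N]) (use N[OF m] that in auto)
      show sq: "sq_summable (\<lambda>x. f m x - g x)"
        unfolding sq_summable_def
        by (rule nonneg_bdd_above_summable_on) (use le in \<open>auto intro!: bdd_aboveI2\<close>)
      have "(\<Sum>\<^sub>\<infinity>x. (cmod (f m x - g x))\<^sup>2) \<le> e\<^sup>2"
        by (rule infsum_le_finite_sums) (use sq le in \<open>auto simp: sq_summable_def\<close>)
      then show "l2_norm (\<lambda>x. f m x - g x) \<le> e"
        unfolding l2_norm_def using e by (intro real_le_lsqrt) (auto intro: infsum_nonneg)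
    qed
    then show ?thesis by blast
  qed
  obtain m where "sq_summable (\<lambda>x. f m x - g x)" using key[of 1] by auto
  then have "sq_summable g" using sq_summable_diff[OF f[of m], of "\<lambda>x. f m x - g x"] by simp
  moreover have "(\<lambda>n. l2_norm (\<lambda>x. f n x - g x)) \<longlonglongrightarrow> 0"
  proof (rule LIMSEQ_I)
    fix r :: real assume r: "r > 0"
    obtain N where N: "\<And>m. m \<ge> N \<Longrightarrow> l2_norm (\<lambda>x. f m x - g x) \<le> r / 2" using key[of "r / 2"] r by auto
    have "norm (l2_norm (\<lambda>x. f n x - g x) - 0) < r" if "n \<ge> N" for n
      using N[OF that] r l2_norm_nonneg[of "\<lambda>x. f n x - g x"] by simp
    then show "\<exists>N. \<forall>n\<ge>N. norm (l2_norm (\<lambda>x. f n x - g x) - 0) < r" by blast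
  qed
  ultimately show ?thesis by blast
qed

lemma hilbert_space_ell2: "hilbert_space (ell2 :: (complex + ('v \<Rightarrow> complex)) hilbert)"
proof -
  let ?H = "ell2 :: (complex + ('v \<Rightarrow> complex)) hilbert"
  have G: "abelian_group ?H"
  proof (rule abelian_groupI)
    fix x assume "x \<in> carrier ?H"
    then show "\<exists>y\<in>carrier ?H. y \<oplus>\<^bsub>?H\<^esub> x = \<zero>\<^bsub>?H\<^esub>"
    proof (elim ell2_carrierE)
      fix f :: "'v \<Rightarrow> complex" assume "x = Inr f" "sq_summable f"
      then show ?thesis
        using sq_summable_scale[of f "- 1"] by (intro bexI[of _ "Inr (\<lambda>t. - 1 * f t)"]) auto
    qed
  qed (auto elim!: ell2_carrierE simp: sq_summable_add sq_summable_zero algebra_simps)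
  have "module complex_ring ?H"
    by (rule moduleI[OF cring_complex_ring G])
      (auto elim!: ell2_carrierE simp: complex_ring_def sq_summable_scale algebra_simps)
  then interpret L: module complex_ring ?H .
  have neg: "\<ominus>\<^bsub>?H\<^esub> Inr f = Inr (\<lambda>t. - f t)" if "sq_summable f" for f
    by (rule L.M.minus_equality) (use that sq_summable_scale[of f "- 1"] in auto)
  have diff: "Inr f \<ominus>\<^bsub>?H\<^esub> Inr g = Inr (\<lambda>t. f t - g t)" if "sq_summable g" for f g
    using that by (simp add: a_minus_def neg)
  show ?thesis
  proof unfold_locales
    fix s :: "nat \<Rightarrow> complex + ('v \<Rightarrow> complex)"
    assume s: "\<And>n. s n \<in> carrier ?H"
      and C: "\<And>e. 0 < e \<Longrightarrow> \<exists>N. \<forall>m\<ge>N. \<forall>n\<ge>N. hnorm ?H (s m \<ominus>\<^bsub>?H\<^esub> s n) < e"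
    obtain f where f: "\<And>n. s n = Inr (f n)" "\<And>n. sq_summable (f n)"
      using s by (meson ell2_carrierE)
    obtain g where "sq_summable g" "(\<lambda>n. l2_norm (\<lambda>x. f n x - g x)) \<longlonglongrightarrow> 0"
      using ell2_complete[of f] C f by (auto simp: diff sq_summable_diff)
    then show "\<exists>x\<in>carrier ?H. (\<lambda>n. hnorm ?H (s n \<ominus>\<^bsub>?H\<^esub> x)) \<longlonglongrightarrow> 0"
      by (intro bexI[of _ "Inr g"]) (auto simp: f diff sq_summable_diff)
  next
    fix x y z assume "x \<in> carrier ?H" "y \<in> carrier ?H" "z \<in> carrier ?H"
    then show "hinner ?H (x \<oplus>\<^bsub>?H\<^esub> y) z = hinner ?H x z + hinner ?H y z"
      by (auto elim!: ell2_carrierE simp: distrib_right infsum_add sq_summable_inner)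
  next
    fix x z c assume "x \<in> carrier ?H" "z \<in> carrier ?H"
    then show "hinner ?H (c \<odot>\<^bsub>?H\<^esub> x) z = c * hinner ?H x z"
      by (auto elim!: ell2_carrierE simp: mult.assoc infsum_cmult_right sq_summable_inner)
  next
    fix x y assume "x \<in> carrier ?H" "y \<in> carrier ?H"
    then show "hinner ?H y x = cnj (hinner ?H x y)"
      by (auto elim!: ell2_carrierE simp: infsum_cnj[symmetric] mult.commute simp del: infsum_cnj)
  next
    fix x assume x: "x \<in> carrier ?H"
    show "0 \<le> Re (hinner ?H x x)"
    proof -
      obtain f where "x = Inr f" "sq_summable f" using x by (rule ell2_carrierE)
      then have "0 \<le> hnorm ?H x" by (simp add: l2_norm_nonneg)
      then show ?thesis by (simp add: hnorm_def)
    qed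
    assume 0: "hinner ?H x x = 0"
    obtain f where f: "x = Inr f" "sq_summable f" using x by (rule ell2_carrierE)
    have "hnorm ?H x = 0" by (simp add: hnorm_def 0)
    then have "f t = 0" for t using cmod_le_l2_norm[OF f(2), of t] f by simp
    then show "x = \<zero>\<^bsub>?H\<^esub>" using f by auto
  qed
qed

lemma l2_Cauchy_Schwarz:
  assumes "sq_summable f" "sq_summable g"
  shows "cmod (\<Sum>\<^sub>\<infinity>t. f t * cnj (g t)) \<le> l2_norm f * l2_norm g"
  using hilbert_space.Cauchy_Schwarz[OF hilbert_space_ell2, of "Inr f" "Inr g"] assms by simp

lemma l2_norm_scale: "l2_norm (\<lambda>t. c * f t) = cmod c * l2_norm f"
  unfolding l2_norm_def
  by (simp add: norm_mult power_mult_distrib infsum_cmult_right' real_sqrt_mult)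

section \<open>Norms of operators and of multipliers\<close>

lemma (in hilbert_space) hnorm_smult:
  assumes "x \<in> carrier H" shows "hnorm H (c \<odot> x) = cmod c * hnorm H x"
proof -
  have "hinner H (c \<odot> x) (c \<odot> x) = (c * cnj c) * hinner H x x"
    using assms by (simp add: inner_smult inner_smult_right)
  also have "\<dots> = of_real ((cmod c * hnorm H x)\<^sup>2)"
    using assms by (simp add: inner_self complex_norm_square[symmetric] power_mult_distrib)
  finally have "(hnorm H (c \<odot> x))\<^sup>2 = (cmod c * hnorm H x)\<^sup>2"
    using assms inner_self[of "c \<odot> x"] by (simp only: of_real_eq_iff smult_closed')
  then show ?thesis using assms by (simp add: hnorm_nonneg power2_eq_iff_nonneg)
qed

lemma hnorm_complex_line [simp]: "hnorm complex_line (Inl c) = cmod c"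
  by (simp add: hnorm_def complex_line_def cmod_def power2_eq_square)

lemma complex_line_simps [simp]:
  "Inl c \<in> carrier complex_line" "c \<odot>\<^bsub>complex_line\<^esub> Inl z = Inl (c * z)"
  "Inl c \<oplus>\<^bsub>complex_line\<^esub> Inl z = Inl (c + z)"
  by (auto simp: complex_line_def)

lemma complex_line_carrierE: "x \<in> carrier complex_line \<Longrightarrow> (\<And>c. x = Inl c \<Longrightarrow> P) \<Longrightarrow> P"
  by (auto simp: complex_line_def)

lemma operator_norm_le:
  assumes "hilbert_space H" "0 \<le> c" "\<And>x. x \<in> carrier H \<Longrightarrow> hnorm K (T x) \<le> c * hnorm H x"
  shows "operator_norm H K T \<le> c"
  unfolding operator_norm_def
proof (rule cSUP_least)
  interpret hilbert_space H by fact
  show "{x \<in> carrier H. hnorm H x \<le> 1} \<noteq> {}" using hnorm_zero by (auto intro!: exI[of _ "\<zero>\<^bsub>H\<^esub>"])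
  fix x assume x: "x \<in> {x \<in> carrier H. hnorm H x \<le> 1}"
  have "hnorm K (T x) \<le> c * hnorm H x" using assms(3) x by simp
  also have "\<dots> \<le> c" using x assms(2) by (simp add: mult_left_le)
  finally show "hnorm K (T x) \<le> c" .
qed

lemma operator_norm_upper:
  assumes H: "hilbert_space H" and T: "T \<in> bounded_operators H K"
    and x: "x \<in> carrier H" "hnorm H x \<le> 1"
  shows "hnorm K (T x) \<le> operator_norm H K T"
  unfolding operator_norm_def
proof (rule cSUP_upper)
  interpret hilbert_space H by fact
  obtain C where C: "\<And>x. x \<in> carrier H \<Longrightarrow> hnorm K (T x) \<le> C * hnorm H x"
    using T unfolding bounded_operators_def by blast
  show "bdd_above ((\<lambda>x. hnorm K (T x)) ` {x \<in> carrier H. hnorm H x \<le> 1})"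
  proof (rule bdd_aboveI2)
    fix x assume x: "x \<in> {x \<in> carrier H. hnorm H x \<le> 1}"
    then have "hnorm K (T x) \<le> C * hnorm H x" using C by simp
    also have "\<dots> \<le> \<bar>C\<bar> * 1" using x hnorm_nonneg[of x] by (intro mult_mono) auto
    finally show "hnorm K (T x) \<le> \<bar>C\<bar>" by simp
  qed
qed (use x in simp)

lemma operator_norm_nonneg:
  assumes H: "hilbert_space H" and K: "hilbert_space K" and T: "T \<in> bounded_operators H K"
  shows "0 \<le> operator_norm H K T"
proof -
  interpret H: hilbert_space H by fact
  interpret K: hilbert_space K by fact
  have "0 \<le> hnorm K (T \<zero>\<^bsub>H\<^esub>)" using T by (intro K.hnorm_nonneg) (auto simp: bounded_operators_def)
  also have "\<dots> \<le> operator_norm H K T"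
    by (rule operator_norm_upper[OF H T]) (auto simp: H.hnorm_zero)
  finally show ?thesis .
qed

lemma hnorm_le_operator_norm:
  assumes H: "hilbert_space H" and K: "hilbert_space K" and T: "T \<in> bounded_operators H K"
    and x: "x \<in> carrier H"
  shows "hnorm K (T x) \<le> operator_norm H K T * hnorm H x"
proof -
  interpret H: hilbert_space H by fact
  interpret K: hilbert_space K by fact
  have Tx: "T x \<in> carrier K" using bounded_operators_closed[OF T x] .
  show ?thesis
  proof (cases "hnorm H x = 0")
    case True
    then have "x = \<zero>\<^bsub>H\<^esub>" using x H.inner_self[OF x] H.inner_definite by simp
    then show ?thesis using bounded_operators_zero[OF H K T] by (simp add: H.hnorm_zero K.hnorm_zero)
  next
    case False
    define r where "r = hnorm H x"
    have r: "r > 0" using False H.hnorm_nonneg[OF x] by (simp add: r_def)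
    define y where "y = complex_of_real (1 / r) \<odot>\<^bsub>H\<^esub> x"
    have y: "y \<in> carrier H" "hnorm H y \<le> 1"
      using x r unfolding y_def by (simp_all add: H.hnorm_smult norm_divide) (simp add: r_def)
    have "T y = complex_of_real (1 / r) \<odot>\<^bsub>K\<^esub> T x"
      using T x unfolding y_def bounded_operators_def by blast
    then have "hnorm K (T y) = hnorm K (T x) / r"
      using Tx r by (simp add: K.hnorm_smult norm_divide)
    then show ?thesis using operator_norm_upper[OF H T y] r by (simp add: r_def pos_divide_le_eq)
  qed
qed

definition decomposition_norm ::
  "nat \<Rightarrow> ('a, 'x) monoid_scheme \<Rightarrow> (nat \<Rightarrow> (complex + 'v) hilbert) \<Rightarrow>
    (nat \<Rightarrow> 'a \<Rightarrow> complex + 'v \<Rightarrow> complex + 'v) \<Rightarrow> real" where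
  "decomposition_norm d G H \<xi> =
     (\<Prod>i=1..d. SUP t\<in>carrier G. operator_norm (H i) (H (i - 1)) (\<xi> i t))"

lemma Md_decompositionD:
  assumes "Md_decomposition d G \<phi> H \<xi>"
  shows "\<And>i. i \<le> d \<Longrightarrow> hilbert_space (H i)" "H 0 = complex_line" "H d = complex_line"
    "\<And>i t. 1 \<le> i \<Longrightarrow> i \<le> d \<Longrightarrow> t \<in> carrier G \<Longrightarrow> \<xi> i t \<in> bounded_operators (H i) (H (i - 1))"
    "\<And>i. 1 \<le> i \<Longrightarrow> i \<le> d \<Longrightarrow> bdd_above ((\<lambda>t. operator_norm (H i) (H (i - 1)) (\<xi> i t)) ` carrier G)"
    "\<And>t. t \<in> {1..d} \<rightarrow> carrier G \<Longrightarrow> foldr (\<lambda>i. \<xi> i (t i)) [1..<Suc d] (Inl 1) =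
        Inl (\<phi> (foldr (\<lambda>i s. t i \<otimes>\<^bsub>G\<^esub> s) [1..<Suc d] \<one>\<^bsub>G\<^esub>))"
  using assms unfolding Md_decomposition_def by (auto simp del: upt_Suc)

lemma operator_norm_le_SUP:
  assumes "Md_decomposition d G \<phi> H \<xi>" "1 \<le> i" "i \<le> d" "t \<in> carrier G"
  shows "operator_norm (H i) (H (i - 1)) (\<xi> i t) \<le> (SUP t\<in>carrier G. operator_norm (H i) (H (i - 1)) (\<xi> i t))"
  using assms by (intro cSUP_upper Md_decompositionD(5))

lemma SUP_operator_norm_nonneg:
  assumes D: "Md_decomposition d G \<phi> H \<xi>" and "1 \<le> i" "i \<le> d" and G: "carrier G \<noteq> {}"
  shows "0 \<le> (SUP t\<in>carrier G. operator_norm (H i) (H (i - 1)) (\<xi> i t))"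
proof -
  obtain t where t: "t \<in> carrier G" using G by blast
  have "0 \<le> operator_norm (H i) (H (i - 1)) (\<xi> i t)"
    using assms t by (intro operator_norm_nonneg Md_decompositionD[OF D]) auto
  also note operator_norm_le_SUP[OF assms(1-3) t]
  finally show ?thesis .
qed

lemma decomposition_norm_nonneg:
  assumes "Md_decomposition d G \<phi> H \<xi>" "carrier G \<noteq> {}"
  shows "0 \<le> decomposition_norm d G H \<xi>"
  unfolding decomposition_norm_def using assms by (intro prod_nonneg SUP_operator_norm_nonneg) auto

text \<open>The value \<open>\<phi> x\<close> is the product \<open>\<xi>\<^sub>1(x) \<xi>\<^sub>2(1) \<dots> \<xi>\<^sub>d(1)\<close>.\<close>

lemma cmod_le_decomposition_norm:
  assumes D: "Md_decomposition d G \<phi> H \<xi>" and "group G" and d: "d \<ge> 1" and x: "x \<in> carrier G"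
  shows "cmod (\<phi> x) \<le> decomposition_norm d G H \<xi>"
proof -
  interpret group G by fact
  define t where "t i = (if i = 1 then x else \<one>\<^bsub>G\<^esub>)" for i :: nat
  have t: "t i \<in> carrier G" for i using x by (simp add: t_def)
  define B where "B i = (SUP t\<in>carrier G. operator_norm (H i) (H (i - 1)) (\<xi> i t))" for i
  define g where "g = (\<lambda>i. foldr (\<lambda>j. \<xi> j (t j)) [Suc i..<Suc d] (Inl 1))"
  have gi: "g i = \<xi> (Suc i) (t (Suc i)) (g (Suc i))" if "i < d" for i
    unfolding g_def using that by (subst upt_conv_Cons) auto
  have g: "g i \<in> carrier (H i) \<and> hnorm (H i) (g i) \<le> (\<Prod>j=Suc i..d. B j)" if "i \<le> d" for i
    using that
  proof (induction rule: inc_induct)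
    case base
    show ?case using Md_decompositionD(3)[OF D] by (simp add: g_def)
  next
    case (step n)
    have T: "\<xi> (Suc n) (t (Suc n)) \<in> bounded_operators (H (Suc n)) (H n)"
      using Md_decompositionD(4)[OF D, of "Suc n"] step t by simp
    have hs: "hilbert_space (H (Suc n))" "hilbert_space (H n)" using Md_decompositionD(1)[OF D] step by auto
    have "hnorm (H n) (g n) \<le> operator_norm (H (Suc n)) (H n) (\<xi> (Suc n) (t (Suc n))) * hnorm (H (Suc n)) (g (Suc n))"
      unfolding gi[OF step(2)] using step hs T by (intro hnorm_le_operator_norm) auto
    also have "\<dots> \<le> B (Suc n) * (\<Prod>j=Suc (Suc n)..d. B j)"
    proof (rule mult_mono)
      show "operator_norm (H (Suc n)) (H n) (\<xi> (Suc n) (t (Suc n))) \<le> B (Suc n)"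
        using operator_norm_le_SUP[OF D, of "Suc n" "t (Suc n)"] step t by (simp add: B_def)
      show "0 \<le> B (Suc n)" using SUP_operator_norm_nonneg[OF D, of "Suc n"] step x by (auto simp: B_def)
      show "0 \<le> hnorm (H (Suc n)) (g (Suc n))" using hs(1) step by (simp add: hilbert_space.hnorm_nonneg)
    qed (use step in simp)
    also have "\<dots> = (\<Prod>j=Suc n..d. B j)" using step(2) by (simp add: prod.atLeast_Suc_atMost)
    finally show ?case using bounded_operators_closed[OF T] step gi by simp
  qed
  have "foldr (\<lambda>i s. t i \<otimes>\<^bsub>G\<^esub> s) [Suc i..<Suc d] \<one>\<^bsub>G\<^esub> = \<one>\<^bsub>G\<^esub>" if "i \<le> d" "1 \<le> i" for i
    using that
  proof (induction rule: inc_induct)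
    case (step n)
    then show ?case by (subst upt_conv_Cons) (auto simp: t_def simp del: upt_Suc)
  qed simp
  then have "foldr (\<lambda>i s. t i \<otimes>\<^bsub>G\<^esub> s) [1..<Suc d] \<one>\<^bsub>G\<^esub> = x"
    using d x by (subst upt_conv_Cons) (auto simp: t_def simp del: upt_Suc)
  then have "g 0 = Inl (\<phi> x)"
    using Md_decompositionD(6)[OF D, of t] t by (simp add: g_def del: upt_Suc)
  then show ?thesis
    using g[of 0] Md_decompositionD(2)[OF D] by (simp add: decomposition_norm_def B_def)
qed

lemma Md_norm_altdef:
  "Md_norm d G \<phi> = Inf {decomposition_norm d G H \<xi> |
     (H :: nat \<Rightarrow> 'a universe hilbert) \<xi>. Md_decomposition d G \<phi> H \<xi>}" for \<phi> :: "'a \<Rightarrow> complex"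
  by (simp add: Md_norm_def decomposition_norm_def)

lemma Md_norm_lower:
  fixes H :: "nat \<Rightarrow> 'a universe hilbert" and \<phi> :: "'a \<Rightarrow> complex"
  assumes D: "Md_decomposition d G \<phi> H \<xi>" and G: "carrier G \<noteq> {}"
  shows "Md_norm d G \<phi> \<le> decomposition_norm d G H \<xi>"
  unfolding Md_norm_altdef
  by (rule cInf_lower) (use D decomposition_norm_nonneg[OF _ G] in \<open>auto intro!: bdd_belowI[of _ 0]\<close>)

lemma Md_norm_greatest:
  fixes \<phi> :: "'a \<Rightarrow> complex"
  assumes "\<phi> \<in> Md d G"
    and "\<And>(H :: nat \<Rightarrow> 'a universe hilbert) \<xi>. Md_decomposition d G \<phi> H \<xi> \<Longrightarrow> r \<le> decomposition_norm d G H \<xi>"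
  shows "r \<le> Md_norm d G \<phi>"
  unfolding Md_norm_altdef by (rule cInf_greatest) (use assms in \<open>auto simp: Md_def\<close>)

text \<open>A decomposition through Hilbert spaces in any type bounds the norm: moving it to the type used in
  the definition of \<^term>\<open>Md\<close> does not increase the operator norms.\<close>

lemma MdI:
  fixes H :: "nat \<Rightarrow> (complex + 'v) hilbert" and \<phi> :: "'a \<Rightarrow> complex"
  assumes D: "Md_decomposition d G \<phi> H \<xi>" and \<phi>: "\<And>t. t \<notin> carrier G \<Longrightarrow> \<phi> t = 0"
    and G: "carrier G \<noteq> {}"
    and c: "\<And>i t. 1 \<le> i \<Longrightarrow> i \<le> d \<Longrightarrow> t \<in> carrier G \<Longrightarrow> operator_norm (H i) (H (i - 1)) (\<xi> i t) \<le> c i"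
  shows "\<phi> \<in> Md d G" "Md_norm d G \<phi> \<le> (\<Prod>i=1..d. c i)"
proof -
  obtain H' :: "nat \<Rightarrow> 'a universe hilbert" and \<xi>' where D': "Md_decomposition d G \<phi> H' \<xi>'"
    and le: "\<And>i t. i \<in> {1..d} \<Longrightarrow> t \<in> carrier G \<Longrightarrow>
       operator_norm (H' i) (H' (i - 1)) (\<xi>' i t) \<le> operator_norm (H i) (H (i - 1)) (\<xi> i t)"
    using Md_decomposition_universe[OF D] by blast
  show "\<phi> \<in> Md d G" using D' \<phi> by (auto simp: Md_def)
  have "decomposition_norm d G H' \<xi>' \<le> (\<Prod>i=1..d. c i)"
    unfolding decomposition_norm_def
  proof (intro prod_mono conjI)
    fix i assume i: "i \<in> {1..d}"
    show "0 \<le> (SUP t\<in>carrier G. operator_norm (H' i) (H' (i - 1)) (\<xi>' i t))"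
      using SUP_operator_norm_nonneg[OF D' _ _ G, of i] i by simp
    show "(SUP t\<in>carrier G. operator_norm (H' i) (H' (i - 1)) (\<xi>' i t)) \<le> c i"
      using i by (intro cSUP_least[OF G] order_trans[OF le c]) auto
  qed
  then show "Md_norm d G \<phi> \<le> (\<Prod>i=1..d. c i)" using Md_norm_lower[OF D' G] by linarith
qed

lemma cmod_le_Md_norm:
  assumes "\<phi> \<in> Md d G" "group G" "d \<ge> 1" "x \<in> carrier G"
  shows "cmod (\<phi> x) \<le> Md_norm d G \<phi>"
  using assms by (intro Md_norm_greatest cmod_le_decomposition_norm)

text \<open>The scalar is absorbed by the first factor of a decomposition.\<close>

lemma Md_scale:
  fixes \<phi> :: "'a \<Rightarrow> complex"
  assumes \<phi>: "\<phi> \<in> Md d G" and "group G" and d: "d \<ge> 1" and c: "c \<noteq> 0"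
  shows "(\<lambda>t. c * \<phi> t) \<in> Md d G" "Md_norm d G (\<lambda>t. c * \<phi> t) \<le> cmod c * Md_norm d G \<phi>"
proof -
  interpret group G by fact
  have G: "carrier G \<noteq> {}" by blast
  have key: "(\<lambda>t. c * \<phi> t) \<in> Md d G \<and> Md_norm d G (\<lambda>t. c * \<phi> t) \<le> cmod c * decomposition_norm d G H \<xi>"
    if D: "Md_decomposition d G \<phi> H \<xi>" for H :: "nat \<Rightarrow> 'a universe hilbert" and \<xi>
  proof -
    define s where "s i x = (if i = (1::nat) then c \<odot>\<^bsub>complex_line\<^esub> x else x)" for i and x :: "'a universe"
    define \<xi>' where "\<xi>' i t x = s i (\<xi> i t x)" for i t x
    define b where "b i = (if i = 1 then cmod c else 1) * (SUP t\<in>carrier G. operator_norm (H i) (H (i - 1)) (\<xi> i t))" for i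
    note hs = Md_decompositionD(1)[OF D] and T = Md_decompositionD(4)[OF D]
    have hnorm_s: "hnorm (H (i - 1)) (s i x) = (if i = 1 then cmod c else 1) * hnorm (H (i - 1)) x"
      if "x \<in> carrier (H (i - 1))" for i x
      using that hilbert_space.hnorm_smult[OF hilbert_space_complex_line] Md_decompositionD(2)[OF D]
      by (auto simp: s_def)
    have le: "hnorm (H (i - 1)) (\<xi>' i t x) \<le> b i * hnorm (H i) x"
      if i: "1 \<le> i" "i \<le> d" and t: "t \<in> carrier G" and x: "x \<in> carrier (H i)" for i t x
    proof -
      have "hnorm (H (i - 1)) (\<xi> i t x) \<le> operator_norm (H i) (H (i - 1)) (\<xi> i t) * hnorm (H i) x"
        using hs T i t x by (intro hnorm_le_operator_norm) auto
      also have "\<dots> \<le> (SUP t\<in>carrier G. operator_norm (H i) (H (i - 1)) (\<xi> i t)) * hnorm (H i) x"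
        using operator_norm_le_SUP[OF D i t] hilbert_space.hnorm_nonneg[OF hs[OF i(2)] x]
        by (intro mult_right_mono)
      finally show ?thesis
        unfolding \<xi>'_def hnorm_s[OF bounded_operators_closed[OF T[OF i t] x]] b_def
        by (auto simp: mult.assoc intro: mult_left_mono)
    qed
    have b0: "0 \<le> b i" if "1 \<le> i" "i \<le> d" for i
      using SUP_operator_norm_nonneg[OF D that G] by (auto simp: b_def)
    have on: "operator_norm (H i) (H (i - 1)) (\<xi>' i t) \<le> b i"
      if "1 \<le> i" "i \<le> d" "t \<in> carrier G" for i t
      using that le b0 hs by (intro operator_norm_le) auto
    have bop: "\<xi>' i t \<in> bounded_operators (H i) (H (i - 1))"
      if i: "1 \<le> i" "i \<le> d" and t: "t \<in> carrier G" for i t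
    proof -
      interpret K: hilbert_space "H (i - 1)" using hs i by simp
      have s: "s i x \<in> carrier (H (i - 1))" "s i (a \<odot>\<^bsub>H (i - 1)\<^esub> x) = a \<odot>\<^bsub>H (i - 1)\<^esub> s i x"
        if "x \<in> carrier (H (i - 1))" for x a
        using that Md_decompositionD(2)[OF D]
        by (auto simp: s_def algebra_simps elim!: complex_line_carrierE)
      have s_add: "s i (x \<oplus>\<^bsub>H (i - 1)\<^esub> y) = s i x \<oplus>\<^bsub>H (i - 1)\<^esub> s i y"
        if "x \<in> carrier (H (i - 1))" "y \<in> carrier (H (i - 1))" for x y
        using that Md_decompositionD(2)[OF D]
        by (auto simp: s_def algebra_simps elim!: complex_line_carrierE)
      show ?thesis
        using T[OF i t] le[OF i t] unfolding bounded_operators_def \<xi>'_def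
        by (auto simp: s[unfolded One_nat_def] s_add[unfolded One_nat_def] Pi_iff)
    qed
    have "Md_decomposition d G (\<lambda>t. c * \<phi> t) H \<xi>'"
      unfolding Md_decomposition_def
    proof (intro conjI ballI allI impI)
      fix t assume t: "t \<in> {1..d} \<rightarrow> carrier G"
      have "foldr (\<lambda>i. \<xi>' i (t i)) [1..<Suc d] (Inl 1) = \<xi>' 1 (t 1) (foldr (\<lambda>i. \<xi>' i (t i)) [2..<Suc d] (Inl 1))"
        using d by (subst upt_conv_Cons) (auto simp: numeral_2_eq_2 simp del: upt_Suc)
      also have "foldr (\<lambda>i. \<xi>' i (t i)) [2..<Suc d] (Inl 1) = foldr (\<lambda>i. \<xi> i (t i)) [2..<Suc d] (Inl 1)"
        by (rule foldr_cong) (auto simp: \<xi>'_def s_def simp del: upt_Suc)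
      also have "\<xi>' 1 (t 1) \<dots> = s 1 (foldr (\<lambda>i. \<xi> i (t i)) [1..<Suc d] (Inl 1))"
        using d by (subst (2) upt_conv_Cons) (auto simp: \<xi>'_def numeral_2_eq_2 simp del: upt_Suc)
      finally show "foldr (\<lambda>i. \<xi>' i (t i)) [1..<Suc d] (Inl 1) =
          Inl (c * \<phi> (foldr (\<lambda>i s. t i \<otimes>\<^bsub>G\<^esub> s) [1..<Suc d] \<one>\<^bsub>G\<^esub>))"
        unfolding Md_decompositionD(6)[OF D t] by (simp add: s_def del: upt_Suc)
    next
      fix i assume "i \<in> {1..d}"
      then show "bdd_above ((\<lambda>t. operator_norm (H i) (H (i - 1)) (\<xi>' i t)) ` carrier G)"
        using on by (intro bdd_aboveI2[of _ _ "b i"]) simp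
    qed (use bop Md_decompositionD(1-3)[OF D] in auto)
    note res = MdI[OF this _ G on]
    have "(\<Prod>i=1..d. b i) = cmod c * decomposition_norm d G H \<xi>"
      using d by (simp add: b_def decomposition_norm_def prod.distrib prod.delta)
    then show ?thesis using res \<phi> by (simp add: Md_def)
  qed
  obtain H :: "nat \<Rightarrow> 'a universe hilbert" and \<xi> where "Md_decomposition d G \<phi> H \<xi>"
    using \<phi> by (auto simp: Md_def)
  from key[OF this] show "(\<lambda>t. c * \<phi> t) \<in> Md d G" ..
  have "Md_norm d G (\<lambda>t. c * \<phi> t) / cmod c \<le> Md_norm d G \<phi>"
    using key c \<phi> by (intro Md_norm_greatest) (auto simp: pos_divide_le_eq mult.commute)
  then show "Md_norm d G (\<lambda>t. c * \<phi> t) \<le> cmod c * Md_norm d G \<phi>"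
    using c by (simp add: pos_divide_le_eq mult.commute)
qed

section \<open>Pull-backs and regular coefficients\<close>

lemma hom_foldr_mult:
  assumes "group W" "group G" and q: "q \<in> hom W G" and t: "\<And>i. i \<in> set xs \<Longrightarrow> t i \<in> carrier W"
  shows "foldr (\<lambda>i s. t i \<otimes>\<^bsub>W\<^esub> s) xs \<one>\<^bsub>W\<^esub> \<in> carrier W"
    and "q (foldr (\<lambda>i s. t i \<otimes>\<^bsub>W\<^esub> s) xs \<one>\<^bsub>W\<^esub>) = foldr (\<lambda>i s. q (t i) \<otimes>\<^bsub>G\<^esub> s) xs \<one>\<^bsub>G\<^esub>"
proof -
  interpret W: group W by fact
  have "foldr (\<lambda>i s. t i \<otimes>\<^bsub>W\<^esub> s) xs \<one>\<^bsub>W\<^esub> \<in> carrier W \<and>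
      q (foldr (\<lambda>i s. t i \<otimes>\<^bsub>W\<^esub> s) xs \<one>\<^bsub>W\<^esub>) = foldr (\<lambda>i s. q (t i) \<otimes>\<^bsub>G\<^esub> s) xs \<one>\<^bsub>G\<^esub>"
    using t hom_one[OF q assms(1,2)] hom_mult[OF q] by (induction xs) auto
  then show "foldr (\<lambda>i s. t i \<otimes>\<^bsub>W\<^esub> s) xs \<one>\<^bsub>W\<^esub> \<in> carrier W"
    and "q (foldr (\<lambda>i s. t i \<otimes>\<^bsub>W\<^esub> s) xs \<one>\<^bsub>W\<^esub>) = foldr (\<lambda>i s. q (t i) \<otimes>\<^bsub>G\<^esub> s) xs \<one>\<^bsub>G\<^esub>"
    by blast+
qed

definition pullback :: "('w, 'z) monoid_scheme \<Rightarrow> ('w \<Rightarrow> 'a) \<Rightarrow> ('a \<Rightarrow> complex) \<Rightarrow> 'w \<Rightarrow> complex" where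
  "pullback W q \<phi> w = (if w \<in> carrier W then \<phi> (q w) else 0)"

text \<open>Since \<open>q\<close> is a homomorphism, a decomposition \<open>\<xi>\<close> of \<open>\<phi>\<close> yields the decomposition \<open>\<xi>\<^sub>i \<circ> q\<close> of \<open>\<phi> \<circ> q\<close>.\<close>

lemma Md_pullback:
  fixes \<phi> :: "'a \<Rightarrow> complex"
  assumes "group W" "group G" and q: "q \<in> hom W G" and \<phi>: "\<phi> \<in> Md d G"
  shows "pullback W q \<phi> \<in> Md d W" "Md_norm d W (pullback W q \<phi>) \<le> Md_norm d G \<phi>"
proof -
  interpret W: group W by fact
  interpret G: group G by fact
  have W: "carrier W \<noteq> {}" and G: "carrier G \<noteq> {}" by blast+
  have qc: "q w \<in> carrier G" if "w \<in> carrier W" for w using q that by (auto simp: hom_def)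
  have key: "pullback W q \<phi> \<in> Md d W \<and> Md_norm d W (pullback W q \<phi>) \<le> decomposition_norm d G H \<xi>"
    if D: "Md_decomposition d G \<phi> H \<xi>" for H :: "nat \<Rightarrow> 'a universe hilbert" and \<xi>
  proof -
    have le: "operator_norm (H i) (H (i - 1)) (\<xi> i (q t)) \<le>
        (SUP t\<in>carrier G. operator_norm (H i) (H (i - 1)) (\<xi> i t))"
      if "1 \<le> i" "i \<le> d" "t \<in> carrier W" for i t
      using operator_norm_le_SUP[OF D that(1,2) qc[OF that(3)]] .
    have "Md_decomposition d W (pullback W q \<phi>) H (\<lambda>i t. \<xi> i (q t))"
      unfolding Md_decomposition_def
    proof (intro conjI ballI allI impI)
      fix t assume t: "t \<in> {1..d} \<rightarrow> carrier W"
      then have t': "t i \<in> carrier W" if "i \<in> set [1..<Suc d]" for i using that by auto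
      show "foldr (\<lambda>i. \<xi> i (q (t i))) [1..<Suc d] (Inl 1) =
          Inl (pullback W q \<phi> (foldr (\<lambda>i s. t i \<otimes>\<^bsub>W\<^esub> s) [1..<Suc d] \<one>\<^bsub>W\<^esub>))"
        using Md_decompositionD(6)[OF D, of "\<lambda>i. q (t i)"] t qc hom_foldr_mult(1)[of W G q "[1..<Suc d]" t]
          hom_foldr_mult(2)[of W G q "[1..<Suc d]" t] assms(1-3) t'
        by (simp add: pullback_def Pi_iff del: upt_Suc)
    next
      fix i assume "i \<in> {1..d}"
      then show "bdd_above ((\<lambda>t. operator_norm (H i) (H (i - 1)) (\<xi> i (q t))) ` carrier W)"
        using le by (intro bdd_aboveI2) auto
    qed (use Md_decompositionD(1-4)[OF D] qc in auto)
    note res = MdI[OF this _ W le]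
    show ?thesis using res by (simp add: pullback_def decomposition_norm_def)
  qed
  then show "pullback W q \<phi> \<in> Md d W" using \<phi> by (auto simp: Md_def)
  show "Md_norm d W (pullback W q \<phi>) \<le> Md_norm d G \<phi>"
    using key \<phi> by (intro Md_norm_greatest) auto
qed

text \<open>The left regular representation, on functions on the whole type. It discards values outside the
  carrier and is therefore contractive, but isometric only on functions supported in the carrier.\<close>

definition translate :: "('a, 'x) monoid_scheme \<Rightarrow> 'a \<Rightarrow> ('a \<Rightarrow> complex) \<Rightarrow> 'a \<Rightarrow> complex" where
  "translate G t f z = (if z \<in> carrier G then f (inv\<^bsub>G\<^esub> t \<otimes>\<^bsub>G\<^esub> z) else 0)"

lemma translate_translate:
  assumes "group G" "t \<in> carrier G" "s \<in> carrier G"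
  shows "translate G t (translate G s f) = translate G (t \<otimes>\<^bsub>G\<^esub> s) f"
proof -
  interpret group G by fact
  show ?thesis using assms by (auto simp: translate_def fun_eq_iff inv_mult_group m_assoc)
qed

lemma translate_contractive:
  assumes "group G" and t: "t \<in> carrier G" and f: "sq_summable f"
  shows "sq_summable (translate G t f)" "l2_norm (translate G t f) \<le> l2_norm f"
proof -
  interpret group G by fact
  have fin: "(\<Sum>z\<in>F. (cmod (translate G t f z))\<^sup>2) \<le> (\<Sum>\<^sub>\<infinity>z. (cmod (f z))\<^sup>2)" if F: "finite F" for F
  proof -
    have "(\<Sum>z\<in>F. (cmod (translate G t f z))\<^sup>2) = (\<Sum>z\<in>F \<inter> carrier G. (cmod (f (inv\<^bsub>G\<^esub> t \<otimes>\<^bsub>G\<^esub> z)))\<^sup>2)"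
      by (rule sum.mono_neutral_cong_right) (auto simp: F translate_def)
    also have "\<dots> = (\<Sum>z\<in>(\<lambda>z. inv\<^bsub>G\<^esub> t \<otimes>\<^bsub>G\<^esub> z) ` (F \<inter> carrier G). (cmod (f z))\<^sup>2)"
      by (subst sum.reindex) (use inj_on_subset[OF inj_on_cmult[of "inv\<^bsub>G\<^esub> t"]] t in auto)
    also have "\<dots> \<le> (\<Sum>\<^sub>\<infinity>z. (cmod (f z))\<^sup>2)"
      by (rule finite_sum_le_infsum) (use f F in \<open>auto simp: sq_summable_def\<close>)
    finally show ?thesis .
  qed
  show sq: "sq_summable (translate G t f)"
    unfolding sq_summable_def by (rule nonneg_bdd_above_summable_on) (use fin in \<open>auto intro!: bdd_aboveI2\<close>)
  show "l2_norm (translate G t f) \<le> l2_norm f"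
    unfolding l2_norm_def
    by (intro real_sqrt_le_mono infsum_le_finite_sums) (use sq fin in \<open>auto simp: sq_summable_def\<close>)
qed

text \<open>The coefficient \<open>x \<mapsto> \<langle>\<lambda>(x) a, b\<rangle>\<close> of the left regular representation.\<close>

definition regular_coefficient ::
  "('a, 'x) monoid_scheme \<Rightarrow> ('a \<Rightarrow> complex) \<Rightarrow> ('a \<Rightarrow> complex) \<Rightarrow> 'a \<Rightarrow> complex" where
  "regular_coefficient G a b x = (if x \<in> carrier G then \<Sum>\<^sub>\<infinity>z. translate G x a z * cnj (b z) else 0)"

text \<open>From \<open>\<langle>\<lambda>(t\<^sub>1 \<dots> t\<^sub>d) a, b\<rangle> = \<langle>\<lambda>(t\<^sub>1) \<dots> \<lambda>(t\<^sub>d) a, b\<rangle>\<close> one reads off a decomposition: the middle factors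
  are \<open>\<lambda>(t\<^sub>i)\<close>, the last factor maps \<open>z\<close> to \<open>z \<lambda>(t\<^sub>d) a\<close>, and the first one pairs \<open>\<lambda>(t\<^sub>1) h\<close> with \<open>b\<close>. The norm bound
  depends on \<open>a\<close> and \<open>b\<close> only through their norms.\<close>

lemma regular_coefficient_Md:
  fixes a b :: "'a \<Rightarrow> complex"
  assumes "group G" and d: "d \<ge> 1" and a: "sq_summable a" and b: "sq_summable b"
  shows "regular_coefficient G a b \<in> Md d G"
    and "Md_norm d G (regular_coefficient G a b) \<le> l2_norm a * l2_norm b"
proof -
  interpret group G by fact
  define H :: "nat \<Rightarrow> (complex + ('a \<Rightarrow> complex)) hilbert" where "H i = (if i = 0 \<or> i = d then complex_line else ell2)" for i
  \<comment> \<open>For \<open>d = 1\<close> the only factor both enters and leaves \<open>\<ell>\<^sup>2\<close>, which is why the two ends are handled by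
    separate maps.\<close>
  define enter :: "nat \<Rightarrow> (complex + ('a \<Rightarrow> complex)) \<Rightarrow> 'a \<Rightarrow> complex" where
    "enter i v = (if i = d then (\<lambda>z. projl v * a z) else projr v)" for i v
  define exit :: "nat \<Rightarrow> ('a \<Rightarrow> complex) \<Rightarrow> (complex + ('a \<Rightarrow> complex))" where
    "exit i h = (if i = 1 then Inl (\<Sum>\<^sub>\<infinity>z. h z * cnj (b z)) else Inr h)" for i h
  define \<xi> where "\<xi> i t v = exit i (translate G t (enter i v))" for i t v
  define c where "c i = (if i = 1 then l2_norm b else 1) * (if i = d then l2_norm a else 1)" for i
  have Hi: "hilbert_space (H i)" for i
    by (simp add: H_def hilbert_space_complex_line hilbert_space_ell2)
  have enter: "sq_summable (enter i v)" "l2_norm (enter i v) \<le> (if i = d then l2_norm a else 1) * hnorm (H i) v"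
    "enter i (v \<oplus>\<^bsub>H i\<^esub> w) = (\<lambda>z. enter i v z + enter i w z)" "enter i (k \<odot>\<^bsub>H i\<^esub> v) = (\<lambda>z. k * enter i v z)"
    if "1 \<le> i" "v \<in> carrier (H i)" "w \<in> carrier (H i)" for i v w k
    using that a by (auto simp: enter_def H_def sq_summable_scale l2_norm_scale distrib_right mult.assoc
        elim!: complex_line_carrierE ell2_carrierE)
  have exit: "exit i h \<in> carrier (H (i - 1))" "hnorm (H (i - 1)) (exit i h) \<le> (if i = 1 then l2_norm b else 1) * l2_norm h"
    "exit i (\<lambda>z. h z + k z) = exit i h \<oplus>\<^bsub>H (i - 1)\<^esub> exit i k"
    "exit i (\<lambda>z. m * h z) = m \<odot>\<^bsub>H (i - 1)\<^esub> exit i h"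
    if "1 \<le> i" "i \<le> d" "sq_summable h" "sq_summable k" for i h k m
    using that b l2_Cauchy_Schwarz[of h b]
    by (auto simp: exit_def H_def mult.commute[of "l2_norm b"] distrib_right mult.assoc infsum_add
        infsum_cmult_right sq_summable_inner)
  have tr: "sq_summable (translate G t (enter i v))" if "1 \<le> i" "v \<in> carrier (H i)" "t \<in> carrier G" for i v t
    using that enter(1) translate_contractive(1)[OF \<open>group G\<close>] by blast
  have tr_lin: "translate G t (\<lambda>z. f z + g z) = (\<lambda>z. translate G t f z + translate G t g z)"
    "translate G t (\<lambda>z. k * f z) = (\<lambda>z. k * translate G t f z)" for t f g k
    by (auto simp: translate_def fun_eq_iff)
  have le: "hnorm (H (i - 1)) (\<xi> i t v) \<le> c i * hnorm (H i) v"
    if i: "1 \<le> i" "i \<le> d" and t: "t \<in> carrier G" and v: "v \<in> carrier (H i)" for i t v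
  proof -
    have "hnorm (H (i - 1)) (\<xi> i t v) \<le> (if i = 1 then l2_norm b else 1) * l2_norm (translate G t (enter i v))"
      unfolding \<xi>_def using i tr[OF i(1) v t] by (intro exit(2)) auto
    also have "\<dots> \<le> (if i = 1 then l2_norm b else 1) * ((if i = d then l2_norm a else 1) * hnorm (H i) v)"
      using order_trans[OF translate_contractive(2)[OF \<open>group G\<close> t enter(1)[OF i(1) v v]] enter(2)[OF i(1) v v]]
      by (intro mult_left_mono) (auto simp: l2_norm_nonneg)
    finally show ?thesis by (simp add: c_def mult.assoc)
  qed
  have c0: "0 \<le> c i" for i by (simp add: c_def l2_norm_nonneg)
  have on: "operator_norm (H i) (H (i - 1)) (\<xi> i t) \<le> c i" if "1 \<le> i" "i \<le> d" "t \<in> carrier G" for i t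
    using le that c0 Hi by (intro operator_norm_le) auto
  have bop: "\<xi> i t \<in> bounded_operators (H i) (H (i - 1))" if i: "1 \<le> i" "i \<le> d" and t: "t \<in> carrier G" for i t
    unfolding bounded_operators_def
  proof (intro CollectI conjI ballI allI)
    show "\<exists>C. \<forall>v\<in>carrier (H i). hnorm (H (i - 1)) (\<xi> i t v) \<le> C * hnorm (H i) v" using le[OF i t] by blast
    show "\<xi> i t \<in> carrier (H i) \<rightarrow> carrier (H (i - 1))" unfolding \<xi>_def by (intro funcsetI exit(1)[OF i _ sq_summable_zero] tr i t)
    show "\<xi> i t (v \<oplus>\<^bsub>H i\<^esub> w) = \<xi> i t v \<oplus>\<^bsub>H (i - 1)\<^esub> \<xi> i t w" if "v \<in> carrier (H i)" "w \<in> carrier (H i)" for v w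
      unfolding \<xi>_def enter(3)[OF i(1) that] tr_lin by (intro exit(3) i tr t that)
    show "\<xi> i t (k \<odot>\<^bsub>H i\<^esub> v) = k \<odot>\<^bsub>H (i - 1)\<^esub> \<xi> i t v" if "v \<in> carrier (H i)" for k v
      unfolding \<xi>_def enter(4)[OF i(1) that that] tr_lin by (intro exit(4)[OF i _ sq_summable_zero] tr i t that)
  qed
  have "Md_decomposition d G (regular_coefficient G a b) H \<xi>"
    unfolding Md_decomposition_def
  proof (intro conjI ballI allI impI)
    fix t assume t: "t \<in> {1..d} \<rightarrow> carrier G"
    define P where "P j = foldr (\<lambda>i s. t i \<otimes>\<^bsub>G\<^esub> s) [j..<Suc d] \<one>\<^bsub>G\<^esub>" for j
    have Pj: "P j = t j \<otimes>\<^bsub>G\<^esub> P (Suc j)" if "j \<le> d" for j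
      unfolding P_def using that by (subst upt_conv_Cons) (auto simp del: upt_Suc)
    have "P j \<in> carrier G \<and> foldr (\<lambda>i. \<xi> i (t i)) [j..<Suc d] (Inl 1) = exit j (translate G (P j) a)"
      if "1 \<le> j" "j \<le> d" for j
      using that(2,1)
    proof (induction rule: inc_induct)
      case base
      then have "t d \<in> carrier G" using t by auto
      then show ?case using base by (simp add: P_def \<xi>_def enter_def)
    next
      case (step j)
      then have tj: "t j \<in> carrier G" using t by auto
      have PS: "P (Suc j) \<in> carrier G"
        and IH: "foldr (\<lambda>i. \<xi> i (t i)) [Suc j..<Suc d] (Inl 1) = exit (Suc j) (translate G (P (Suc j)) a)"
        using step by (auto simp del: upt_Suc)
      have "foldr (\<lambda>i. \<xi> i (t i)) [j..<Suc d] (Inl 1) =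
          \<xi> j (t j) (foldr (\<lambda>i. \<xi> i (t i)) [Suc j..<Suc d] (Inl 1))"
        using step by (subst upt_conv_Cons) (auto simp del: upt_Suc)
      also have "\<dots> = exit j (translate G (t j) (translate G (P (Suc j)) a))"
        unfolding IH using step by (simp add: \<xi>_def enter_def exit_def[of "Suc j"])
      also have "\<dots> = exit j (translate G (P j) a)"
        using translate_translate[OF \<open>group G\<close> tj PS] Pj[of j] step by simp
      finally show ?case using tj PS Pj[of j] step by simp
    qed
    from this[of 1] show "foldr (\<lambda>i. \<xi> i (t i)) [1..<Suc d] (Inl 1) =
        Inl (regular_coefficient G a b (foldr (\<lambda>i s. t i \<otimes>\<^bsub>G\<^esub> s) [1..<Suc d] \<one>\<^bsub>G\<^esub>))"
      using d by (simp add: P_def exit_def regular_coefficient_def del: upt_Suc)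
  next
    fix i assume "i \<in> {1..d}"
    then show "bdd_above ((\<lambda>t. operator_norm (H i) (H (i - 1)) (\<xi> i t)) ` carrier G)"
      using on by (intro bdd_aboveI2) auto
  next
    show "H 0 = complex_line" "H d = complex_line" by (simp_all add: H_def)
  qed (use Hi bop in auto)
  note res = MdI[OF this _ _ on]
  have "(\<Prod>i=1..d. c i) = l2_norm b * l2_norm a"
    using d by (simp add: c_def prod.distrib prod.delta)
  then show "regular_coefficient G a b \<in> Md d G"
    and "Md_norm d G (regular_coefficient G a b) \<le> l2_norm a * l2_norm b"
    using res by (auto simp: regular_coefficient_def mult.commute)
qed

lemma regular_coefficient_finite:
  assumes "group G" and S: "finite S" "S \<subseteq> carrier G" and a: "\<And>y. y \<notin> S \<Longrightarrow> a y = 0" and x: "x \<in> carrier G"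
  shows "regular_coefficient G a b x = (\<Sum>y\<in>S. a y * cnj (b (x \<otimes>\<^bsub>G\<^esub> y)))"
proof -
  interpret group G by fact
  have "(\<Sum>\<^sub>\<infinity>z. translate G x a z * cnj (b z)) =
      (\<Sum>\<^sub>\<infinity>z\<in>(\<lambda>y. x \<otimes>\<^bsub>G\<^esub> y) ` S. translate G x a z * cnj (b z))"
  proof (rule infsum_cong_neutral)
    fix z assume z: "z \<in> UNIV - (\<lambda>y. x \<otimes>\<^bsub>G\<^esub> y) ` S"
    have "inv\<^bsub>G\<^esub> x \<otimes>\<^bsub>G\<^esub> z \<notin> S" if "z \<in> carrier G"
    proof
      assume "inv\<^bsub>G\<^esub> x \<otimes>\<^bsub>G\<^esub> z \<in> S"
      moreover have "z = x \<otimes>\<^bsub>G\<^esub> (inv\<^bsub>G\<^esub> x \<otimes>\<^bsub>G\<^esub> z)" using x that by (simp add: m_assoc[symmetric])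
      ultimately show False using z by blast
    qed
    then show "translate G x a z * cnj (b z) = 0" by (simp add: translate_def a)
  qed auto
  also have "\<dots> = (\<Sum>z\<in>(\<lambda>y. x \<otimes>\<^bsub>G\<^esub> y) ` S. translate G x a z * cnj (b z))" using S by simp
  also have "\<dots> = (\<Sum>y\<in>S. a y * cnj (b (x \<otimes>\<^bsub>G\<^esub> y)))"
    by (subst sum.reindex[OF inj_on_subset[OF inj_on_cmult[OF x] S(2)]])
      (use S x in \<open>auto simp: translate_def m_assoc[symmetric] intro!: sum.cong\<close>)
  finally show ?thesis using x by (simp add: regular_coefficient_def)
qed

section \<open>The duality between \<open>X\<^sub>d\<close> and \<open>M\<^sub>d\<close>\<close>

lemma pairing_eq_sum:
  assumes "finite A" "{t. g t \<noteq> 0} \<subseteq> A"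
  shows "pairing \<phi> g = (\<Sum>t\<in>A. \<phi> t * g t)"
  unfolding pairing_def by (rule sum.mono_neutral_left) (use assms in auto)

lemma finsupp_diff: "g \<in> finsupp G \<Longrightarrow> h \<in> finsupp G \<Longrightarrow> (\<lambda>t. g t - h t) \<in> finsupp G"
proof -
  assume gh: "g \<in> finsupp G" "h \<in> finsupp G"
  have sub: "{t. g t - h t \<noteq> 0} \<subseteq> {t. g t \<noteq> 0} \<union> {t. h t \<noteq> 0}" by auto
  have "finite ({t. g t \<noteq> 0} \<union> {t. h t \<noteq> 0})" "{t. g t \<noteq> 0} \<union> {t. h t \<noteq> 0} \<subseteq> carrier G"
    using gh by (simp_all add: finsupp_def)
  then show ?thesis
    unfolding finsupp_def using finite_subset[OF sub] order_trans[OF sub] by simp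
qed

lemma pairing_diff:
  assumes "g \<in> finsupp G" "h \<in> finsupp G"
  shows "pairing \<phi> (\<lambda>t. g t - h t) = pairing \<phi> g - pairing \<phi> h"
proof -
  define A where "A = {t. g t \<noteq> 0} \<union> {t. h t \<noteq> 0}"
  have A: "finite A" using assms by (simp add: finsupp_def A_def)
  have "pairing \<phi> (\<lambda>t. g t - h t) = (\<Sum>t\<in>A. \<phi> t * (g t - h t))" "pairing \<phi> g = (\<Sum>t\<in>A. \<phi> t * g t)"
    "pairing \<phi> h = (\<Sum>t\<in>A. \<phi> t * h t)"
    by (rule pairing_eq_sum[OF A]; force simp: A_def)+
  then show ?thesis by (simp add: right_diff_distrib sum_subtractf)
qed

lemma pairing_scale: "pairing (\<lambda>t. c * \<phi> t) g = c * pairing \<phi> g"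
  by (simp add: pairing_def sum_distrib_left mult.assoc)

lemma zero_in_Md:
  assumes "group G" "d \<ge> 1" shows "(\<lambda>_. 0) \<in> Md d G" "Md_norm d G (\<lambda>_. 0) \<le> 0"
proof -
  have "regular_coefficient G (\<lambda>_. 0) (\<lambda>_. 0) = (\<lambda>_. 0)"
    by (simp add: regular_coefficient_def translate_def fun_eq_iff)
  then show "(\<lambda>_. 0) \<in> Md d G" "Md_norm d G (\<lambda>_. 0) \<le> 0"
    using regular_coefficient_Md[OF assms sq_summable_zero sq_summable_zero] by (auto simp: l2_norm_def)
qed

lemma Md_norm_nonneg:
  assumes "\<phi> \<in> Md d G" "group G" "d \<ge> 1" shows "0 \<le> Md_norm d G \<phi>"
proof -
  interpret group G by fact
  show ?thesis using order_trans[OF norm_ge_zero cmod_le_Md_norm[OF assms one_closed]] .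
qed

text \<open>The definition of \<^term>\<open>Xd_norm\<close> is the case \<open>C = 1\<close>, once the supremum in it is known to be finite. This
  follows from \<open>\<bar>\<phi> t\<bar> \<le> Md_norm d G \<phi>\<close>. A free bound \<open>C > 0\<close> instead of the norm of \<open>\<phi>\<close> spares a case
  distinction for norm \<open>0\<close>.\<close>

lemma pairing_le_Xd_norm:
  assumes "group G" "d \<ge> 1" and \<phi>: "\<phi> \<in> Md d G" "Md_norm d G \<phi> \<le> C" "C > 0" and g: "g \<in> finsupp G"
  shows "cmod (pairing \<phi> g) \<le> C * Xd_norm d G g"
proof -
  define \<psi> where "\<psi> = (\<lambda>t. complex_of_real (1 / C) * \<phi> t)"
  have "Md_norm d G \<psi> \<le> cmod (complex_of_real (1 / C)) * Md_norm d G \<phi>"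
    unfolding \<psi>_def using \<phi> assms(1,2) by (intro Md_scale) auto
  also have "\<dots> \<le> 1" using \<phi> by (simp add: norm_divide)
  finally have \<psi>_norm: "Md_norm d G \<psi> \<le> 1" .
  have \<psi>_Md: "\<psi> \<in> Md d G"
    unfolding \<psi>_def by (rule Md_scale(1)[OF \<phi>(1) assms(1,2)]) (use \<phi>(3) in simp)
  have "bdd_above ((\<lambda>\<phi>. cmod (pairing \<phi> g)) ` {\<phi> \<in> Md d G. Md_norm d G \<phi> \<le> 1})"
  proof (rule bdd_aboveI2)
    fix \<phi> assume \<phi>: "\<phi> \<in> {\<phi> \<in> Md d G. Md_norm d G \<phi> \<le> 1}"
    have "cmod (pairing \<phi> g) \<le> (\<Sum>t | g t \<noteq> 0. cmod (\<phi> t) * cmod (g t))"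
      unfolding pairing_def by (rule order_trans[OF norm_sum]) (simp add: norm_mult)
    also have "\<dots> \<le> (\<Sum>t | g t \<noteq> 0. cmod (g t))"
    proof (rule sum_mono)
      fix t assume "t \<in> {t. g t \<noteq> 0}"
      then have "cmod (\<phi> t) \<le> 1"
        using cmod_le_Md_norm[of \<phi> d G t] \<phi> assms(1,2) g by (auto simp: finsupp_def subset_iff)
      then show "cmod (\<phi> t) * cmod (g t) \<le> cmod (g t)" by (simp add: mult_left_le_one_le)
    qed
    finally show "cmod (pairing \<phi> g) \<le> (\<Sum>t | g t \<noteq> 0. cmod (g t))" .
  qed
  then have "cmod (pairing \<psi> g) \<le> Xd_norm d G g"
    unfolding Xd_norm_def by (rule cSUP_upper[rotated]) (use \<psi>_norm \<psi>_Md in simp)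
  moreover have "cmod (pairing \<psi> g) = cmod (pairing \<phi> g) / C"
    using \<phi>(3) unfolding \<psi>_def pairing_scale by (simp add: norm_mult norm_divide)
  ultimately show ?thesis using \<phi>(3) by (simp add: pos_divide_le_eq mult.commute)
qed

lemma Xd_norm_le:
  assumes "group G" "d \<ge> 1"
    and "\<And>\<phi>. \<phi> \<in> Md d G \<Longrightarrow> Md_norm d G \<phi> \<le> 1 \<Longrightarrow> cmod (pairing \<phi> g) \<le> r"
  shows "Xd_norm d G g \<le> r"
  unfolding Xd_norm_def
proof (rule cSUP_least)
  show "{\<phi> \<in> Md d G. Md_norm d G \<phi> \<le> 1} \<noteq> {}" using zero_in_Md[OF assms(1,2)] by force
qed (use assms(3) in auto)

lemma Xd_norm_zero:
  assumes "group G" "d \<ge> 1" shows "Xd_norm d G (\<lambda>_. 0) = 0"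
proof (rule antisym)
  show "Xd_norm d G (\<lambda>_. 0) \<le> 0" by (rule Xd_norm_le[OF assms]) (simp add: pairing_def)
  show "0 \<le> Xd_norm d G (\<lambda>_. 0)"
    using pairing_le_Xd_norm[OF assms zero_in_Md(1)[OF assms], of 1 "\<lambda>_. 0"] zero_in_Md(2)[OF assms]
    by (simp add: finsupp_def pairing_def)
qed

text \<open>The index \<open>N\<close> serves all multipliers \<open>\<phi>\<close> at once. This uniformity is the reason why, on bounded sets
  of multipliers, pointwise approximation implies approximation in the weak topology.\<close>

lemma Xd_Cauchy_pairing_Cauchy:
  assumes "group G" "d \<ge> 1" and s: "s \<in> Xd_Cauchy d G" and e: "e > 0"
  shows "\<exists>N. \<forall>\<phi> C. \<phi> \<in> Md d G \<longrightarrow> Md_norm d G \<phi> \<le> C \<longrightarrow> C > 0 \<longrightarrow>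
    (\<forall>m\<ge>N. \<forall>n\<ge>N. cmod (pairing \<phi> (s m) - pairing \<phi> (s n)) \<le> C * e)"
proof -
  have fs: "s n \<in> finsupp G" for n using s by (simp add: Xd_Cauchy_def)
  obtain N where N: "\<And>m n. m \<ge> N \<Longrightarrow> n \<ge> N \<Longrightarrow> Xd_norm d G (\<lambda>t. s m t - s n t) < e"
    using s e unfolding Xd_Cauchy_def by blast
  have "cmod (pairing \<phi> (s m) - pairing \<phi> (s n)) \<le> C * e"
    if \<phi>: "\<phi> \<in> Md d G" "Md_norm d G \<phi> \<le> C" "C > 0" and mn: "m \<ge> N" "n \<ge> N" for \<phi> C m n
  proof -
    have "cmod (pairing \<phi> (s m) - pairing \<phi> (s n)) \<le> C * Xd_norm d G (\<lambda>t. s m t - s n t)"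
      unfolding pairing_diff[OF fs fs, symmetric] by (intro pairing_le_Xd_norm assms \<phi> finsupp_diff fs)
    also have "\<dots> \<le> C * e" using N[OF mn] \<phi>(3) by (intro mult_left_mono) auto
    finally show ?thesis .
  qed
  then show ?thesis by blast
qed

lemma Xd_Cauchy_pairing_tendsto:
  assumes "group G" "d \<ge> 1" and s: "s \<in> Xd_Cauchy d G" and \<phi>: "\<phi> \<in> Md d G"
  shows "(\<lambda>n. pairing \<phi> (s n)) \<longlonglongrightarrow> lim (\<lambda>n. pairing \<phi> (s n))"
proof -
  define C where "C = 1 + Md_norm d G \<phi>"
  have C: "Md_norm d G \<phi> \<le> C" "C > 0" using Md_norm_nonneg[OF \<phi> assms(1,2)] by (auto simp: C_def)
  have "Cauchy (\<lambda>n. pairing \<phi> (s n))"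
  proof (rule CauchyI)
    fix e :: real assume e: "e > 0"
    then have e': "e / (2 * C) > 0" using C by simp
    obtain N where N: "\<And>m n. m \<ge> N \<Longrightarrow> n \<ge> N \<Longrightarrow> cmod (pairing \<phi> (s m) - pairing \<phi> (s n)) \<le> C * (e / (2 * C))"
      using Xd_Cauchy_pairing_Cauchy[OF assms(1-3) e'] C \<phi> by blast
    have "C * (e / (2 * C)) < e" using e C by simp
    then show "\<exists>M. \<forall>m\<ge>M. \<forall>n\<ge>M. norm (pairing \<phi> (s m) - pairing \<phi> (s n)) < e"
      using N by (meson le_less_trans)
  qed
  then show ?thesis using Cauchy_convergent_iff convergent_LIMSEQ_iff by blast
qed

lemma Xd_Cauchy_pairing_tail:
  assumes "group G" "d \<ge> 1" and s: "s \<in> Xd_Cauchy d G" and e: "e > 0"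
  shows "\<exists>N. \<forall>\<phi> C. \<phi> \<in> Md d G \<longrightarrow> Md_norm d G \<phi> \<le> C \<longrightarrow> C > 0 \<longrightarrow>
    cmod (lim (\<lambda>n. pairing \<phi> (s n)) - pairing \<phi> (s N)) \<le> C * e"
proof -
  obtain N where N: "\<And>\<phi> C m n. \<phi> \<in> Md d G \<Longrightarrow> Md_norm d G \<phi> \<le> C \<Longrightarrow> C > 0 \<Longrightarrow> m \<ge> N \<Longrightarrow> n \<ge> N \<Longrightarrow>
      cmod (pairing \<phi> (s m) - pairing \<phi> (s n)) \<le> C * e"
    using Xd_Cauchy_pairing_Cauchy[OF assms] by blast
  have "cmod (lim (\<lambda>n. pairing \<phi> (s n)) - pairing \<phi> (s N)) \<le> C * e"
    if \<phi>: "\<phi> \<in> Md d G" "Md_norm d G \<phi> \<le> C" "C > 0" for \<phi> C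
  proof (rule LIMSEQ_le_const2)
    show "(\<lambda>n. cmod (pairing \<phi> (s n) - pairing \<phi> (s N))) \<longlonglongrightarrow>
        cmod (lim (\<lambda>n. pairing \<phi> (s n)) - pairing \<phi> (s N))"
      by (intro tendsto_intros Xd_Cauchy_pairing_tendsto[OF assms(1-3) \<phi>(1)])
    show "\<exists>N'. \<forall>n\<ge>N'. cmod (pairing \<phi> (s n) - pairing \<phi> (s N)) \<le> C * e" using N[OF \<phi>] by blast
  qed
  then show ?thesis by blast
qed

text \<open>Equivalent Cauchy sequences differ by a sequence that tends to \<open>0\<close> in the \<open>X\<^sub>d\<close> norm, and pairing with a
  multiplier is continuous for that norm; so all representatives have the same limit.\<close>

lemma Xd_pairing_class:
  assumes "group G" "d \<ge> 1" and s: "s \<in> Xd_Cauchy d G" and \<phi>: "\<phi> \<in> Md d G"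
  shows "Xd_pairing \<phi> (Xd_rel d G `` {s}) = lim (\<lambda>n. pairing \<phi> (s n))"
proof -
  have mem: "s \<in> Xd_rel d G `` {s}" using s by (simp add: Xd_rel_def Xd_norm_zero[OF assms(1,2)])
  have eq: "lim (\<lambda>n. pairing \<phi> (s' n)) = lim (\<lambda>n. pairing \<phi> (s n))" if "s' \<in> Xd_rel d G `` {s}" for s'
  proof -
    have s': "s' \<in> Xd_Cauchy d G" and null: "(\<lambda>n. Xd_norm d G (\<lambda>t. s n t - s' n t)) \<longlonglongrightarrow> 0"
      using that by (auto simp: Xd_rel_def)
    have fs: "s n \<in> finsupp G" "s' n \<in> finsupp G" for n using s s' by (auto simp: Xd_Cauchy_def)
    define C where "C = 1 + Md_norm d G \<phi>"
    have C: "Md_norm d G \<phi> \<le> C" "C > 0" using Md_norm_nonneg[OF \<phi> assms(1,2)] by (auto simp: C_def)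
    have "(\<lambda>n. pairing \<phi> (s n) - pairing \<phi> (s' n)) \<longlonglongrightarrow> 0"
    proof (rule Lim_null_comparison)
      show "(\<lambda>n. C * Xd_norm d G (\<lambda>t. s n t - s' n t)) \<longlonglongrightarrow> 0" using tendsto_mult_right_zero[OF null] by simp
      have "norm (pairing \<phi> (s n) - pairing \<phi> (s' n)) \<le> C * Xd_norm d G (\<lambda>t. s n t - s' n t)" for n
        unfolding pairing_diff[OF fs, symmetric] by (intro pairing_le_Xd_norm assms \<phi> C finsupp_diff fs)
      then show "\<forall>\<^sub>F n in sequentially. norm (pairing \<phi> (s n) - pairing \<phi> (s' n)) \<le>
          C * Xd_norm d G (\<lambda>t. s n t - s' n t)" by simp
    qed
    moreover have "(\<lambda>n. pairing \<phi> (s n) - pairing \<phi> (s' n)) \<longlonglongrightarrow>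
        lim (\<lambda>n. pairing \<phi> (s n)) - lim (\<lambda>n. pairing \<phi> (s' n))"
      by (intro tendsto_diff Xd_Cauchy_pairing_tendsto[OF assms(1,2) _ \<phi>] s s')
    ultimately have "0 = lim (\<lambda>n. pairing \<phi> (s n)) - lim (\<lambda>n. pairing \<phi> (s' n))"
      by (rule LIMSEQ_unique)
    then show ?thesis by simp
  qed
  have "(\<lambda>s. lim (\<lambda>n. pairing \<phi> (s n))) ` (Xd_rel d G `` {s}) =
      (\<lambda>_. lim (\<lambda>n. pairing \<phi> (s n))) ` (Xd_rel d G `` {s})"
    by (rule image_cong[OF refl]) (rule eq)
  also have "\<dots> = {lim (\<lambda>n. pairing \<phi> (s n))}" by (rule image_constant[OF mem])
  finally have "(\<lambda>s. lim (\<lambda>n. pairing \<phi> (s n))) ` (Xd_rel d G `` {s}) = {lim (\<lambda>n. pairing \<phi> (s n))}" .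
  then show ?thesis by (simp add: Xd_pairing_def)
qed

definition Md_weak_subbasis :: "nat \<Rightarrow> ('a, 'x) monoid_scheme \<Rightarrow> ('a \<Rightarrow> complex) set set" where
  "Md_weak_subbasis d G = {{\<phi> \<in> Md d G. Xd_pairing \<phi> x \<in> U} | x U. x \<in> Xd d G \<and> open U}"

text \<open>Neighbourhoods of \<open>\<phi>\<^sub>0\<close> in the weak topology are described by finitely many Cauchy sequences in
  \<open>\<complex>[G]\<close>, which removes the completion and its quotient from all later arguments.\<close>

lemma generated_nhd_contains_basic_nhd:
  assumes "group G" "d \<ge> 1"
    and "generate_topology_on (Md_weak_subbasis d G) T"
    and "\<phi>\<^sub>0 \<in> T" and \<phi>\<^sub>0: "\<phi>\<^sub>0 \<in> Md d G"
  shows "\<exists>S e. finite S \<and> S \<subseteq> Xd_Cauchy d G \<and> e > 0 \<and> (\<forall>\<phi>\<in>Md d G.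
    (\<forall>s\<in>S. cmod (lim (\<lambda>n. pairing \<phi> (s n)) - lim (\<lambda>n. pairing \<phi>\<^sub>0 (s n))) < e) \<longrightarrow> \<phi> \<in> T)"
  using assms(3,4)
proof (induction rule: generate_topology_on.induct)
  case Empty
  then show ?case by simp
next
  case (Int a b)
  then obtain S e S' e' where
    S: "finite S" "S \<subseteq> Xd_Cauchy d G" "e > 0" "\<And>\<phi>. \<phi> \<in> Md d G \<Longrightarrow>
      (\<forall>s\<in>S. cmod (lim (\<lambda>n. pairing \<phi> (s n)) - lim (\<lambda>n. pairing \<phi>\<^sub>0 (s n))) < e) \<Longrightarrow> \<phi> \<in> a" and
    S': "finite S'" "S' \<subseteq> Xd_Cauchy d G" "e' > 0" "\<And>\<phi>. \<phi> \<in> Md d G \<Longrightarrow>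
      (\<forall>s\<in>S'. cmod (lim (\<lambda>n. pairing \<phi> (s n)) - lim (\<lambda>n. pairing \<phi>\<^sub>0 (s n))) < e') \<Longrightarrow> \<phi> \<in> b"
    by auto
  show ?case
    by (intro exI[of _ "S \<union> S'"] exI[of _ "min e e'"]) (use S S' in auto)
next
  case (UN K)
  then obtain k where k: "k \<in> K" "\<phi>\<^sub>0 \<in> k" by blast
  from UN.IH[OF this] show ?case using k(1) by (elim exE conjE) (intro exI conjI, assumption+, blast)
next
  case (Basis T)
  then obtain x U where T: "T = {\<phi> \<in> Md d G. Xd_pairing \<phi> x \<in> U}" and x: "x \<in> Xd d G" and U: "open U"
    unfolding Md_weak_subbasis_def by blast
  obtain s where s: "s \<in> Xd_Cauchy d G" "x = Xd_rel d G `` {s}" using x by (auto simp: Xd_def quotient_def)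
  note cl = Xd_pairing_class[OF assms(1,2) s(1), folded s(2)]
  obtain e where e: "e > 0" "\<And>z. dist z (Xd_pairing \<phi>\<^sub>0 x) < e \<Longrightarrow> z \<in> U"
    using U Basis.prems unfolding open_dist T by blast
  show ?case
    by (intro exI[of _ "{s}"] exI[of _ e]) (use s e cl \<phi>\<^sub>0 in \<open>auto simp: T dist_norm\<close>)
qed

lemma Md_weak_topology_eq: "Md_weak_topology d G = topology_generated_by (Md_weak_subbasis d G)"
  unfolding Md_weak_topology_def Md_weak_subbasis_def by (rule refl)

lemma Md_AP_iff_open_sets:
  "Md_AP d G \<longleftrightarrow> indicator (carrier G) \<in> \<Union>(Md_weak_subbasis d G) \<and>
    (\<forall>T. indicator (carrier G) \<in> T \<and> generate_topology_on (Md_weak_subbasis d G) T \<longrightarrow>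
      (\<exists>\<phi>\<in>finsupp G. \<phi> \<in> T))"
  unfolding Md_AP_def Md_weak_topology_eq in_closure_of topology_generated_by_topspace
    openin_topology_generated_by_iff Bex_def
  by (rule refl)

lemma Md_AP_iff:
  fixes G :: "('a, 'x) monoid_scheme"
  assumes "group G" "d \<ge> 1"
  shows "Md_AP d G \<longleftrightarrow> indicator (carrier G) \<in> Md d G \<and>
    (\<forall>S e. finite S \<longrightarrow> S \<subseteq> Xd_Cauchy d G \<longrightarrow> e > 0 \<longrightarrow> (\<exists>\<phi> \<in> finsupp G \<inter> Md d G. \<forall>s\<in>S.
       cmod (lim (\<lambda>n. pairing \<phi> (s n)) - lim (\<lambda>n. pairing (indicator (carrier G)) (s n))) < e))"
    (is "_ \<longleftrightarrow> ?one \<in> _ \<and> ?approx")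
proof -
  let ?\<B> = "Md_weak_subbasis d G"
  note AP = Md_AP_iff_open_sets[of d G]
  show ?thesis
  proof
    assume L: "Md_AP d G"
    have dense: "\<exists>\<phi>\<in>finsupp G. \<phi> \<in> T" if "?one \<in> T" "generate_topology_on ?\<B> T" for T
      using L that unfolding AP by blast
    have "?one \<in> \<Union>?\<B>" using L unfolding AP by (rule conjunct1)
    then have one: "?one \<in> Md d G" unfolding Md_weak_subbasis_def by blast
    have ?approx
    proof (intro allI impI)
      fix S and e :: real assume S: "finite S" "S \<subseteq> Xd_Cauchy d G" and e: "e > 0"
      show "\<exists>\<phi> \<in> finsupp G \<inter> Md d G. \<forall>s\<in>S. cmod (lim (\<lambda>n. pairing \<phi> (s n)) - lim (\<lambda>n. pairing ?one (s n))) < e"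
      proof (cases "S = {}")
        case True
        then show ?thesis
          using zero_in_Md(1)[OF assms] by (intro bexI[of _ "\<lambda>_. 0"]) (simp_all add: finsupp_def)
      next
        case False
        define T where "T s = {\<phi> \<in> Md d G. Xd_pairing \<phi> (Xd_rel d G `` {s}) \<in> ball (lim (\<lambda>n. pairing ?one (s n))) e}" for s
        have T_iff: "\<phi> \<in> T s \<longleftrightarrow> \<phi> \<in> Md d G \<and> cmod (lim (\<lambda>n. pairing \<phi> (s n)) - lim (\<lambda>n. pairing ?one (s n))) < e"
          if "s \<in> S" for \<phi> s
        proof -
          have "s \<in> Xd_Cauchy d G" using that S by blast
          note cl = Xd_pairing_class[OF assms this]
          show ?thesis
          proof (cases "\<phi> \<in> Md d G")
            case True
            then show ?thesis unfolding T_def mem_Collect_eq cl[OF True] mem_ball dist_norm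
              by (simp only: norm_minus_commute simp_thms)
          qed (simp add: T_def)
        qed
        have "generate_topology_on ?\<B> (T s)" if "s \<in> S" for s
        proof (rule generate_topology_on.Basis)
          have "Xd_rel d G `` {s} \<in> Xd d G" using that S by (auto simp: Xd_def quotient_def)
          then show "T s \<in> ?\<B>" unfolding T_def Md_weak_subbasis_def by blast
        qed
        then have "generate_topology_on ?\<B> (\<Inter>(T ` S))"
          using S False by (intro generate_topology_on_Inter) auto
        moreover have "?one \<in> \<Inter>(T ` S)" using T_iff one e by auto
        ultimately obtain \<phi> where "\<phi> \<in> finsupp G" "\<phi> \<in> \<Inter>(T ` S)" using dense by blast
        then show ?thesis using T_iff False by (intro bexI[of _ \<phi>]) auto
      qed
    qed
    with one show "?one \<in> Md d G \<and> ?approx" by (rule conjI)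
  next
    assume R: "?one \<in> Md d G \<and> ?approx"
    have "(\<lambda>_ _. 0) \<in> Xd_Cauchy d G"
      by (auto simp: Xd_Cauchy_def finsupp_def Xd_norm_zero[OF assms])
    then have "Xd_rel d G `` {\<lambda>_ _. 0} \<in> Xd d G" by (auto simp: Xd_def quotient_def)
    then have "{\<phi> \<in> Md d G. Xd_pairing \<phi> (Xd_rel d G `` {\<lambda>_ _. 0}) \<in> UNIV} \<in> ?\<B>"
      unfolding Md_weak_subbasis_def by blast
    then have top: "?one \<in> \<Union>?\<B>" by (rule UnionI) (use R in simp)
    have "\<exists>\<phi>\<in>finsupp G. \<phi> \<in> T" if T: "?one \<in> T \<and> generate_topology_on ?\<B> T" for T
    proof -
      obtain S e where S: "finite S" "S \<subseteq> Xd_Cauchy d G" "e > 0" and ST: "\<forall>\<phi>\<in>Md d G.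
          (\<forall>s\<in>S. cmod (lim (\<lambda>n. pairing \<phi> (s n)) - lim (\<lambda>n. pairing ?one (s n))) < e) \<longrightarrow> \<phi> \<in> T"
        using generated_nhd_contains_basic_nhd[OF assms T[THEN conjunct2] T[THEN conjunct1] R[THEN conjunct1]]
        by (elim exE conjE)
      obtain \<phi> where "\<phi> \<in> finsupp G \<inter> Md d G"
        and "\<forall>s\<in>S. cmod (lim (\<lambda>n. pairing \<phi> (s n)) - lim (\<lambda>n. pairing ?one (s n))) < e"
        using R[THEN conjunct2, THEN spec, THEN spec, THEN mp, THEN mp, THEN mp, OF S] by (elim bexE)
      then show ?thesis using ST by (intro bexI[of _ \<phi>]) simp_all
    qed
    with top show "Md_AP d G" unfolding AP by (intro conjI allI impI)
  qed
qed

section \<open>Extensions with amenable kernel\<close>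

text \<open>Summation along the fibres of \<open>q\<close>; the map whose adjoint is \<^term>\<open>pullback\<close>.\<close>

definition pushforward :: "('w \<Rightarrow> 'a) \<Rightarrow> ('w \<Rightarrow> complex) \<Rightarrow> 'a \<Rightarrow> complex" where
  "pushforward q g s = (\<Sum>w | g w \<noteq> 0 \<and> q w = s. g w)"

lemma pushforward_eq_sum:
  assumes "finite A" "{w. g w \<noteq> 0} \<subseteq> A"
  shows "pushforward q g s = (\<Sum>w | w \<in> A \<and> q w = s. g w)"
  unfolding pushforward_def by (rule sum.mono_neutral_left) (use assms in auto)

lemma pushforward_nonzero: "pushforward q g s \<noteq> 0 \<Longrightarrow> s \<in> q ` {w. g w \<noteq> 0}"
  unfolding pushforward_def by (rule ccontr) (auto intro!: sum.neutral)

lemma pushforward_finsupp: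
  assumes q: "q \<in> hom W G" and g: "g \<in> finsupp W" shows "pushforward q g \<in> finsupp G"
proof -
  have sub: "{s. pushforward q g s \<noteq> 0} \<subseteq> q ` {w. g w \<noteq> 0}" using pushforward_nonzero by fast
  have "q ` {w. g w \<noteq> 0} \<subseteq> carrier G" using q g by (auto simp: finsupp_def hom_def)
  moreover have "finite (q ` {w. g w \<noteq> 0})" using g by (simp add: finsupp_def)
  ultimately show ?thesis
    unfolding finsupp_def using finite_subset[OF sub] order_trans[OF sub] by simp
qed

lemma pushforward_diff:
  assumes g: "g \<in> finsupp W" "h \<in> finsupp W"
  shows "pushforward q (\<lambda>w. g w - h w) s = pushforward q g s - pushforward q h s"
proof -
  define A where "A = {w. g w \<noteq> 0} \<union> {w. h w \<noteq> 0}"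
  have A: "finite A" using g by (simp add: finsupp_def A_def)
  have "pushforward q (\<lambda>w. g w - h w) s = (\<Sum>w | w \<in> A \<and> q w = s. g w - h w)"
    "pushforward q g s = (\<Sum>w | w \<in> A \<and> q w = s. g w)"
    "pushforward q h s = (\<Sum>w | w \<in> A \<and> q w = s. h w)"
    by (rule pushforward_eq_sum[OF A]; force simp: A_def)+
  then show ?thesis by (simp add: sum_subtractf)
qed

lemma pairing_pushforward:
  assumes g: "g \<in> finsupp W"
  shows "pairing \<phi> (pushforward q g) = pairing (pullback W q \<phi>) g"
proof -
  define A where "A = {w. g w \<noteq> 0}"
  have A: "finite A" "A \<subseteq> carrier W" using g by (auto simp: A_def finsupp_def)
  have "pairing (pullback W q \<phi>) g = (\<Sum>w\<in>A. \<phi> (q w) * g w)"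
    unfolding pairing_def A_def[symmetric] using A(2) by (intro sum.cong) (auto simp: pullback_def)
  also have "\<dots> = (\<Sum>s\<in>q ` A. \<Sum>w | w \<in> A \<and> q w = s. \<phi> (q w) * g w)"
    by (rule sum.image_gen[OF A(1)])
  also have "\<dots> = (\<Sum>s\<in>q ` A. \<phi> s * pushforward q g s)"
    unfolding pushforward_def A_def sum_distrib_left by (intro sum.cong) auto
  also have "\<dots> = pairing \<phi> (pushforward q g)"
    by (rule pairing_eq_sum[symmetric]) (use A in \<open>auto simp: A_def dest: pushforward_nonzero\<close>)
  finally show ?thesis ..
qed

text \<open>Summation along the fibres contracts the \<open>X\<^sub>d\<close> norms because its adjoint contracts the \<open>M\<^sub>d\<close> norms.\<close>

lemma pushforward_Xd_Cauchy:
  assumes "group W" "group G" "d \<ge> 1" and q: "q \<in> hom W G" and s: "s \<in> Xd_Cauchy d W"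
  shows "(\<lambda>n. pushforward q (s n)) \<in> Xd_Cauchy d G"
proof -
  have fs: "s n \<in> finsupp W" for n using s by (simp add: Xd_Cauchy_def)
  have le: "Xd_norm d G (\<lambda>t. pushforward q (s m) t - pushforward q (s n) t) \<le> Xd_norm d W (\<lambda>t. s m t - s n t)" for m n
    unfolding pushforward_diff[OF fs fs, symmetric]
  proof (rule Xd_norm_le[OF assms(2,3)])
    fix \<phi> assume \<phi>: "\<phi> \<in> Md d G" "Md_norm d G \<phi> \<le> 1"
    note pb = Md_pullback[OF assms(1,2) q \<phi>(1)]
    have "cmod (pairing (pullback W q \<phi>) (\<lambda>t. s m t - s n t)) \<le> 1 * Xd_norm d W (\<lambda>t. s m t - s n t)"
      using pb \<phi>(2) by (intro pairing_le_Xd_norm assms(1,3) finsupp_diff fs) auto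
    then show "cmod (pairing \<phi> (pushforward q (\<lambda>t. s m t - s n t))) \<le> Xd_norm d W (\<lambda>t. s m t - s n t)"
      unfolding pairing_pushforward[OF finsupp_diff[OF fs fs]] by simp
  qed
  have "\<exists>N. \<forall>m\<ge>N. \<forall>n\<ge>N. Xd_norm d G (\<lambda>t. pushforward q (s m) t - pushforward q (s n) t) < e" if e: "e > 0" for e
  proof -
    obtain N where "\<forall>m\<ge>N. \<forall>n\<ge>N. Xd_norm d W (\<lambda>t. s m t - s n t) < e"
      using s e unfolding Xd_Cauchy_def by blast
    then show ?thesis using le by (intro exI[of _ N]) (meson le_less_trans)
  qed
  then show ?thesis using pushforward_finsupp[OF q fs] unfolding Xd_Cauchy_def by simp
qed

lemma sum_translate_product_le:
  fixes f :: "'g \<Rightarrow> real"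
  assumes "group W" and S: "finite S" "S \<subseteq> carrier W" and f: "\<And>x. x \<notin> S \<Longrightarrow> f x = 0"
    and f1: "(\<Sum>x\<in>S. (f x)\<^sup>2) = 1" and k: "k \<in> carrier W"
  shows "(\<Sum>x\<in>S. f x * f (k \<otimes>\<^bsub>W\<^esub> x)) \<le> 1"
proof -
  interpret group W by fact
  have "(\<Sum>x\<in>S. (f (k \<otimes>\<^bsub>W\<^esub> x))\<^sup>2) = (\<Sum>y\<in>(\<lambda>x. k \<otimes>\<^bsub>W\<^esub> x) ` S. (f y)\<^sup>2)"
    by (subst sum.reindex[OF inj_on_subset[OF inj_on_cmult[OF k] S(2)]]) simp
  also have "\<dots> = (\<Sum>y\<in>(\<lambda>x. k \<otimes>\<^bsub>W\<^esub> x) ` S \<inter> S. (f y)\<^sup>2)"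
    using S f by (intro sum.mono_neutral_right) auto
  also have "\<dots> \<le> (\<Sum>y\<in>S. (f y)\<^sup>2)" using S by (intro sum_mono2) auto
  finally have le: "(\<Sum>x\<in>S. (f (k \<otimes>\<^bsub>W\<^esub> x))\<^sup>2) \<le> 1" using f1 by simp
  have "(\<Sum>x\<in>S. f x * f (k \<otimes>\<^bsub>W\<^esub> x)) \<le> (\<Sum>x\<in>S. ((f x)\<^sup>2 + (f (k \<otimes>\<^bsub>W\<^esub> x))\<^sup>2) / 2)"
  proof (rule sum_mono)
    show "f x * f (k \<otimes>\<^bsub>W\<^esub> x) \<le> ((f x)\<^sup>2 + (f (k \<otimes>\<^bsub>W\<^esub> x))\<^sup>2) / 2" for x
      using sum_squares_bound[of "f x" "f (k \<otimes>\<^bsub>W\<^esub> x)"] by simp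
  qed
  also have "\<dots> = ((\<Sum>x\<in>S. (f x)\<^sup>2) + (\<Sum>x\<in>S. (f (k \<otimes>\<^bsub>W\<^esub> x))\<^sup>2)) / 2"
    by (simp add: sum_divide_distrib[symmetric] sum.distrib)
  finally show ?thesis using le f1 by simp
qed

text \<open>The function \<open>\<phi> \<circ> q\<close> is supported on finitely many cosets of the kernel. Let \<open>\<sigma>\<close> be a section of \<open>q\<close>, let
  \<open>f\<close> be an almost invariant vector on the kernel, and put
  \<open>F x = \<phi> (q x) * (\<Sum>n. f n * f (x \<sigma>(q x)\<^sup>-\<^sup>1 n))\<close>. This is the coefficient \<open>\<langle>\<lambda>(x) a, f\<rangle>\<close> with
  \<open>a = \<Sum>g. \<phi> g \<lambda>(\<sigma> g)\<^sup>-\<^sup>1 f\<close>: the vector \<open>\<lambda>(x) \<lambda>(\<sigma> g)\<^sup>-\<^sup>1 f\<close> is supported on the coset of \<open>x \<sigma>(g)\<^sup>-\<^sup>1\<close> and is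
  orthogonal to \<open>f\<close> unless \<open>g = q x\<close>. The summands of \<open>a\<close> are orthogonal, whence the bound on the norm
  of \<open>F\<close>, in which \<open>f\<close> no longer occurs.\<close>

lemma regular_approximation_of_pullback:
  fixes W :: "('w, 'z) monoid_scheme" and G :: "('a, 'x) monoid_scheme"
  assumes "group W" "group G" and d: "d \<ge> 1" and q: "q \<in> hom W G" and surj: "q ` carrier W = carrier G"
    and aiv: "almost_invariant_vectors (W\<lparr>carrier := kernel W G q\<rparr>)"
    and \<phi>: "\<phi> \<in> finsupp G" and E: "finite E" "E \<subseteq> carrier W" and \<delta>: "\<delta> > 0"
  shows "\<exists>F \<in> finsupp W \<inter> Md d W. Md_norm d W F \<le> sqrt (\<Sum>g | \<phi> g \<noteq> 0. (cmod (\<phi> g))\<^sup>2) \<and>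
    (\<forall>x\<in>E. cmod (F x - \<phi> (q x)) \<le> \<delta> * cmod (\<phi> (q x)))"
proof -
  interpret W: group W by fact
  interpret G: group G by fact
  interpret q: group_hom W G q using assms(1,2) q by (simp add: group_hom_def group_hom_axioms_def)
  define N where "N = kernel W G q"
  have N: "x \<in> N \<longleftrightarrow> x \<in> carrier W \<and> q x = \<one>\<^bsub>G\<^esub>" for x by (auto simp: N_def kernel_def)
  define \<sigma> where "\<sigma> g = (SOME w. w \<in> carrier W \<and> q w = g)" for g
  have \<sigma>: "\<sigma> g \<in> carrier W" "q (\<sigma> g) = g" if "g \<in> carrier G" for g
  proof -
    have "\<exists>w. w \<in> carrier W \<and> q w = g" using that unfolding surj[symmetric] by auto
    from someI_ex[OF this] show "\<sigma> g \<in> carrier W" "q (\<sigma> g) = g" unfolding \<sigma>_def by blast+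
  qed
  define K where "K = (\<lambda>x. x \<otimes>\<^bsub>W\<^esub> inv\<^bsub>W\<^esub> (\<sigma> (q x))) ` E"
  have K: "finite K" "K \<subseteq> carrier (W\<lparr>carrier := kernel W G q\<rparr>)"
    using E \<sigma> by (auto simp: K_def N_def[symmetric] N)
  obtain S f where S: "finite S" "S \<subseteq> carrier (W\<lparr>carrier := kernel W G q\<rparr>)"
    and fS: "\<And>x. x \<notin> S \<Longrightarrow> f x = (0 :: real)" and f1: "(\<Sum>x\<in>S. (f x)\<^sup>2) = 1"
    and fk': "\<And>k. k \<in> K \<Longrightarrow> 1 - \<delta> \<le> (\<Sum>x\<in>S. f x * f (k \<otimes>\<^bsub>W\<lparr>carrier := kernel W G q\<rparr>\<^esub> x))"
    using almost_invariant_vectorsE[OF aiv K \<delta>] by blast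
  have fk: "1 - \<delta> \<le> (\<Sum>x\<in>S. f x * f (k \<otimes>\<^bsub>W\<^esub> x))" if "k \<in> K" for k using fk'[OF that] by simp
  have S: "finite S" "S \<subseteq> N" using S by (simp_all add: N_def)
  have SW: "S \<subseteq> carrier W" using S N by auto
  define P where "P = {g. \<phi> g \<noteq> 0}"
  have P: "finite P" "P \<subseteq> carrier G" using \<phi> by (auto simp: P_def finsupp_def)
  \<comment> \<open>\<open>\<tau>\<close> parametrises the support of \<open>a\<close>; its inverse is \<open>y \<mapsto> (q(y)\<^sup>-\<^sup>1, \<sigma>(q(y)\<^sup>-\<^sup>1) y)\<close>, from which the
    formula for \<open>a\<close> below is taken.\<close>
  define \<tau> where "\<tau> = (\<lambda>(g, n). inv\<^bsub>W\<^esub> (\<sigma> g) \<otimes>\<^bsub>W\<^esub> n)"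
  define Y where "Y = \<tau> ` (P \<times> S)"
  have \<tau>: "\<tau> (g, n) \<in> carrier W" "inv\<^bsub>G\<^esub> (q (\<tau> (g, n))) = g" "\<sigma> g \<otimes>\<^bsub>W\<^esub> \<tau> (g, n) = n"
    if "g \<in> P" "n \<in> S" for g n
  proof -
    have gn: "g \<in> carrier G" "n \<in> carrier W" "q n = \<one>\<^bsub>G\<^esub>" using that P S N by auto
    then show "\<tau> (g, n) \<in> carrier W" "inv\<^bsub>G\<^esub> (q (\<tau> (g, n))) = g" "\<sigma> g \<otimes>\<^bsub>W\<^esub> \<tau> (g, n) = n"
      using \<sigma>[of g] by (auto simp: \<tau>_def W.m_assoc[symmetric])
  qed
  have inj: "inj_on \<tau> (P \<times> S)"
  proof (rule inj_onI)
    fix x y assume xy: "x \<in> P \<times> S" "y \<in> P \<times> S" "\<tau> x = \<tau> y"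
    obtain g n h m where gn: "x = (g, n)" "y = (h, m)" by fastforce
    have P: "g \<in> P" "n \<in> S" "h \<in> P" "m \<in> S" and eq: "\<tau> (g, n) = \<tau> (h, m)" using xy gn by auto
    have gh: "g = h" using \<tau>(2)[OF P(1,2)] \<tau>(2)[OF P(3,4)] unfolding eq by (rule trans[OF sym])
    have "n = \<sigma> g \<otimes>\<^bsub>W\<^esub> \<tau> (g, n)" by (rule \<tau>(3)[OF P(1,2), symmetric])
    also have "\<dots> = \<sigma> h \<otimes>\<^bsub>W\<^esub> \<tau> (h, m)" by (rule arg_cong2[OF arg_cong[OF gh] eq])
    also have "\<dots> = m" by (rule \<tau>(3)[OF P(3,4)])
    finally have "n = m" .
    then show "x = y" using gh gn by simp
  qed
  have Y: "finite Y" "Y \<subseteq> carrier W" using P S \<tau>(1) by (auto simp: Y_def)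
  define a where "a y = (if y \<in> carrier W
      then \<phi> (inv\<^bsub>G\<^esub> (q y)) * complex_of_real (f (\<sigma> (inv\<^bsub>G\<^esub> (q y)) \<otimes>\<^bsub>W\<^esub> y)) else 0)" for y
  define b where "b y = complex_of_real (f y)" for y
  have a\<tau>: "a (\<tau> (g, n)) = \<phi> g * complex_of_real (f n)" if "g \<in> P" "n \<in> S" for g n
    using \<tau>[OF that] by (simp add: a_def)
  have aY: "a y = 0" if y: "y \<notin> Y" for y
  proof (rule ccontr)
    assume "a y \<noteq> 0"
    define g where "g = inv\<^bsub>G\<^esub> (q y)"
    have yW: "y \<in> carrier W" and g: "g \<in> P" and n: "\<sigma> g \<otimes>\<^bsub>W\<^esub> y \<in> S"
      using \<open>a y \<noteq> 0\<close> fS by (auto simp: a_def g_def P_def split: if_splits)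
    have "g \<in> carrier G" using g P by auto
    then have "y = \<tau> (g, \<sigma> g \<otimes>\<^bsub>W\<^esub> y)" using yW \<sigma>[of g] by (simp add: \<tau>_def W.m_assoc[symmetric])
    then show False using y g n unfolding Y_def by blast
  qed
  have sum_Y: "(\<Sum>y\<in>Y. h y) = (\<Sum>g\<in>P. \<Sum>n\<in>S. h (\<tau> (g, n)))" for h :: "'w \<Rightarrow> 'b :: comm_monoid_add"
    unfolding Y_def sum.reindex[OF inj] by (simp add: sum.cartesian_product)
  have "(\<Sum>y\<in>Y. (cmod (a y))\<^sup>2) = (\<Sum>g\<in>P. \<Sum>n\<in>S. (cmod (\<phi> g))\<^sup>2 * (f n)\<^sup>2)"
    unfolding sum_Y by (intro sum.cong refl) (simp add: a\<tau> norm_mult power_mult_distrib)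
  also have "\<dots> = (\<Sum>g\<in>P. (cmod (\<phi> g))\<^sup>2)" by (simp add: sum_distrib_left[symmetric] f1)
  finally have a_norm: "l2_norm a = sqrt (\<Sum>g\<in>P. (cmod (\<phi> g))\<^sup>2)"
    using l2_norm_finite[OF Y(1) aY] by simp
  have b_norm: "l2_norm b = 1" using l2_norm_finite[OF S(1), of b] fS f1 by (simp add: b_def)
  have a_sq: "sq_summable a"
    by (rule sq_summable_finite, rule finite_subset[OF _ Y(1)]) (use aY in blast)
  have b_sq: "sq_summable b"
    by (rule sq_summable_finite, rule finite_subset[OF _ S(1)]) (use fS in \<open>auto simp: b_def\<close>)
  define F where "F = regular_coefficient W a b"
  have F_Md: "F \<in> Md d W" "Md_norm d W F \<le> sqrt (\<Sum>g\<in>P. (cmod (\<phi> g))\<^sup>2)"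
    using regular_coefficient_Md[OF \<open>group W\<close> d a_sq b_sq] by (simp_all add: F_def a_norm b_norm)
  have coefficient: "F x = (\<Sum>y\<in>Y. a y * cnj (b (x \<otimes>\<^bsub>W\<^esub> y)))" if x: "x \<in> carrier W" for x
    unfolding F_def by (rule regular_coefficient_finite[OF \<open>group W\<close> Y _ x]) (rule aY)
  have F_eq: "F x = (\<Sum>g\<in>P. \<Sum>n\<in>S. \<phi> g * complex_of_real (f n * f (x \<otimes>\<^bsub>W\<^esub> \<tau> (g, n))))"
    if x: "x \<in> carrier W" for x
    unfolding coefficient[OF x] sum_Y
    by (intro sum.cong refl) (simp add: a\<tau> b_def)
  have F_val: "F x = \<phi> (q x) * complex_of_real (\<Sum>n\<in>S. f n * f (x \<otimes>\<^bsub>W\<^esub> inv\<^bsub>W\<^esub> (\<sigma> (q x)) \<otimes>\<^bsub>W\<^esub> n))"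
    if x: "x \<in> carrier W" for x
  proof -
    define h where "h g = (\<Sum>n\<in>S. \<phi> g * complex_of_real (f n * f (x \<otimes>\<^bsub>W\<^esub> \<tau> (g, n))))" for g
    have h0: "h g = 0" if "g \<in> P" "g \<noteq> q x" for g
      unfolding h_def
    proof (rule sum.neutral, rule ballI)
      fix n assume n: "n \<in> S"
      have gn: "g \<in> carrier G" "n \<in> carrier W" "q n = \<one>\<^bsub>G\<^esub>" using that n P S N by auto
      have "q (x \<otimes>\<^bsub>W\<^esub> \<tau> (g, n)) = q x \<otimes>\<^bsub>G\<^esub> inv\<^bsub>G\<^esub> g" using gn x \<sigma>[of g] by (simp add: \<tau>_def)
      moreover have "q x \<otimes>\<^bsub>G\<^esub> inv\<^bsub>G\<^esub> g \<noteq> \<one>\<^bsub>G\<^esub>"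
        using that(2) x gn(1) G.inv_equality[of "q x" "inv\<^bsub>G\<^esub> g"] by auto
      ultimately have "x \<otimes>\<^bsub>W\<^esub> \<tau> (g, n) \<notin> S" using S N by auto
      then show "\<phi> g * complex_of_real (f n * f (x \<otimes>\<^bsub>W\<^esub> \<tau> (g, n))) = 0" by (simp add: fS)
    qed
    have "F x = (\<Sum>g\<in>P. if g = q x then h (q x) else 0)"
      unfolding F_eq[OF x] h_def[symmetric] using h0 by (intro sum.cong) auto
    also have "\<dots> = (if q x \<in> P then h (q x) else 0)" using P(1) by simp
    also have "\<dots> = h (q x)" by (simp add: h_def P_def)
    also have "\<dots> = \<phi> (q x) * complex_of_real (\<Sum>n\<in>S. f n * f (x \<otimes>\<^bsub>W\<^esub> inv\<^bsub>W\<^esub> (\<sigma> (q x)) \<otimes>\<^bsub>W\<^esub> n))"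
    proof -
      have "x \<otimes>\<^bsub>W\<^esub> \<tau> (q x, n) = x \<otimes>\<^bsub>W\<^esub> inv\<^bsub>W\<^esub> (\<sigma> (q x)) \<otimes>\<^bsub>W\<^esub> n" if "n \<in> S" for n
        using that x SW \<sigma>[of "q x"] by (auto simp: \<tau>_def W.m_assoc)
      then show ?thesis by (simp add: h_def sum_distrib_left cong: sum.cong)
    qed
    finally show ?thesis .
  qed
  have "F \<in> finsupp W"
  proof -
    have "x \<in> (\<lambda>(z, y). z \<otimes>\<^bsub>W\<^esub> inv\<^bsub>W\<^esub> y) ` (S \<times> Y)" if F: "F x \<noteq> 0" for x
    proof -
      have x: "x \<in> carrier W" using F by (auto simp: F_def regular_coefficient_def split: if_splits)
      obtain y where y: "y \<in> Y" "a y * cnj (b (x \<otimes>\<^bsub>W\<^esub> y)) \<noteq> 0"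
        using F unfolding coefficient[OF x]
        by (elim sum.not_neutral_contains_not_neutral)
      then have "x \<otimes>\<^bsub>W\<^esub> y \<in> S" using fS by (auto simp: b_def)
      moreover have "x = x \<otimes>\<^bsub>W\<^esub> y \<otimes>\<^bsub>W\<^esub> inv\<^bsub>W\<^esub> y" using x y Y by (auto simp: W.m_assoc)
      ultimately show ?thesis using y(1) by (intro image_eqI[of _ _ "(x \<otimes>\<^bsub>W\<^esub> y, y)"]) auto
    qed
    then have sub: "{x. F x \<noteq> 0} \<subseteq> (\<lambda>(z, y). z \<otimes>\<^bsub>W\<^esub> inv\<^bsub>W\<^esub> y) ` (S \<times> Y)" by blast
    have "(\<lambda>(z, y). z \<otimes>\<^bsub>W\<^esub> inv\<^bsub>W\<^esub> y) ` (S \<times> Y) \<subseteq> carrier W" using SW Y by auto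
    moreover have "finite ((\<lambda>(z, y). z \<otimes>\<^bsub>W\<^esub> inv\<^bsub>W\<^esub> y) ` (S \<times> Y))" using S Y by simp
    ultimately show ?thesis
      unfolding finsupp_def using finite_subset[OF sub] order_trans[OF sub] by simp
  qed
  moreover have "cmod (F x - \<phi> (q x)) \<le> \<delta> * cmod (\<phi> (q x))" if x: "x \<in> E" for x
  proof -
    have xW: "x \<in> carrier W" using x E by auto
    define k where "k = x \<otimes>\<^bsub>W\<^esub> inv\<^bsub>W\<^esub> (\<sigma> (q x))"
    define r where "r = (\<Sum>n\<in>S. f n * f (k \<otimes>\<^bsub>W\<^esub> n))"
    have k: "k \<in> K" "k \<in> carrier W"
      unfolding k_def K_def by (rule imageI[OF x]) (simp add: xW \<sigma>(1))
    have "1 - \<delta> \<le> r" "r \<le> 1"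
      unfolding r_def using fk[OF k(1)] sum_translate_product_le[OF \<open>group W\<close> S(1) SW fS f1 k(2)] by auto
    then have r: "\<bar>r - 1\<bar> \<le> \<delta>" by simp
    have "F x - \<phi> (q x) = \<phi> (q x) * complex_of_real (r - 1)"
      unfolding F_val[OF xW] r_def k_def by (simp add: algebra_simps)
    then have "cmod (F x - \<phi> (q x)) = cmod (\<phi> (q x)) * \<bar>r - 1\<bar>" by (simp only: norm_mult norm_of_real)
    also have "\<dots> \<le> cmod (\<phi> (q x)) * \<delta>" using r by (intro mult_left_mono) auto
    finally show ?thesis by (simp add: mult.commute)
  qed
  ultimately show ?thesis using F_Md by (intro bexI[of _ F]) (auto simp: P_def)
qed

lemma cmod_pairing_diff_le:
  assumes "finite {t. g t \<noteq> 0}" and "\<And>t. g t \<noteq> 0 \<Longrightarrow> cmod (\<phi> t - \<psi> t) \<le> r"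
  shows "cmod (pairing \<phi> g - pairing \<psi> g) \<le> r * (\<Sum>t | g t \<noteq> 0. cmod (g t))"
proof -
  have "pairing \<phi> g - pairing \<psi> g = (\<Sum>t | g t \<noteq> 0. (\<phi> t - \<psi> t) * g t)"
    by (simp add: pairing_def sum_subtractf left_diff_distrib)
  also have "cmod \<dots> \<le> (\<Sum>t | g t \<noteq> 0. cmod (\<phi> t - \<psi> t) * cmod (g t))"
    by (rule order_trans[OF norm_sum]) (simp add: norm_mult)
  also have "\<dots> \<le> (\<Sum>t | g t \<noteq> 0. r * cmod (g t))"
    using assms(2) by (intro sum_mono mult_right_mono) auto
  finally show ?thesis by (simp add: sum_distrib_left)
qed

text \<open>If \<open>\<phi>\<close> in \<open>\<complex>[G]\<close> is close to \<open>1\<close>, then \<open>\<psi> = \<phi> \<circ> q\<close> is close to \<open>1\<close>, because pairing \<open>\<psi>\<close> with elements of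
  \<open>X\<^sub>d(W)\<close> is pairing \<open>\<phi>\<close> with their images under summation along the fibres. The norms of \<open>\<psi>\<close> and of
  its regular approximations \<open>F\<close> are at most a constant \<open>C\<close> that is known before \<open>F\<close> is chosen.
  Hence the Cauchy sequences can be truncated first, at a cost controlled by \<open>C\<close>, and \<open>F\<close> only needs to
  be close to \<open>\<psi>\<close> on the finite union of the supports of the truncations.\<close>

theorem Md_AP_extension:
  fixes W :: "('w, 'z) monoid_scheme" and G :: "('a, 'x) monoid_scheme"
  assumes "group W" "group G" and d: "d \<ge> 1" and q: "q \<in> hom W G" and surj: "q ` carrier W = carrier G"
    and aiv: "almost_invariant_vectors (W\<lparr>carrier := kernel W G q\<rparr>)" and AP: "Md_AP d G"
  shows "Md_AP d W"
  unfolding Md_AP_iff[OF \<open>group W\<close> d]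
proof (intro conjI allI impI)
  let ?oneG = "indicator (carrier G) :: 'a \<Rightarrow> complex" and ?oneW = "indicator (carrier W) :: 'w \<Rightarrow> complex"
  note AP = AP[unfolded Md_AP_iff[OF \<open>group G\<close> d]]
  have qc: "q w \<in> carrier G" if "w \<in> carrier W" for w using that surj by blast
  have one: "?oneW = pullback W q ?oneG" by (auto simp: pullback_def indicator_def fun_eq_iff qc)
  show "?oneW \<in> Md d W" unfolding one by (rule Md_pullback(1)[OF assms(1,2) q AP[THEN conjunct1]])
  fix S and e :: real assume S: "finite S" "S \<subseteq> Xd_Cauchy d W" and e: "e > 0"
  have fs: "s n \<in> finsupp W" if "s \<in> S" for s n using that S by (auto simp: Xd_Cauchy_def)
  have push: "(\<lambda>n. pairing \<phi> (pushforward q (s n))) = (\<lambda>n. pairing (pullback W q \<phi>) (s n))"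
    if "s \<in> S" for \<phi> s
    by (rule ext) (rule pairing_pushforward[OF fs[OF that]])
  define S' where "S' = (\<lambda>s n. pushforward q (s n)) ` S"
  have S': "finite S'" "S' \<subseteq> Xd_Cauchy d G"
    using S pushforward_Xd_Cauchy[OF assms(1,2) d q] by (auto simp: S'_def)
  have e2: "e / 2 > 0" using e by simp
  obtain \<phi> where \<phi>: "\<phi> \<in> finsupp G \<inter> Md d G"
    and near': "\<forall>s\<in>S'. cmod (lim (\<lambda>n. pairing \<phi> (s n)) - lim (\<lambda>n. pairing ?oneG (s n))) < e / 2"
    using AP[THEN conjunct2, THEN spec, THEN spec, THEN mp, THEN mp, THEN mp, OF S' e2] by (elim bexE)
  define \<psi> where "\<psi> = pullback W q \<phi>"
  have near: "cmod (lim (\<lambda>n. pairing \<psi> (s n)) - lim (\<lambda>n. pairing ?oneW (s n))) < e / 2" if "s \<in> S" for s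
  proof -
    have "(\<lambda>n. pushforward q (s n)) \<in> S'" using that by (simp add: S'_def)
    from bspec[OF near' this] show ?thesis unfolding push[OF that] \<psi>_def one .
  qed
  have \<phi>_fs: "\<phi> \<in> finsupp G" and \<phi>_Md: "\<phi> \<in> Md d G" using \<phi> by auto
  note \<psi> = Md_pullback[OF assms(1,2) q \<phi>_Md, folded \<psi>_def]
  define L where "L = sqrt (\<Sum>g | \<phi> g \<noteq> 0. (cmod (\<phi> g))\<^sup>2)"
  \<comment> \<open>\<open>C\<close> bounds the norms of \<open>\<psi>\<close> and of every regular approximation of it, and the values of \<open>\<phi>\<close>.\<close>
  define C where "C = 1 + Md_norm d G \<phi> + L"
  have "0 \<le> L" by (simp add: L_def sum_nonneg)
  then have C: "C > 0" "Md_norm d G \<phi> \<le> C" "L \<le> C"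
    using Md_norm_nonneg[OF \<phi>_Md \<open>group G\<close> d] by (auto simp: C_def)
  define \<eta> where "\<eta> = e / (8 * C)"
  have \<eta>: "\<eta> > 0" "C * \<eta> = e / 8" using e C by (auto simp: \<eta>_def)
  have "\<forall>s\<in>S. \<exists>N. \<forall>\<phi> C. \<phi> \<in> Md d W \<longrightarrow> Md_norm d W \<phi> \<le> C \<longrightarrow> C > 0 \<longrightarrow>
      cmod (lim (\<lambda>n. pairing \<phi> (s n)) - pairing \<phi> (s N)) \<le> C * \<eta>"
    using Xd_Cauchy_pairing_tail[OF \<open>group W\<close> d _ \<eta>(1)] S(2) by (intro ballI) (simp add: subset_iff)
  from bchoice[OF this] obtain N where N: "\<forall>s\<in>S. \<forall>\<phi> C. \<phi> \<in> Md d W \<longrightarrow> Md_norm d W \<phi> \<le> C \<longrightarrow> C > 0 \<longrightarrow>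
      cmod (lim (\<lambda>n. pairing \<phi> (s n)) - pairing \<phi> (s (N s))) \<le> C * \<eta>" ..
  have tail: "cmod (lim (\<lambda>n. pairing \<theta> (s n)) - pairing \<theta> (s (N s))) \<le> e / 8"
    if "s \<in> S" "\<theta> \<in> Md d W" "Md_norm d W \<theta> \<le> C" for s \<theta>
    using N that C(1) unfolding \<eta>(2)[symmetric] by blast
  define E where "E = (\<Union>s\<in>S. {t. s (N s) t \<noteq> 0})"
  have E: "finite E" "E \<subseteq> carrier W" using S fs by (auto simp: E_def finsupp_def)
  define M where "M = 1 + (\<Sum>s\<in>S. \<Sum>t | s (N s) t \<noteq> 0. cmod (s (N s) t))"
  have M_le: "(\<Sum>t | s (N s) t \<noteq> 0. cmod (s (N s) t)) \<le> M" if "s \<in> S" for s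
    using member_le_sum[OF that, of "\<lambda>s. \<Sum>t | s (N s) t \<noteq> 0. cmod (s (N s) t)"] S(1)
    by (simp add: M_def sum_nonneg)
  have M: "M > 0" unfolding M_def by (intro add_pos_nonneg sum_nonneg) simp_all
  define \<delta> where "\<delta> = e / (8 * C * M)"
  have \<delta>: "\<delta> > 0" "\<delta> * C * M = e / 8" using e C M by (auto simp: \<delta>_def)
  obtain F where F: "F \<in> finsupp W \<inter> Md d W" and F_norm: "Md_norm d W F \<le> L"
    and F_near: "\<forall>x\<in>E. cmod (F x - \<phi> (q x)) \<le> \<delta> * cmod (\<phi> (q x))"
    using regular_approximation_of_pullback[OF assms(1,2) d q surj aiv \<phi>_fs E \<delta>(1)]
    unfolding L_def by (elim bexE conjE)
  have F_\<psi>: "cmod (F x - \<psi> x) \<le> \<delta> * C" if "x \<in> E" for x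
  proof -
    have x: "x \<in> carrier W" using that E by blast
    have "cmod (F x - \<psi> x) \<le> \<delta> * cmod (\<phi> (q x))" using F_near that x by (simp add: \<psi>_def pullback_def)
    also have "\<dots> \<le> \<delta> * C"
      using cmod_le_Md_norm[OF \<phi>_Md \<open>group G\<close> d qc[OF x]] C(2) \<delta>(1) by (intro mult_left_mono) auto
    finally show ?thesis .
  qed
  have "cmod (lim (\<lambda>n. pairing F (s n)) - lim (\<lambda>n. pairing ?oneW (s n))) < e" if s: "s \<in> S" for s
  proof -
    have 1: "cmod (lim (\<lambda>n. pairing F (s n)) - pairing F (s (N s))) \<le> e / 8"
      using F F_norm C(3) by (intro tail[OF s]) auto
    have 2: "cmod (lim (\<lambda>n. pairing \<psi> (s n)) - pairing \<psi> (s (N s))) \<le> e / 8"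
      using \<psi> C(2) by (intro tail[OF s]) auto
    have "cmod (pairing F (s (N s)) - pairing \<psi> (s (N s))) \<le> \<delta> * C * (\<Sum>t | s (N s) t \<noteq> 0. cmod (s (N s) t))"
      using fs[OF s, of "N s"] s by (intro cmod_pairing_diff_le F_\<psi>) (auto simp: finsupp_def E_def)
    also have "\<dots> \<le> \<delta> * C * M" using M_le[OF s] \<delta>(1) C(1) by (intro mult_left_mono) auto
    finally have 3: "cmod (pairing F (s (N s)) - pairing \<psi> (s (N s))) \<le> e / 8" unfolding \<delta>(2) .
    define a1 a2 b1 b2 c where "a1 = lim (\<lambda>n. pairing F (s n))" and "a2 = pairing F (s (N s))"
      and "b1 = lim (\<lambda>n. pairing \<psi> (s n))" and "b2 = pairing \<psi> (s (N s))" and "c = lim (\<lambda>n. pairing ?oneW (s n))"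
    have "a1 - c = (a1 - a2) + (a2 - b2) + (b2 - b1) + (b1 - c)" by simp
    also have "cmod \<dots> \<le> cmod (a1 - a2) + cmod (a2 - b2) + cmod (b2 - b1) + cmod (b1 - c)"
      by (intro norm_triangle_le add_right_mono order_refl norm_triangle_ineq)
    also have "\<dots> < e / 8 + e / 8 + e / 8 + e / 2"
      using 1 2 3 near[OF s] unfolding a1_def a2_def b1_def b2_def c_def
      by (intro add_le_less_mono add_mono) (simp_all add: norm_minus_commute)
    also have "\<dots> \<le> e" using e by simp
    finally show ?thesis by (simp add: a1_def c_def)
  qed
  then show "\<exists>\<phi>\<in>finsupp W \<inter> Md d W. \<forall>s\<in>S. cmod (lim (\<lambda>n. pairing \<phi> (s n)) - lim (\<lambda>n. pairing ?oneW (s n))) < e"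
    by (intro bexI[OF _ F] ballI)
qed

section \<open>Wreath products\<close>

lemma almost_invariant_vectors_iso:
  fixes N :: "('n, 'x) monoid_scheme" and M :: "('m, 'y) monoid_scheme"
  assumes "group N" and iso: "\<iota> \<in> iso N M" and aiv: "almost_invariant_vectors N"
  shows "almost_invariant_vectors M"
  unfolding almost_invariant_vectors_def
proof (intro allI impI)
  interpret N: group N by fact
  have bij: "bij_betw \<iota> (carrier N) (carrier M)" and hom: "\<iota> \<in> hom N M" using iso by (auto simp: iso_def)
  define j where "j = inv_into (carrier N) \<iota>"
  have j: "j y \<in> carrier N" "\<iota> (j y) = y" if "y \<in> carrier M" for y
    using that bij unfolding j_def bij_betw_def by (auto intro: inv_into_into f_inv_into_f)
  have j\<iota>: "j (\<iota> x) = x" if "x \<in> carrier N" for x using that bij unfolding j_def bij_betw_def by simp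
  have \<iota>: "\<iota> x \<in> carrier M" if "x \<in> carrier N" for x using that hom by (auto simp: hom_def)
  fix E and \<epsilon> :: real assume E: "finite E" "E \<subseteq> carrier M" and \<epsilon>: "\<epsilon> > 0"
  have jE: "finite (j ` E)" "j ` E \<subseteq> carrier N" using E j by auto
  obtain S f where S: "finite S" "S \<subseteq> carrier N" and fS: "\<And>x. x \<notin> S \<Longrightarrow> f x = (0 :: real)"
    and f1: "(\<Sum>x\<in>S. (f x)\<^sup>2) = 1" and fk: "\<And>k. k \<in> j ` E \<Longrightarrow> 1 - \<epsilon> \<le> (\<Sum>x\<in>S. f x * f (k \<otimes>\<^bsub>N\<^esub> x))"
    using almost_invariant_vectorsE[OF aiv jE \<epsilon>] by blast
  define F where "F y = (if y \<in> carrier M then f (j y) else 0)" for y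
  have F\<iota>: "F (\<iota> x) = f x" if "x \<in> carrier N" for x using that \<iota> j\<iota> by (simp add: F_def)
  have inj: "inj_on \<iota> S" using bij S(2) unfolding bij_betw_def by (blast intro: inj_on_subset)
  have sum_S: "(\<Sum>y\<in>\<iota> ` S. h y) = (\<Sum>x\<in>S. h (\<iota> x))" for h :: "'m \<Rightarrow> real"
    by (simp add: sum.reindex[OF inj])
  have "1 - \<epsilon> \<le> (\<Sum>y\<in>\<iota> ` S. F y * F (k \<otimes>\<^bsub>M\<^esub> y))" if k: "k \<in> E" for k
  proof -
    have kM: "k \<in> carrier M" using k E by blast
    have "F (\<iota> x) * F (k \<otimes>\<^bsub>M\<^esub> \<iota> x) = f x * f (j k \<otimes>\<^bsub>N\<^esub> x)" if "x \<in> S" for x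
    proof -
      have x: "x \<in> carrier N" using that S by blast
      have "k \<otimes>\<^bsub>M\<^esub> \<iota> x = \<iota> (j k \<otimes>\<^bsub>N\<^esub> x)" using hom_mult[OF hom j(1)[OF kM] x] j(2)[OF kM] by simp
      then show ?thesis using F\<iota>[OF x] F\<iota>[OF N.m_closed[OF j(1)[OF kM] x]] by simp
    qed
    then show ?thesis unfolding sum_S using fk[OF imageI[OF k]] by simp
  qed
  moreover have "(\<Sum>y\<in>\<iota> ` S. (F y)\<^sup>2) = 1"
  proof -
    have "F (\<iota> x) = f x" if "x \<in> S" for x using that S F\<iota> by blast
    then show ?thesis unfolding sum_S f1[symmetric] by simp
  qed
  moreover have "F y = 0" if y: "y \<notin> \<iota> ` S" for y
  proof (cases "y \<in> carrier M")
    case True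
    then have "j y \<notin> S" using y j(2)[OF True] by (metis imageI)
    then show ?thesis using fS by (simp add: F_def)
  qed (simp add: F_def)
  moreover have "finite (\<iota> ` S)" "\<iota> ` S \<subseteq> carrier M" using S \<iota> by auto
  ultimately show "\<exists>S F. finite S \<and> S \<subseteq> carrier M \<and> (\<forall>x. x \<notin> S \<longrightarrow> F x = (0 :: real)) \<and>
        (\<Sum>x\<in>S. (F x)\<^sup>2) = 1 \<and> (\<forall>k\<in>E. 1 - \<epsilon> \<le> (\<Sum>x\<in>S. F x * F (k \<otimes>\<^bsub>M\<^esub> x)))"
    by (intro exI[of _ "\<iota> ` S"] exI[of _ F]) simp
qed

lemma shift_one:
  assumes "group G" "m \<in> extensional (carrier G)" shows "shift G \<one>\<^bsub>G\<^esub> m = m"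
proof -
  interpret group G by fact
  show ?thesis using assms(2) by (auto simp: shift_def fun_eq_iff extensional_def)
qed

text \<open>The wreath product is an extension of \<open>G\<close> by the direct sum of copies of \<open>\<Gamma>\<close>.\<close>

lemma wreath_product_projection:
  assumes "group \<Gamma>" and "group G"
  shows "fst \<in> hom (wreath_product \<Gamma> G) G" "fst ` carrier (wreath_product \<Gamma> G) = carrier G"
    and "Pair \<one>\<^bsub>G\<^esub> \<in> iso (sum_group (carrier G) (\<lambda>_. \<Gamma>))
      ((wreath_product \<Gamma> G)\<lparr>carrier := kernel (wreath_product \<Gamma> G) G fst\<rparr>)"
proof -
  interpret G: group G by fact
  let ?N = "sum_group (carrier G) (\<lambda>_. \<Gamma>)"
  interpret N: group ?N by (rule sum_group) (rule assms(1))
  have carr: "carrier (wreath_product \<Gamma> G) = carrier G \<times> carrier ?N"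
    by (simp add: wreath_product_def semidirect_product_def del: carrier_sum_group)
  have mult: "x \<otimes>\<^bsub>wreath_product \<Gamma> G\<^esub> y = (fst x \<otimes>\<^bsub>G\<^esub> fst y, snd x \<otimes>\<^bsub>?N\<^esub> shift G (fst x) (snd y))" for x y
    by (cases x; cases y) (simp add: wreath_product_def semidirect_product_def)
  show "fst \<in> hom (wreath_product \<Gamma> G) G" by (auto simp: hom_def carr mult)
  show "fst ` carrier (wreath_product \<Gamma> G) = carrier G"
    unfolding carr using N.one_closed by (intro fst_image_times[THEN trans]) auto
  have ker: "kernel (wreath_product \<Gamma> G) G fst = {\<one>\<^bsub>G\<^esub>} \<times> carrier ?N"
    by (auto simp: kernel_def carr)
  have ext: "n \<in> extensional (carrier G)" if "n \<in> carrier ?N" for n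
    using that by (simp add: carrier_sum_group[OF assms(1)] PiE_def)
  show "Pair \<one>\<^bsub>G\<^esub> \<in> iso ?N ((wreath_product \<Gamma> G)\<lparr>carrier := kernel (wreath_product \<Gamma> G) G fst\<rparr>)"
  proof (rule isoI)
    show "Pair \<one>\<^bsub>G\<^esub> \<in> hom ?N ((wreath_product \<Gamma> G)\<lparr>carrier := kernel (wreath_product \<Gamma> G) G fst\<rparr>)"
    proof (rule homI)
      fix n m assume "n \<in> carrier ?N" "m \<in> carrier ?N"
      then show "(\<one>\<^bsub>G\<^esub>, n \<otimes>\<^bsub>?N\<^esub> m) =
          (\<one>\<^bsub>G\<^esub>, n) \<otimes>\<^bsub>(wreath_product \<Gamma> G)\<lparr>carrier := kernel (wreath_product \<Gamma> G) G fst\<rparr>\<^esub> (\<one>\<^bsub>G\<^esub>, m)"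
        by (simp add: mult shift_one[OF assms(2) ext] del: mult_sum_group)
    qed (simp add: ker)
    show "bij_betw (Pair \<one>\<^bsub>G\<^esub>) (carrier ?N) (carrier ((wreath_product \<Gamma> G)\<lparr>carrier := kernel (wreath_product \<Gamma> G) G fst\<rparr>))"
      by (auto simp: ker bij_betw_def inj_on_def)
  qed
qed

theorem corollary4p5:
  fixes d :: nat
    and \<Gamma> :: "('g, 'y) monoid_scheme"
    and G :: "('a, 'x) monoid_scheme"
  assumes "d \<ge> 1"
    and "group \<Gamma>" and "amenable \<Gamma>"
    and "group G" and "Md_AP d G"
  shows "Md_AP d (wreath_product \<Gamma> G)"
proof (rule Md_AP_extension)
  have "almost_invariant_vectors (sum_group (carrier G) (\<lambda>_. \<Gamma>))"
    using assms by (intro almost_invariant_vectors_sum_group amenable_almost_invariant_vectors)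
  then show "almost_invariant_vectors ((wreath_product \<Gamma> G)\<lparr>carrier := kernel (wreath_product \<Gamma> G) G fst\<rparr>)"
    using assms by (intro almost_invariant_vectors_iso[OF _ wreath_product_projection(3)] sum_group) auto
qed (intro assms group_wreath_product wreath_product_projection)+

end
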